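(* Let $k = k(n)$ satisfy $k = \omega\left( \frac{n}{\log^{1/3} n} \right)$, let $G$ be a $k$-regular bipartite graph on $2n$ vertices, and let $\tilde{G}$ be a uniformly random graph process in $G$. Then, asymptotically almost surely, $\tau_M(\tilde{G}) = \tau_I(\tilde{G})$.
   Context: A graph process in $G=(V,E)$ is a sequence of graphs $(V,\emptyset)=G_0,G_1,\ldots,G_{|E|}=G$ on vertex set $V$ where each $G_i$ is obtained from $G_{i-1}$ by adding a single edge of $G$; a uniformly random graph process corresponds to a uniformly random ordering of $E$. For a monotone graph property $P$, the hitting time of $P$ is $\min\{t : G_t \in P\}$. $\tau_M(\tilde G)$ is the hitting time of containing a perfect matching and $\tau_I(\tilde G)$ is the hitting time of having no isolated vertices. "Asymptotically almost surely" (a.a.s.) means with probability tending to $1$ as $n\to\infty$. $\log$ denotes the natural logarithm. *)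

theory Defs
  imports Complex_Main "HOL-Combinatorics.Multiset_Permutations"
begin

definition simple_graph :: "nat set \<Rightarrow> nat set set \<Rightarrow> bool" where
  "simple_graph V E \<longleftrightarrow> (\<forall>e\<in>E. \<exists>u v. u \<noteq> v \<and> u \<in> V \<and> v \<in> V \<and> e = {u, v})"

definition degree :: "nat set set \<Rightarrow> nat \<Rightarrow> nat" where
  "degree E v = card {e \<in> E. v \<in> e}"

definition regular :: "nat set \<Rightarrow> nat set set \<Rightarrow> nat \<Rightarrow> bool" where
  "regular V E k \<longleftrightarrow> (\<forall>v\<in>V. degree E v = k)"

definition bipartite :: "nat set \<Rightarrow> nat set set \<Rightarrow> bool" where
  "bipartite V E \<longleftrightarrow> (\<exists>A \<subseteq> V. \<forall>e\<in>E. card (e \<inter> A) = 1)"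

definition has_perfect_matching :: "nat set \<Rightarrow> nat set set \<Rightarrow> bool" where
  "has_perfect_matching V F \<longleftrightarrow> (\<exists>M \<subseteq> F. \<forall>v\<in>V. \<exists>!e. e \<in> M \<and> v \<in> e)"

definition no_isolated :: "nat set \<Rightarrow> nat set set \<Rightarrow> bool" where
  "no_isolated V F \<longleftrightarrow> (\<forall>v\<in>V. \<exists>e\<in>F. v \<in> e)"

text \<open>A graph process is given by an ordering xs of the edge set; G_t = set (take t xs).
  Hitting time of a property P.\<close>

definition hitting_time :: "(nat set set \<Rightarrow> bool) \<Rightarrow> nat set list \<Rightarrow> nat" where
  "hitting_time P xs = (LEAST t. P (set (take t xs)))"

definition tau_M :: "nat set \<Rightarrow> nat set list \<Rightarrow> nat" where
  "tau_M V xs = hitting_time (has_perfect_matching V) xs"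

definition tau_I :: "nat set \<Rightarrow> nat set list \<Rightarrow> nat" where
  "tau_I V xs = hitting_time (no_isolated V) xs"

definition process_prob :: "nat set set \<Rightarrow> (nat set list \<Rightarrow> bool) \<Rightarrow> real" where
  "process_prob E Q = real (card {xs \<in> permutations_of_set E. Q xs}) / real (card (permutations_of_set E))"

end

theory Submission
  imports Defs "HOL-Library.FuncSet" "HOL-Real_Asymp.Real_Asymp"
begin

text \<open>
  Write \<open>m = n / k\<close> and \<open>L = ln n\<close>, so that \<open>m\<^sup>3 = o(L)\<close>. With high probability the hitting time of
  having no isolated vertex lies between \<open>s = 15/16 n L\<close> and \<open>t = 2 n L\<close>. If the graph \<open>H\<close> at that
  time has no perfect matching, then it has an independent set with more than \<open>n\<close> vertices. Choose a
  maximum one, \<open>I\<close>, and among these one that spans the least number \<open>x\<close> of edges of the regular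
  graph; regularity gives \<open>x \<ge> k\<close>. None of these \<open>x\<close> edges is among the first \<open>s\<close>, which has
  probability at most \<open>n\<close> to the power \<open>-(7/8) x / k\<close>.

  Both \<open>I\<close> and its complement are sparse, hence \<open>I\<close> is close to a member \<open>J\<close> of a family of only
  \<open>exp (O(m + x / k))\<close> sets. By maximality and since no vertex is isolated, every vertex
  in which \<open>I\<close> and \<open>J\<close> differ has an edge of \<open>H\<close> to the other side of \<open>I\<close>. Such an edge leads to the
  part on which \<open>I\<close> and \<open>J\<close> agree, where a vertex and its edge together contribute only a
  polylogarithmic factor to the union bound, or to another differing vertex. Minimality of \<open>x\<close> forces
  every vertex of \<open>J - I\<close> of the second kind to have two neighbours in \<open>I - J\<close>, so that either these
  vertices or the set \<open>I - J\<close> can be specified at a total cost of \<open>n\<close> to the power \<open>\<bar>I - J\<bar> / 2\<close>. As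
  \<open>\<bar>I - J\<bar>\<close> is at most \<open>(5/4) x / k\<close>, this is outweighed by the above probability.
\<close>

section \<open>Uniformly random orderings\<close>

text \<open>The obstacle is that the missing edges do not pay for naming \<open>I\<close> vertex by
  vertex. As \<open>card (I - J)\<close> may reach (5/4) x / k, they yield only a factor of about n
  to the power -7/10 for each vertex of \<open>I - J\<close>, which can be chosen in about n ways.
  Hence the vertices in which \<open>I\<close> and \<open>J\<close> differ are paid for by edges
  that are known to be present. A fixed edge is present with probability at most 2 (ln n) / k, and
  only O(x) edges join a vertex to its own side of \<open>J\<close>, so a vertex chosen together
  with such an edge has total weight O((x / k) ln n) instead of n.

  The exponent 1/3 comes from the containers. The first approximation to \<open>I\<close> may err at
  O(m^2 x / k) vertices, and the degrees into it are reliable only if this number is at most a small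
  multiple of k. Sets with x at least 4 n k / ln n are rare enough for a union bound over all
  subsets, so x / k may be taken to be O(n / ln n). Then n m^2 / ln n must be small compared with k,
  that is, m^3 small compared with ln n.\<close>

definition avoid_hit :: "'a set \<Rightarrow> nat \<Rightarrow> nat \<Rightarrow> 'a set \<Rightarrow> 'a set \<Rightarrow> 'a list set" where
  "avoid_hit E s t X Y =
     {xs \<in> permutations_of_set E. X \<inter> set (take s xs) = {} \<and> Y \<subseteq> set (take t xs)}"

lemma finite_avoid_hit: "finite (avoid_hit E s t X Y)"
  unfolding avoid_hit_def by simp

lemma map_transpose_avoid_hit:
  assumes "xs \<in> avoid_hit E s t X Y" "a \<in> E" "b \<in> E"
  shows "map (transpose a b) xs \<in> avoid_hit E s t (transpose a b ` X) (transpose a b ` Y)"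
proof -
  have "transpose a b ` E = E" using assms by (intro transpose_image_eq) auto
  moreover have "inj (transpose a b)" by (rule inj_on_transpose)
  ultimately show ?thesis
    using assms unfolding avoid_hit_def permutations_of_set_def
    by (auto simp: distinct_map take_map simp flip: image_Int intro: inj_on_subset)
qed

text \<open>Relabelling the entries by a transposition is an involution on orderings. This symmetry
  replaces every explicit enumeration of permutations.\<close>

lemma card_avoid_hit_transpose:
  assumes "a \<in> E" "b \<in> E"
  shows "card (avoid_hit E s t (transpose a b ` X) (transpose a b ` Y)) = card (avoid_hit E s t X Y)"
proof (rule sym, rule bij_betw_same_card, rule bij_betwI)
  show "map (transpose a b) \<in> avoid_hit E s t X Y \<rightarrow> avoid_hit E s t (transpose a b ` X) (transpose a b ` Y)"
    using map_transpose_avoid_hit[OF _ assms] by blast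
  show "map (transpose a b) \<in> avoid_hit E s t (transpose a b ` X) (transpose a b ` Y) \<rightarrow> avoid_hit E s t X Y"
  proof
    fix xs assume "xs \<in> avoid_hit E s t (transpose a b ` X) (transpose a b ` Y)"
    from map_transpose_avoid_hit[OF this assms] show "map (transpose a b) xs \<in> avoid_hit E s t X Y"
      by (simp add: image_image)
  qed
qed (simp_all add: comp_def)

lemma transpose_image_fix:
  assumes "a \<notin> X" "b \<notin> X" shows "transpose a b ` X = X"
  using assms by (metis image_cong image_ident transpose_apply_other)

lemma transpose_image_insert:
  assumes "a \<notin> X" "b \<notin> X" shows "transpose a b ` insert a X = insert b X"
  using transpose_image_fix[OF assms] by simp

lemma card_drop_permutation:
  assumes "xs \<in> permutations_of_set E" "s \<le> card E"
  shows "card (E - set (take s xs)) = card E - s" "card (set (take s xs)) = s"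
proof -
  have d: "distinct xs" "set xs = E" and l: "length xs = card E"
    using assms by (auto simp: permutations_of_set_def distinct_card)
  show 2: "card (set (take s xs)) = s"
    using d l assms(2) by (simp add: distinct_card)
  show "card (E - set (take s xs)) = card E - s"
    using 2 d set_take_subset[of s xs] by (subst card_Diff_subset) auto
qed

text \<open>All elements outside \<open>X \<union> Y\<close> play the same role, so the extension by one element is counted
  by summing over all of them.\<close>

lemma avoid_hit_insert_sum:
  assumes E: "finite E" and "X \<subseteq> E" "Y \<subseteq> E" "e \<in> E - X - Y"
  shows "card (avoid_hit E s t (insert e X) Y) * card (E - X - Y)
           = (\<Sum>xs\<in>avoid_hit E s t X Y. card (E - X - Y - set (take s xs)))"
    and "card (avoid_hit E s t X (insert e Y)) * card (E - X - Y)
           = (\<Sum>xs\<in>avoid_hit E s t X Y. card ((E - X - Y) \<inter> set (take t xs)))"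
proof -
  let ?R = "E - X - Y"
  have sym1: "card (avoid_hit E s t (insert f X) Y) = card (avoid_hit E s t (insert e X) Y)" if "f \<in> ?R" for f
    using card_avoid_hit_transpose[of e E f s t "insert e X" Y] that assms
    by (simp del: image_insert add: transpose_image_insert transpose_image_fix)
  have sym2: "card (avoid_hit E s t X (insert f Y)) = card (avoid_hit E s t X (insert e Y))" if "f \<in> ?R" for f
    using card_avoid_hit_transpose[of e E f s t X "insert e Y"] that assms
    by (simp del: image_insert add: transpose_image_insert transpose_image_fix)
  have fR: "finite ?R" using E by simp
  have "card (avoid_hit E s t (insert e X) Y) * card ?R = (\<Sum>f\<in>?R. card (avoid_hit E s t (insert f X) Y))"
    using sym1 by simp
  also have "\<dots> = (\<Sum>f\<in>?R. card {xs \<in> avoid_hit E s t X Y. f \<notin> set (take s xs)})"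
    by (intro sum.cong refl arg_cong[where f=card]) (auto simp: avoid_hit_def)
  also have "\<dots> = (\<Sum>f\<in>?R. \<Sum>xs\<in>avoid_hit E s t X Y. if f \<notin> set (take s xs) then 1 else 0)"
    by (simp add: sum.If_cases finite_avoid_hit Int_def)
  also have "\<dots> = (\<Sum>xs\<in>avoid_hit E s t X Y. \<Sum>f\<in>?R. if f \<notin> set (take s xs) then 1 else 0)"
    by (rule sum.swap)
  also have "\<dots> = (\<Sum>xs\<in>avoid_hit E s t X Y. card (?R - set (take s xs)))"
    using fR by (intro sum.cong refl) (auto simp: sum.If_cases intro!: arg_cong[where f=card])
  finally show "card (avoid_hit E s t (insert e X) Y) * card (E - X - Y)
           = (\<Sum>xs\<in>avoid_hit E s t X Y. card (E - X - Y - set (take s xs)))" .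
  have "card (avoid_hit E s t X (insert e Y)) * card ?R = (\<Sum>f\<in>?R. card (avoid_hit E s t X (insert f Y)))"
    using sym2 by simp
  also have "\<dots> = (\<Sum>f\<in>?R. card {xs \<in> avoid_hit E s t X Y. f \<in> set (take t xs)})"
    by (intro sum.cong refl arg_cong[where f=card]) (auto simp: avoid_hit_def)
  also have "\<dots> = (\<Sum>f\<in>?R. \<Sum>xs\<in>avoid_hit E s t X Y. if f \<in> set (take t xs) then 1 else 0)"
    by (simp add: sum.If_cases finite_avoid_hit Int_def)
  also have "\<dots> = (\<Sum>xs\<in>avoid_hit E s t X Y. \<Sum>f\<in>?R. if f \<in> set (take t xs) then 1 else 0)"
    by (rule sum.swap)
  also have "\<dots> = (\<Sum>xs\<in>avoid_hit E s t X Y. card (?R \<inter> set (take t xs)))"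
    using fR by (intro sum.cong refl) (auto simp: sum.If_cases intro!: arg_cong[where f=card])
  finally show "card (avoid_hit E s t X (insert e Y)) * card (E - X - Y)
           = (\<Sum>xs\<in>avoid_hit E s t X Y. card ((E - X - Y) \<inter> set (take t xs)))" .
qed

lemma card_hit_insert:
  assumes E: "finite E" and "Y \<subseteq> E" "e \<in> E - Y" "t \<le> card E"
  shows "card (avoid_hit E s t {} (insert e Y)) * (card E - card Y)
           = card (avoid_hit E s t {} Y) * (t - card Y)"
proof -
  have "card ((E - Y) \<inter> set (take t xs)) = t - card Y" if "xs \<in> avoid_hit E s t {} Y" for xs
  proof -
    have x: "xs \<in> permutations_of_set E" and Y: "Y \<subseteq> set (take t xs)"
      using that by (auto simp: avoid_hit_def)
    have "set (take t xs) \<subseteq> E" using x set_take_subset[of t xs] by (auto simp: permutations_of_set_def)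
    hence "(E - Y) \<inter> set (take t xs) = set (take t xs) - Y" by auto
    thus ?thesis using Y card_drop_permutation(2)[OF x assms(4)]
      by (metis card_Diff_subset finite_set finite_subset)
  qed
  moreover have "card (E - Y) = card E - card Y" using assms by (meson card_Diff_subset finite_subset)
  ultimately show ?thesis using avoid_hit_insert_sum(2)[of E "{}" Y e s t] assms by simp
qed

text \<open>Exactly \<open>card E - s - card X\<close> elements outside \<open>X\<close> miss the
  first \<open>s\<close> places. Some of them may belong to \<open>Y\<close>, which need only occur
  before \<open>t\<close>; hence an inequality in general and an equality for empty
  \<open>Y\<close>.\<close>

lemma card_avoid_insert:
  assumes E: "finite E" and "X \<subseteq> E" "Y \<subseteq> E" "X \<inter> Y = {}" "e \<in> E - X - Y" "s \<le> card E"
  shows "card (avoid_hit E s t (insert e X) Y) * (card E - card Y - card X)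
           \<le> card (avoid_hit E s t X Y) * (card E - s - card X)" (is ?le)
    and "Y = {} \<Longrightarrow> card (avoid_hit E s t (insert e X) Y) * (card E - card Y - card X)
           = card (avoid_hit E s t X Y) * (card E - s - card X)"
proof -
  have fXY: "finite X" "finite Y" using assms by (auto intro: finite_subset)
  have R: "card (E - X - Y) = card E - card Y - card X"
  proof -
    have "E - X - Y = E - (Y \<union> X)" by auto
    thus ?thesis using assms fXY by (simp add: card_Diff_subset card_Un_disjoint Int_commute)
  qed
  have 1: "card (E - X - Y - set (take s xs)) \<le> card E - s - card X"
    and 2: "Y = {} \<Longrightarrow> card (E - X - Y - set (take s xs)) = card E - s - card X"
    if "xs \<in> avoid_hit E s t X Y" for xs
  proof -
    have x: "xs \<in> permutations_of_set E" and X: "X \<inter> set (take s xs) = {}"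
      using that by (auto simp: avoid_hit_def)
    have *: "card (E - set (take s xs) - X) = card E - s - card X"
      using card_drop_permutation(1)[OF x assms(6)] assms X fXY by (subst card_Diff_subset) auto
    have "card (E - X - Y - set (take s xs)) \<le> card (E - set (take s xs) - X)"
      using E by (intro card_mono) auto
    thus "card (E - X - Y - set (take s xs)) \<le> card E - s - card X" using * by simp
    assume "Y = {}"
    hence "E - X - Y - set (take s xs) = E - set (take s xs) - X" by auto
    thus "card (E - X - Y - set (take s xs)) = card E - s - card X" using * by simp
  qed
  show ?le using avoid_hit_insert_sum(1)[of E X Y e s t] R sum_mono[OF 1] assms
    by simp
  assume "Y = {}"
  thus "card (avoid_hit E s t (insert e X) Y) * (card E - card Y - card X)
           = card (avoid_hit E s t X Y) * (card E - s - card X)"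
    using avoid_hit_insert_sum(1)[of E X Y e s t] R 2 assms by simp
qed

text \<open>Each new element of \<open>Y\<close> contributes a factor (t - y) / (N - y), which
  decreases in y and is therefore at most t / N.\<close>

lemma card_hit_le:
  assumes E: "finite E" and Y: "Y \<subseteq> E" and t: "t \<le> card E"
  shows "real (card (avoid_hit E s t {} Y)) \<le> fact (card E) * (real t / real (card E)) ^ card Y"
  using finite_subset[OF Y E] Y
proof (induction Y rule: finite_induct)
  case empty
  have "card (avoid_hit E s t {} {}) = fact (card E)" using E by (simp add: avoid_hit_def)
  thus ?case by simp
next
  case (insert e Y)
  let ?N = "card E" let ?a = "\<lambda>Y. real (card (avoid_hit E s t {} Y))"
  have lt: "card Y < ?N" using insert E by (metis card_insert_disjoint card_mono less_eq_Suc_le)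
  have eq: "?a (insert e Y) * (real ?N - real (card Y)) = ?a Y * real (t - card Y)"
    using card_hit_insert[OF E, of Y e t s] insert lt t
    by (metis DiffI insert_subset of_nat_diff of_nat_mult order_less_imp_le)
  have "real (t - card Y) * real ?N \<le> real t * (real ?N - real (card Y))"
  proof (cases "card Y \<le> t")
    case True thus ?thesis using t
      by (simp add: of_nat_diff algebra_simps mult_right_mono)
  next
    case False thus ?thesis using lt by simp
  qed
  hence "real (t - card Y) / (real ?N - real (card Y)) \<le> real t / real ?N"
    using lt by (simp add: divide_simps)
  hence "?a Y * (real (t - card Y) / (real ?N - real (card Y))) \<le> (fact ?N * (real t / real ?N) ^ card Y) * (real t / real ?N)"
    using insert lt by (intro mult_mono) (auto intro!: divide_nonneg_nonneg)
  moreover have "?a (insert e Y) = ?a Y * (real (t - card Y) / (real ?N - real (card Y)))"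
    using eq lt by (simp add: field_simps)
  ultimately show ?case using insert by (simp add: mult_ac)
qed

text \<open>\<open>Y\<close> is placed first, then \<open>X\<close> grows by factors at most (N - s
  - x) / (N - y - x). These decrease in x exactly because y is at most \<open>s\<close>, so the
  first one bounds them all.\<close>

lemma card_avoid_hit_le:
  assumes E: "finite E" and X: "X \<subseteq> E" and Y: "Y \<subseteq> E" and XY: "X \<inter> Y = {}"
    and t: "t \<le> card E" and s: "card Y \<le> s" "s \<le> card E"
  shows "real (card (avoid_hit E s t X Y))
    \<le> fact (card E) * (real t / real (card E)) ^ card Y
        * ((real (card E) - real s) / (real (card E) - real (card Y))) ^ card X"
  using finite_subset[OF X E] X XY
proof (induction X rule: finite_induct)
  case empty thus ?case using card_hit_le[OF E Y t] by simp
next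
  case (insert e X)
  let ?N = "card E" let ?a = "\<lambda>X. real (card (avoid_hit E s t X Y))" let ?y = "card Y"
  let ?C = "fact (card E) * (real t / real (card E)) ^ card Y" let ?\<rho> = "(real ?N - real s) / (real ?N - real ?y)"
  have "card (insert e X) + ?y = card (insert e X \<union> Y)"
    using insert Y E by (subst card_Un_disjoint) (auto intro: finite_subset)
  also have "\<dots> \<le> ?N" using insert Y E by (intro card_mono) auto
  finally have lt: "card X + ?y < ?N" using insert by simp
  have eq: "?a (insert e X) * (real ?N - real ?y - real (card X)) \<le> ?a X * real (?N - s - card X)"
  proof -
    have "card (avoid_hit E s t (insert e X) Y) * (?N - ?y - card X) \<le> card (avoid_hit E s t X Y) * (?N - s - card X)"
      using card_avoid_insert(1)[OF E, of X Y e s t] insert Y s by auto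
    hence "real (card (avoid_hit E s t (insert e X) Y) * (?N - ?y - card X)) \<le> real (card (avoid_hit E s t X Y) * (?N - s - card X))"
      by (rule of_nat_mono)
    moreover have "real (?N - ?y - card X) = real ?N - real ?y - real (card X)" using lt by (simp add: of_nat_diff)
    ultimately show ?thesis unfolding of_nat_mult by (simp only:)
  qed
  have "real (?N - s - card X) * (real ?N - real ?y) \<le> (real ?N - real s) * (real ?N - real ?y - real (card X))"
  proof (cases "s + card X \<le> ?N")
    case True
    have "real ?y * real (card X) \<le> real s * real (card X)" using s by (intro mult_right_mono) auto
    thus ?thesis using True by (simp add: of_nat_diff algebra_simps)
  next
    case False thus ?thesis using lt s by simp
  qed
  hence "real (?N - s - card X) / (real ?N - real ?y - real (card X)) \<le> ?\<rho>"
    using lt by (simp add: divide_simps)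
  hence "?a X * (real (?N - s - card X) / (real ?N - real ?y - real (card X))) \<le> (?C * ?\<rho> ^ card X) * ?\<rho>"
    using insert s lt by (intro mult_mono divide_nonneg_nonneg zero_le_power mult_nonneg_nonneg) auto
  moreover have "?a (insert e X) \<le> ?a X * (real (?N - s - card X) / (real ?N - real ?y - real (card X)))"
    using eq lt by (simp add: field_simps)
  ultimately show ?case using insert by (simp add: mult_ac)
qed

text \<open>The exact value serves the second moment argument, which needs the mean and not only an
  upper bound of it.\<close>

lemma card_avoid_eq:
  assumes E: "finite E" and X: "X \<subseteq> E" and s: "s + card X \<le> card E"
  shows "real (card (avoid_hit E s t X {}))
    = fact (card E) * (\<Prod>i<card X. (real (card E) - real s - real i) / (real (card E) - real i))"
  using finite_subset[OF X E] X s
proof (induction X rule: finite_induct)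
  case empty
  have "card (avoid_hit E s t {} {}) = fact (card E)" using E by (simp add: avoid_hit_def)
  thus ?case by simp
next
  case (insert e X)
  let ?N = "card E" let ?a = "\<lambda>X. real (card (avoid_hit E s t X {}))"
  have lt: "card X < ?N" "s + card X < ?N" using insert by auto
  have "card (avoid_hit E s t (insert e X) {}) * (?N - card X) = card (avoid_hit E s t X {}) * (?N - s - card X)"
    using card_avoid_insert(2)[OF E, of X "{}" e s t] insert s by auto
  hence "real (card (avoid_hit E s t (insert e X) {}) * (?N - card X)) = real (card (avoid_hit E s t X {}) * (?N - s - card X))"
    by (rule arg_cong)
  hence "?a (insert e X) * (real ?N - real (card X)) = ?a X * (real ?N - real s - real (card X))"
    using lt by (simp add: of_nat_diff)
  hence "?a (insert e X) = ?a X * ((real ?N - real s - real (card X)) / (real ?N - real (card X)))"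
    using lt by (simp add: field_simps)
  thus ?case using insert by simp
qed

section \<open>Union bounds for the uniformly random process\<close>

lemma card_permutations_pos: "finite E \<Longrightarrow> card (permutations_of_set E) > 0"
  by (simp add: card_gt_0_iff)

lemma process_prob_mono:
  assumes "finite E" "\<And>xs. xs \<in> permutations_of_set E \<Longrightarrow> Q xs \<Longrightarrow> R xs"
  shows "process_prob E Q \<le> process_prob E R"
  unfolding process_prob_def
  by (intro divide_right_mono of_nat_mono card_mono) (use assms in auto)

lemma process_prob_not:
  assumes "finite E"
  shows "process_prob E Q = 1 - process_prob E (\<lambda>xs. \<not> Q xs)"
proof -
  let ?\<Omega> = "permutations_of_set E"
  have "card ?\<Omega> = card {xs \<in> ?\<Omega>. Q xs} + card {xs \<in> ?\<Omega>. \<not> Q xs}"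
    by (subst card_Un_disjoint[symmetric]) (auto intro!: arg_cong[where f=card])
  hence "real (card {xs \<in> ?\<Omega>. Q xs}) = real (card ?\<Omega>) - real (card {xs \<in> ?\<Omega>. \<not> Q xs})" by linarith
  thus ?thesis using assms card_permutations_pos[OF assms]
    by (simp add: process_prob_def diff_divide_distrib del: card_permutations_of_set)
qed

lemma process_prob_UN:
  assumes "finite I"
  shows "process_prob E (\<lambda>xs. \<exists>i\<in>I. Q i xs) \<le> (\<Sum>i\<in>I. process_prob E (Q i))"
proof -
  have "{xs \<in> permutations_of_set E. \<exists>i\<in>I. Q i xs} = (\<Union>i\<in>I. {xs \<in> permutations_of_set E. Q i xs})"
    by auto
  hence "card {xs \<in> permutations_of_set E. \<exists>i\<in>I. Q i xs} \<le> (\<Sum>i\<in>I. card {xs \<in> permutations_of_set E. Q i xs})"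
    using card_UN_le[OF assms, of "\<lambda>i. {xs \<in> permutations_of_set E. Q i xs}"] by simp
  hence "real (card {xs \<in> permutations_of_set E. \<exists>i\<in>I. Q i xs}) \<le> (\<Sum>i\<in>I. real (card {xs \<in> permutations_of_set E. Q i xs}))"
    unfolding of_nat_sum[symmetric] by (rule of_nat_mono)
  thus ?thesis unfolding process_prob_def sum_divide_distrib[symmetric]
    by (intro divide_right_mono) auto
qed

lemma process_prob_disj:
  "process_prob E (\<lambda>xs. Q xs \<or> R xs) \<le> process_prob E Q + process_prob E R"
proof -
  have "(\<lambda>xs. \<exists>b\<in>{True, False}. (if b then Q else R) xs) = (\<lambda>xs. Q xs \<or> R xs)" by auto
  thus ?thesis using process_prob_UN[of "{True, False}" E "\<lambda>b. if b then Q else R"] by simp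
qed

lemma process_prob_avoid_hit_le:
  assumes "finite E" "X \<subseteq> E" "Y \<subseteq> E" "X \<inter> Y = {}" "t \<le> card E" "card Y \<le> s" "s \<le> card E"
    and p: "real t / real (card E) \<le> p"
    and q: "(real (card E) - real s) / (real (card E) - real (card Y)) \<le> q"
  shows "process_prob E (\<lambda>xs. X \<inter> set (take s xs) = {} \<and> Y \<subseteq> set (take t xs)) \<le> p ^ card Y * q ^ card X"
proof -
  have "real (card (avoid_hit E s t X Y)) / fact (card E)
     \<le> (real t / real (card E)) ^ card Y * ((real (card E) - real s) / (real (card E) - real (card Y))) ^ card X"
    using divide_right_mono[OF card_avoid_hit_le[OF assms(1-7)], of "fact (card E)"] by (simp add: mult_ac)
  also have "\<dots> \<le> p ^ card Y * q ^ card X"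
    using assms order_trans[OF _ p, of 0] by (intro mult_mono power_mono) auto
  finally show ?thesis using assms(1) by (simp add: process_prob_def avoid_hit_def)
qed

text \<open>A union bound over the choice functions in \<open>PiE \<Lambda> Opt\<close>. Options of
  different indices are disjoint, so the sizes of the chosen sets add up and the sum over all choice
  functions factors into a product over the indices.\<close>

lemma process_prob_choices:
  fixes Opt :: "'i \<Rightarrow> nat set set set"
  assumes "finite E" and fin: "finite \<Lambda>" "\<And>i. i \<in> \<Lambda> \<Longrightarrow> finite (Opt i)"
    and opt: "\<And>i Y. i \<in> \<Lambda> \<Longrightarrow> Y \<in> Opt i \<Longrightarrow> Y \<subseteq> E \<and> X \<inter> Y = {} \<and> card Y = c i"
    and dis: "\<And>i i' Y Y'. i \<in> \<Lambda> \<Longrightarrow> i' \<in> \<Lambda> \<Longrightarrow> i \<noteq> i' \<Longrightarrow> Y \<in> Opt i \<Longrightarrow> Y' \<in> Opt i' \<Longrightarrow> Y \<inter> Y' = {}"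
    and b: "\<And>i. i \<in> \<Lambda> \<Longrightarrow> real (card (Opt i)) * p ^ c i \<le> b i" and p: "p \<ge> 0" and Z: "Z \<ge> 0"
    and pr: "\<And>Y. Y \<subseteq> E \<Longrightarrow> X \<inter> Y = {} \<Longrightarrow> card Y = sum c \<Lambda> \<Longrightarrow>
      process_prob E (\<lambda>xs. X \<inter> set (take s xs) = {} \<and> Y \<subseteq> set (take t xs)) \<le> p ^ card Y * Z"
  shows "process_prob E (\<lambda>xs. X \<inter> set (take s xs) = {} \<and> (\<forall>i\<in>\<Lambda>. \<exists>Y\<in>Opt i. Y \<subseteq> set (take t xs)))
    \<le> (\<Prod>i\<in>\<Lambda>. b i) * Z"
proof -
  let ?H = "PiE \<Lambda> Opt"
  let ?ev = "\<lambda>h xs. X \<inter> set (take s xs) = {} \<and> (\<Union>i\<in>\<Lambda>. h i) \<subseteq> set (take t xs)"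
  have finH: "finite ?H" using fin by (intro finite_PiE)
  have "process_prob E (\<lambda>xs. X \<inter> set (take s xs) = {} \<and> (\<forall>i\<in>\<Lambda>. \<exists>Y\<in>Opt i. Y \<subseteq> set (take t xs)))
     \<le> process_prob E (\<lambda>xs. \<exists>h\<in>?H. ?ev h xs)"
  proof (rule process_prob_mono[OF \<open>finite E\<close>])
    fix xs assume a: "X \<inter> set (take s xs) = {} \<and> (\<forall>i\<in>\<Lambda>. \<exists>Y\<in>Opt i. Y \<subseteq> set (take t xs))"
    then obtain h where "\<forall>i\<in>\<Lambda>. h i \<in> Opt i \<and> h i \<subseteq> set (take t xs)" by metis
    hence "restrict h \<Lambda> \<in> ?H" "?ev (restrict h \<Lambda>) xs" using a by auto
    thus "\<exists>h\<in>?H. ?ev h xs" by blast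
  qed
  also have "\<dots> \<le> (\<Sum>h\<in>?H. process_prob E (?ev h))" by (rule process_prob_UN[OF finH])
  also have "\<dots> \<le> (\<Sum>h\<in>?H. p ^ sum c \<Lambda> * Z)"
  proof (rule sum_mono)
    fix h assume h: "h \<in> ?H"
    have hi: "h i \<in> Opt i" if "i \<in> \<Lambda>" for i using h that by auto
    have fh: "finite (h i)" if "i \<in> \<Lambda>" for i
      using opt[OF that hi[OF that]] \<open>finite E\<close> finite_subset by blast
    have "card (\<Union>i\<in>\<Lambda>. h i) = (\<Sum>i\<in>\<Lambda>. card (h i))"
      using fin(1) fh hi dis by (intro card_UN_disjoint) auto
    also have "\<dots> = sum c \<Lambda>" using opt hi by (intro sum.cong) auto
    finally have cd: "card (\<Union>i\<in>\<Lambda>. h i) = sum c \<Lambda>" .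
    have "(\<Union>i\<in>\<Lambda>. h i) \<subseteq> E" using opt hi by blast
    moreover have "X \<inter> (\<Union>i\<in>\<Lambda>. h i) = {}" using opt hi by blast
    ultimately show "process_prob E (?ev h) \<le> p ^ sum c \<Lambda> * Z"
      using pr[of "\<Union>i\<in>\<Lambda>. h i"] cd by simp
  qed
  also have "\<dots> = real (card ?H) * (p ^ sum c \<Lambda> * Z)" by simp
  also have "\<dots> = (\<Prod>i\<in>\<Lambda>. real (card (Opt i)) * p ^ c i) * Z"
    using fin by (simp add: card_PiE prod.distrib power_sum)
  also have "\<dots> \<le> (\<Prod>i\<in>\<Lambda>. b i) * Z"
    using b p Z by (intro mult_right_mono prod_mono) auto
  finally show ?thesis .
qed

section \<open>Weighted sums over small subsets, and the second moment\<close>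

lemma sum_Pow_prod:
  fixes f :: "'a \<Rightarrow> real"
  assumes "finite V"
  shows "(\<Sum>P\<in>Pow V. \<Prod>v\<in>P. f v) = (\<Prod>v\<in>V. 1 + f v)"
  using assms
proof (induction V rule: finite_induct)
  case (insert a V)
  have "(\<Sum>P\<in>Pow (insert a V). prod f P) = (\<Sum>P\<in>Pow V. prod f P) + (\<Sum>P\<in>insert a ` Pow V. prod f P)"
    unfolding Pow_insert using insert by (intro sum.union_disjoint) auto
  also have "(\<Sum>P\<in>insert a ` Pow V. prod f P) = (\<Sum>P\<in>Pow V. prod f (insert a P))"
    using insert by (intro sum.reindex[THEN trans]) (auto simp: inj_on_def)
  also have "\<dots> = (\<Sum>P\<in>Pow V. f a * prod f P)"
    using insert by (intro sum.cong refl prod.insert) (auto intro: finite_subset)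
  finally show ?case using insert by (simp add: sum_distrib_left[symmetric] algebra_simps)
qed simp

text \<open>Rankin's trick: on sets of at most \<open>R\<close> elements every weight may be divided
  by \<open>c\<close> at the price of \<open>c ^ R\<close>. The sum over all subsets is then a
  product, bounded by 1 + x \<le> exp x.\<close>

lemma sum_subsets_prod_le:
  fixes f :: "'a \<Rightarrow> real"
  assumes "finite V" "\<And>v. v \<in> V \<Longrightarrow> f v \<ge> 0" "c \<ge> 1"
  shows "(\<Sum>P | P \<subseteq> V \<and> card P \<le> R. \<Prod>v\<in>P. f v) \<le> c ^ R * exp ((\<Sum>v\<in>V. f v) / c)"
proof -
  have "(\<Sum>P | P \<subseteq> V \<and> card P \<le> R. \<Prod>v\<in>P. f v) \<le> (\<Sum>P | P \<subseteq> V \<and> card P \<le> R. c ^ R * (\<Prod>v\<in>P. f v / c))"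
  proof (rule sum_mono)
    fix P assume "P \<in> {P. P \<subseteq> V \<and> card P \<le> R}"
    hence P: "P \<subseteq> V" "card P \<le> R" "finite P" using assms(1) by (auto intro: finite_subset)
    have "(\<Prod>v\<in>P. f v) = c ^ card P * (\<Prod>v\<in>P. f v / c)"
      using assms(3) by (simp add: prod_dividef)
    also have "\<dots> \<le> c ^ R * (\<Prod>v\<in>P. f v / c)"
      using P assms by (intro mult_right_mono power_increasing prod_nonneg) auto
    finally show "(\<Prod>v\<in>P. f v) \<le> c ^ R * (\<Prod>v\<in>P. f v / c)" .
  qed
  also have "\<dots> \<le> (\<Sum>P\<in>Pow V. c ^ R * (\<Prod>v\<in>P. f v / c))"
    using assms by (intro sum_mono2) (auto intro!: mult_nonneg_nonneg prod_nonneg)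
  also have "\<dots> = c ^ R * (\<Prod>v\<in>V. 1 + f v / c)"
    unfolding sum_distrib_left[symmetric] sum_Pow_prod[OF assms(1)] ..
  also have "\<dots> \<le> c ^ R * (\<Prod>v\<in>V. exp (f v / c))"
    using assms by (intro mult_left_mono prod_mono) (auto intro: add_nonneg_nonneg exp_ge_add_one_self)
  also have "\<dots> = c ^ R * exp ((\<Sum>v\<in>V. f v) / c)"
    using assms(1) by (simp add: exp_sum sum_divide_distrib)
  finally show ?thesis .
qed

text \<open>Chebyshev's inequality; avoiding two disjoint sets is negatively correlated.\<close>

lemma process_prob_all_hit_le:
  assumes E: "finite E" and A: "finite A" and X: "\<And>v. v \<in> A \<Longrightarrow> X v \<subseteq> E \<and> card (X v) = k"
    and dis: "\<And>v w. v \<in> A \<Longrightarrow> w \<in> A \<Longrightarrow> v \<noteq> w \<Longrightarrow> X v \<inter> X w = {}"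
    and s: "s + 2 * k \<le> card E"
    and \<pi>: "\<pi> = (\<Prod>i<k. (real (card E) - real s - real i) / (real (card E) - real i))"
    and pos: "\<pi> > 0" "A \<noteq> {}"
  shows "process_prob E (\<lambda>xs. \<forall>v\<in>A. X v \<inter> set (take s xs) \<noteq> {}) \<le> 1 / (real (card A) * \<pi>)"
proof -
  let ?\<Omega> = "permutations_of_set E" and ?N = "card E"
  define M :: real where "M = fact ?N"
  have M: "M > 0" "real (card ?\<Omega>) = M" using E by (auto simp: M_def)
  define I where "I v xs = (if X v \<inter> set (take s xs) = {} then 1 else 0 :: real)" for v xs
  define Z where "Z xs = (\<Sum>v\<in>A. I v xs)" for xs
  define \<mu> where "\<mu> = real (card A) * \<pi>"
  have \<mu>: "\<mu> > 0" using pos A by (auto simp: \<mu>_def card_gt_0_iff)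
  have single: "(\<Sum>xs\<in>?\<Omega>. I v xs) = M * \<pi>" if "v \<in> A" for v
  proof -
    have "(\<Sum>xs\<in>?\<Omega>. I v xs) = real (card (avoid_hit E s s (X v) {}))"
      by (simp add: I_def sum.If_cases avoid_hit_def Int_def)
    thus ?thesis using card_avoid_eq[OF E, of "X v" s s] X[OF that] s by (simp add: M_def \<pi>)
  qed
  have pair: "(\<Sum>xs\<in>?\<Omega>. I v xs * I w xs) \<le> M * \<pi> * \<pi>" if vw: "v \<in> A" "w \<in> A" "v \<noteq> w" for v w
  proof -
    have fX: "finite (X v)" "finite (X w)" using X vw E by (meson finite_subset)+
    have c2: "card (X v \<union> X w) = k + k" using X vw dis fX by (subst card_Un_disjoint) auto
    have "(\<Sum>xs\<in>?\<Omega>. I v xs * I w xs) = (\<Sum>xs\<in>?\<Omega>. if (X v \<union> X w) \<inter> set (take s xs) = {} then 1 else 0)"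
      by (intro sum.cong) (auto simp: I_def)
    also have "\<dots> = real (card (avoid_hit E s s (X v \<union> X w) {}))"
      by (simp add: sum.If_cases avoid_hit_def Int_def)
    also have "\<dots> = M * (\<Prod>i<k+k. (real ?N - real s - real i) / (real ?N - real i))"
      using card_avoid_eq[OF E, of "X v \<union> X w" s s] X vw s c2 by (simp add: M_def)
    also have "(\<Prod>i<k+k. (real ?N - real s - real i) / (real ?N - real i))
       = \<pi> * (\<Prod>i<k. (real ?N - real s - real (i + k)) / (real ?N - real (i + k)))"
    proof -
      have "(\<Prod>i<k+k. (real ?N - real s - real i) / (real ?N - real i))
         = (\<Prod>i<k. (real ?N - real s - real i) / (real ?N - real i)) * (\<Prod>i\<in>{k..<k+k}. (real ?N - real s - real i) / (real ?N - real i))"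
        by (subst prod.union_disjoint[symmetric]) (auto intro!: prod.cong)
      also have "(\<Prod>i\<in>{k..<k+k}. (real ?N - real s - real i) / (real ?N - real i))
         = (\<Prod>i<k. (real ?N - real s - real (i + k)) / (real ?N - real (i + k)))"
        using prod.shift_bounds_nat_ivl[of "\<lambda>i. (real ?N - real s - real i) / (real ?N - real i)" 0 k k]
        by (simp add: atLeast0LessThan)
      finally show ?thesis by (simp add: \<pi>)
    qed
    also have "M * (\<pi> * (\<Prod>i<k. (real ?N - real s - real (i + k)) / (real ?N - real (i + k)))) \<le> M * (\<pi> * \<pi>)"
    proof -
      have "(\<Prod>i<k. (real ?N - real s - real (i + k)) / (real ?N - real (i + k))) \<le> \<pi>"
        unfolding \<pi>
      proof (intro prod_mono conjI)
        fix i assume "i \<in> {..<k}"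
        hence i: "i + k < ?N" "s + (i + k) \<le> ?N" using s by auto
        have i': "real i + real k < real ?N" "real s + (real i + real k) \<le> real ?N"
          using i(1) i(2) by linarith+
        show "0 \<le> (real ?N - real s - real (i + k)) / (real ?N - real (i + k))"
          using i' by (auto intro!: divide_nonneg_nonneg)
        have "real s / (real ?N - real i) \<le> real s / (real ?N - real (i + k))"
          using i' by (intro divide_left_mono) auto
        moreover have eq: "(real ?N - real s - real j) / (real ?N - real j) = 1 - real s / (real ?N - real j)"
          if "real j < real ?N" for j using that by (simp add: field_simps)
        ultimately show "(real ?N - real s - real (i + k)) / (real ?N - real (i + k)) \<le> (real ?N - real s - real i) / (real ?N - real i)"
          using i' unfolding eq[OF i'(1)[folded of_nat_add]] by (subst eq) auto
      qed
      thus ?thesis using M pos by (intro mult_left_mono) auto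
    qed
    finally show ?thesis by (simp add: mult_ac)
  qed
  have m1: "(\<Sum>xs\<in>?\<Omega>. Z xs) = \<mu> * M"
    unfolding Z_def by (subst sum.swap) (simp add: single \<mu>_def)
  have m2: "(\<Sum>xs\<in>?\<Omega>. Z xs * Z xs) \<le> \<mu> * M + \<mu> * \<mu> * M"
  proof -
    have "(\<Sum>xs\<in>?\<Omega>. Z xs * Z xs) = (\<Sum>xs\<in>?\<Omega>. \<Sum>v\<in>A. \<Sum>w\<in>A. I v xs * I w xs)"
      by (simp add: Z_def sum_product)
    also have "\<dots> = (\<Sum>v\<in>A. \<Sum>w\<in>A. \<Sum>xs\<in>?\<Omega>. I v xs * I w xs)"
      by (subst sum.swap, intro sum.cong refl, rule sum.swap)
    also have "\<dots> \<le> (\<Sum>v\<in>A. \<Sum>w\<in>A. M * \<pi> * \<pi> + (if v = w then M * \<pi> else 0))"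
    proof (intro sum_mono)
      fix v w assume vw: "v \<in> A" "w \<in> A"
      show "(\<Sum>xs\<in>?\<Omega>. I v xs * I w xs) \<le> M * \<pi> * \<pi> + (if v = w then M * \<pi> else 0)"
      proof (cases "v = w")
        case True
        have "(\<Sum>xs\<in>?\<Omega>. I v xs * I w xs) = (\<Sum>xs\<in>?\<Omega>. I v xs)"
          using True by (intro sum.cong) (auto simp: I_def)
        thus ?thesis using single[OF vw(1)] True M by (simp add: mult.assoc)
      qed (use pair vw in auto)
    qed
    also have "\<dots> = \<mu> * M + \<mu> * \<mu> * M"
      using A by (simp add: sum.distrib \<mu>_def algebra_simps)
    finally show ?thesis .
  qed
  let ?B = "{xs \<in> ?\<Omega>. \<forall>v\<in>A. X v \<inter> set (take s xs) \<noteq> {}}"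
  \<comment> \<open>On \<open>?B\<close> no set is avoided, so \<open>Z\<close> is 0 there and its
    deviation from the mean is all of \<mu>.\<close>
  have "real (card ?B) * (\<mu> * \<mu>) = (\<Sum>xs\<in>?B. (Z xs - \<mu>) * (Z xs - \<mu>))"
    by (simp add: Z_def I_def)
  also have "\<dots> \<le> (\<Sum>xs\<in>?\<Omega>. (Z xs - \<mu>) * (Z xs - \<mu>))"
    by (intro sum_mono2) auto
  also have "\<dots> = (\<Sum>xs\<in>?\<Omega>. Z xs * Z xs) - 2 * \<mu> * (\<Sum>xs\<in>?\<Omega>. Z xs) + \<mu> * \<mu> * M"
    unfolding M(2)[symmetric]
    by (simp add: algebra_simps sum.distrib sum_subtractf sum_distrib_left del: card_permutations_of_set)
  also have "\<dots> \<le> \<mu> * M" using m2 unfolding m1 by (simp add: algebra_simps)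
  finally have "real (card ?B) * \<mu> \<le> M" using \<mu> by (simp add: mult.assoc[symmetric] mult.commute)
  thus ?thesis using M \<mu> unfolding process_prob_def \<mu>_def[symmetric]
    by (simp add: field_simps del: card_permutations_of_set)
qed

section \<open>Regular graphs and independent sets\<close>

text \<open>Rado's argument: a vertex with two choices can always give one of them up.\<close>

lemma hall_marriage:
  fixes N :: "'a \<Rightarrow> 'b set"
  assumes "finite A" "\<And>a. a \<in> A \<Longrightarrow> finite (N a)" "\<And>S. S \<subseteq> A \<Longrightarrow> card S \<le> card (\<Union>a\<in>S. N a)"
  shows "\<exists>f. inj_on f A \<and> (\<forall>a\<in>A. f a \<in> N a)"
  using assms(2,3)
proof (induction "\<Sum>a\<in>A. card (N a)" arbitrary: N rule: less_induct)
  case less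
  note fin = less.prems(1) and hall = less.prems(2)
  show ?case
  proof (cases "\<forall>a\<in>A. card (N a) \<le> 1")
    case True
    have one: "\<exists>x. N a = {x}" if "a \<in> A" for a
    proof -
      have "card (N a) = 1" using hall[of "{a}"] that True by force
      thus ?thesis by (simp add: card_1_singleton_iff)
    qed
    then obtain f where f: "\<And>a. a \<in> A \<Longrightarrow> N a = {f a}" by metis
    have "inj_on f A"
    proof (rule inj_onI, rule ccontr)
      fix a b assume ab: "a \<in> A" "b \<in> A" "f a = f b" "a \<noteq> b"
      show False using hall[of "{a, b}"] ab f by simp
    qed
    thus ?thesis using f by (intro exI[of _ f]) auto
  next
    case False
    then obtain a where a: "a \<in> A" "card (N a) > 1" by auto
    then obtain x y where xy: "x \<in> N a" "y \<in> N a" "x \<noteq> y"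
      by (metis card_le_Suc0_iff_eq fin One_nat_def not_less)
    \<comment> \<open>Without \<open>z\<close> in \<open>N a\<close>, either Hall's condition
      survives and the induction hypothesis applies, or it has a violator. The violator must contain
      \<open>a\<close>; the \<open>S\<close> of the claim is the violator without
      \<open>a\<close>.\<close>
    have shrink: "(\<exists>f. inj_on f A \<and> (\<forall>a\<in>A. f a \<in> N a)) \<or>
        (\<exists>S. S \<subseteq> A - {a} \<and> card ((\<Union>b\<in>S. N b) \<union> (N a - {z})) \<le> card S)" if z: "z \<in> N a" for z
    proof (cases "\<forall>S\<subseteq>A. card S \<le> card (\<Union>b\<in>S. (N(a := N a - {z})) b)")
      case True
      have "(\<Sum>b\<in>A. card ((N(a := N a - {z})) b)) < (\<Sum>b\<in>A. card (N b))"
        using z a fin assms(1)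
        by (intro sum_strict_mono_ex1) (auto simp: card_Diff_singleton intro!: bexI[of _ a])
      hence "\<exists>f. inj_on f A \<and> (\<forall>b\<in>A. f b \<in> (N(a := N a - {z})) b)"
        using True fin by (intro less.hyps) auto
      thus ?thesis by (metis DiffD1 fun_upd_apply)
    next
      case False
      then obtain S where S: "S \<subseteq> A" "card (\<Union>b\<in>S. (N(a := N a - {z})) b) < card S" by auto
      have aS: "a \<in> S"
      proof (rule ccontr)
        assume "a \<notin> S"
        hence "(\<Union>b\<in>S. (N(a := N a - {z})) b) = (\<Union>b\<in>S. N b)" by auto
        thus False using S hall[of S] by simp
      qed
      have "(\<Union>b\<in>S. (N(a := N a - {z})) b) = (\<Union>b\<in>S - {a}. N b) \<union> (N a - {z})" using aS by auto
      moreover have "card S = Suc (card (S - {a}))" using aS S assms(1) by (metis card.remove finite_subset)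
      ultimately have "card ((\<Union>b\<in>S - {a}. N b) \<union> (N a - {z})) \<le> card (S - {a})" using S(2) by simp
      thus ?thesis using S(1) by blast
    qed
    show ?thesis
    proof (rule ccontr)
      assume no: "\<not> ?thesis"
      obtain S where S: "S \<subseteq> A - {a}" "card ((\<Union>b\<in>S. N b) \<union> (N a - {x})) \<le> card S"
        using shrink[OF xy(1)] no by blast
      obtain T where T: "T \<subseteq> A - {a}" "card ((\<Union>b\<in>T. N b) \<union> (N a - {y})) \<le> card T"
        using shrink[OF xy(2)] no by blast
      let ?U = "(\<Union>b\<in>S. N b) \<union> (N a - {x})" and ?W = "(\<Union>b\<in>T. N b) \<union> (N a - {y})"
      have fST: "finite S" "finite T" using S T assms(1) by (auto intro: finite_subset)
      have fUW: "finite ?U" "finite ?W" using S T fin a fST by auto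
      \<comment> \<open>Submodularity: \<open>?U \<union> ?W\<close> contains all of
        \<open>N a\<close> because x and y differ. So Hall's condition for
        \<open>insert a (S \<union> T)\<close> and for \<open>S \<inter> T\<close> makes the two
        cardinalities add up to more than the violators allow.\<close>
      have "card (insert a (S \<union> T)) \<le> card (\<Union>b\<in>insert a (S \<union> T). N b)"
        using S T a by (intro hall) auto
      also have "(\<Union>b\<in>insert a (S \<union> T). N b) = ?U \<union> ?W" using xy by auto
      finally have 1: "Suc (card (S \<union> T)) \<le> card (?U \<union> ?W)"
        using S T fST by (subst (asm) card_insert_disjoint) auto
      have "card (S \<inter> T) \<le> card (\<Union>b\<in>S \<inter> T. N b)" using S by (intro hall) auto
      also have "\<dots> \<le> card (?U \<inter> ?W)" using fUW by (intro card_mono) auto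
      finally have 2: "card (S \<inter> T) \<le> card (?U \<inter> ?W)" .
      have "card ?U + card ?W = card (?U \<union> ?W) + card (?U \<inter> ?W)"
        by (rule card_Un_Int[OF fUW])
      moreover have "card S + card T = card (S \<union> T) + card (S \<inter> T)"
        by (rule card_Un_Int[OF fST])
      ultimately show False using 1 2 S(2) T(2) by linarith
    qed
  qed
qed

section \<open>Degrees and edge counts in a regular graph; a bipartition is passed separately as a
  side \<open>A\<close>\<close>

locale regular_graph =
  fixes V :: "nat set" and E :: "nat set set" and n k :: nat
  assumes finV: "finite V" and cardV: "card V = 2 * n"
    and simple: "simple_graph V E" and reg: "regular V E k" and k_pos: "0 < k"
begin

definition nb :: "nat \<Rightarrow> nat set" where "nb v = {u. {v, u} \<in> E}"
definition deg_in :: "nat \<Rightarrow> nat set \<Rightarrow> nat" where "deg_in v S = card (nb v \<inter> S)"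
definition edges_in :: "nat set \<Rightarrow> nat" where "edges_in S = card {e \<in> E. e \<subseteq> S}"
text \<open>Counts ordered pairs, so an edge with both ends in \<open>S \<inter> T\<close> counts
  twice.\<close>

definition deg_sum :: "nat set \<Rightarrow> nat set \<Rightarrow> nat" where "deg_sum S T = (\<Sum>v\<in>S. deg_in v T)"

lemma edgeE:
  assumes "e \<in> E" obtains u v where "u \<noteq> v" "u \<in> V" "v \<in> V" "e = {u, v}"
  using assms simple unfolding simple_graph_def by metis

lemma edge_at:
  assumes "e \<in> E" "v \<in> e" obtains u where "u \<in> V" "u \<noteq> v" "e = {v, u}" "u \<in> nb v"
proof -
  obtain a b where ab: "a \<noteq> b" "a \<in> V" "b \<in> V" "e = {a, b}" using edgeE[OF assms(1)] .
  show thesis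
  proof (cases "v = a")
    case True
    thus ?thesis using that[of b] ab assms by (simp add: nb_def)
  next
    case False
    hence "v = b" using ab assms by auto
    thus ?thesis using that[of a] ab assms by (simp add: nb_def insert_commute)
  qed
qed

lemma edgeD: "{v, u} \<in> E \<Longrightarrow> v \<in> V \<and> u \<in> V \<and> v \<noteq> u"
  by (metis edgeE doubleton_eq_iff insert_absorb2)

lemma finE: "finite E"
proof (rule finite_subset)
  show "E \<subseteq> Pow V" using edgeE by blast
qed (use finV in simp)

lemma nb_commute: "u \<in> nb v \<longleftrightarrow> v \<in> nb u"
  by (simp add: nb_def insert_commute)

lemma nb_subset: "nb v \<subseteq> V"
  using edgeD by (auto simp: nb_def)

lemma nb_irrefl: "v \<notin> nb v"
  using edgeD[of v v] by (auto simp: nb_def)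

lemma fin_nb: "finite (nb v)"
  using nb_subset finV finite_subset by blast

lemma card_edges_at: "card {e \<in> E. v \<in> e \<and> e \<subseteq> insert v S} = deg_in v S"
proof -
  have "{e \<in> E. v \<in> e \<and> e \<subseteq> insert v S} = (\<lambda>u. {v, u}) ` (nb v \<inter> S)"
  proof (intro equalityI subsetI)
    fix e assume "e \<in> {e \<in> E. v \<in> e \<and> e \<subseteq> insert v S}"
    hence e: "e \<in> E" "v \<in> e" "e \<subseteq> insert v S" by auto
    obtain u where "u \<in> V" "u \<noteq> v" "e = {v, u}" "u \<in> nb v" by (rule edge_at[OF e(1,2)])
    thus "e \<in> (\<lambda>u. {v, u}) ` (nb v \<inter> S)" using e(3) by blast
  qed (auto simp: nb_def)
  moreover have "inj_on (\<lambda>u. {v, u}) (nb v \<inter> S)" by (auto simp: inj_on_def doubleton_eq_iff)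
  ultimately show ?thesis by (simp add: card_image deg_in_def)
qed

lemma card_nb: assumes "v \<in> V" shows "card (nb v) = k"
proof -
  have "e \<subseteq> V" if "e \<in> E" for e using edgeE[OF that] by blast
  hence "{e \<in> E. v \<in> e \<and> e \<subseteq> insert v V} = {e \<in> E. v \<in> e}" by blast
  hence "deg_in v V = k"
    using card_edges_at[of v V] reg assms by (simp add: regular_def degree_def)
  thus ?thesis using nb_subset[of v] by (simp add: deg_in_def Int_absorb2)
qed

lemma deg_in_compl: "v \<in> V \<Longrightarrow> deg_in v S + deg_in v (V - S) = k"
proof -
  assume v: "v \<in> V"
  have "deg_in v S + deg_in v (V - S) = card ((nb v \<inter> S) \<union> (nb v \<inter> (V - S)))"
    unfolding deg_in_def by (subst card_Un_disjoint) (auto simp: fin_nb)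
  also have "(nb v \<inter> S) \<union> (nb v \<inter> (V - S)) = nb v" using nb_subset by auto
  finally show ?thesis using card_nb v by simp
qed

lemma deg_in_mono: "S \<subseteq> T \<Longrightarrow> deg_in v S \<le> deg_in v T"
  unfolding deg_in_def by (intro card_mono) (auto simp: fin_nb)

lemma deg_in_Un: "deg_in v (S \<union> T) \<le> deg_in v S + deg_in v T"
  unfolding deg_in_def by (metis Int_Un_distrib card_Un_le)

lemma deg_in_diff: "finite D \<Longrightarrow> S \<subseteq> T \<union> D \<Longrightarrow> deg_in v S \<le> deg_in v T + card D"
proof -
  assume D: "finite D" and "S \<subseteq> T \<union> D"
  hence "deg_in v S \<le> deg_in v T + deg_in v D" using deg_in_mono deg_in_Un le_trans by meson
  moreover have "deg_in v D \<le> card D" unfolding deg_in_def using D by (intro card_mono) auto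
  ultimately show ?thesis by linarith
qed

lemma deg_sum_commute:
  assumes "finite S" "finite T" shows "deg_sum S T = deg_sum T S"
proof -
  have c: "deg_in v B = (\<Sum>u\<in>B. if u \<in> nb v then 1 else 0)" if "finite B" for v B
    using that by (simp add: deg_in_def sum.If_cases Int_commute)
  show ?thesis
    unfolding deg_sum_def using assms by (simp add: c) (subst sum.swap, simp add: nb_commute)
qed

lemma deg_sum_mono: "finite S' \<Longrightarrow> S \<subseteq> S' \<Longrightarrow> T \<subseteq> T' \<Longrightarrow> deg_sum S T \<le> deg_sum S' T'"
proof -
  assume a: "finite S'" "S \<subseteq> S'" "T \<subseteq> T'"
  have "deg_sum S T \<le> deg_sum S T'" unfolding deg_sum_def using a by (intro sum_mono deg_in_mono)
  also have "\<dots> \<le> deg_sum S' T'" unfolding deg_sum_def using a by (intro sum_mono2) auto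
  finally show ?thesis .
qed

lemma deg_sum_V: "S \<subseteq> V \<Longrightarrow> deg_sum S V = k * card S"
proof -
  assume S: "S \<subseteq> V"
  have "deg_in v V = k" if "v \<in> S" for v
    using card_nb[of v] nb_subset[of v] S that by (auto simp: deg_in_def Int_absorb2)
  thus ?thesis by (simp add: deg_sum_def)
qed

lemma deg_sum_split: "S \<subseteq> V \<Longrightarrow> deg_sum S T + deg_sum S (V - T) = k * card S"
  unfolding deg_sum_def sum.distrib[symmetric] using deg_in_compl by (simp add: subset_iff)

lemma deg_sum_Un_le:
  assumes "S \<subseteq> V" "P \<subseteq> V"
  shows "deg_sum (S \<union> P) (S \<union> P) \<le> deg_sum S S + 2 * (k * card P)"
proof -
  have f: "finite S" "finite P" using assms finV by (auto intro: finite_subset)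
  have "deg_sum (S \<union> P) (S \<union> P) \<le> deg_sum (S \<union> P) S + deg_sum (S \<union> P) P"
    unfolding deg_sum_def sum.distrib[symmetric] by (intro sum_mono deg_in_Un)
  also have "deg_sum (S \<union> P) P = deg_sum P (S \<union> P)" using f by (intro deg_sum_commute) auto
  also have "\<dots> \<le> deg_sum P V" using f assms by (intro deg_sum_mono) auto
  also have "deg_sum (S \<union> P) S = deg_sum S (S \<union> P)" using f by (intro deg_sum_commute) auto
  also have "\<dots> \<le> deg_sum S S + deg_sum S P"
    unfolding deg_sum_def sum.distrib[symmetric] by (intro sum_mono deg_in_Un)
  also have "deg_sum S P = deg_sum P S" using f by (intro deg_sum_commute)
  also have "\<dots> \<le> deg_sum P V" using f assms by (intro deg_sum_mono) auto
  finally show ?thesis using deg_sum_V[OF assms(2)] by simp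
qed

lemma edges_in_insert:
  assumes "a \<notin> S" shows "edges_in (insert a S) = edges_in S + deg_in a S"
proof -
  have "{e \<in> E. e \<subseteq> insert a S} = {e \<in> E. e \<subseteq> S} \<union> {e \<in> E. a \<in> e \<and> e \<subseteq> insert a S}" by auto
  moreover have "{e \<in> E. e \<subseteq> S} \<inter> {e \<in> E. a \<in> e \<and> e \<subseteq> insert a S} = {}" using assms by auto
  ultimately show ?thesis unfolding edges_in_def
    using finE by (simp add: card_Un_disjoint card_edges_at)
qed

lemma handshake:
  assumes "finite S" shows "deg_sum S S = 2 * edges_in S"
  using assms
proof (induction S rule: finite_induct)
  case empty
  have "{e \<in> E. e \<subseteq> {}} = {}" by (auto elim!: edgeE)
  thus ?case by (simp add: deg_sum_def edges_in_def)
next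
  case (insert a S)
  have *: "deg_in v (insert a S) = deg_in v S + deg_in v {a}" for v
    unfolding deg_in_def using insert(1,2)
    by (subst card_Un_disjoint[symmetric]) (auto simp: fin_nb intro!: arg_cong[where f=card])
  have "deg_in a {a} = 0" using nb_irrefl by (simp add: deg_in_def)
  moreover have "deg_sum S {a} = deg_in a S"
    using deg_sum_commute[of S "{a}"] insert by (simp add: deg_sum_def)
  ultimately show ?case using insert edges_in_insert[of a S]
    by (simp add: deg_sum_def * sum.distrib)
qed

lemma edges_in_compl:
  assumes "I \<subseteq> V"
  shows "2 * edges_in I + k * card (V - I) = 2 * edges_in (V - I) + k * card I"
proof -
  have f: "finite I" "finite (V - I)" using assms finV by (auto intro: finite_subset)
  have "deg_sum I I + deg_sum I (V - I) = k * card I" by (rule deg_sum_split[OF assms])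
  moreover have "deg_sum (V - I) I + deg_sum (V - I) (V - I) = k * card (V - I)"
    by (intro deg_sum_split) auto
  moreover have "deg_sum I (V - I) = deg_sum (V - I) I" using f by (intro deg_sum_commute)
  ultimately show ?thesis using handshake f by simp
qed

text \<open>Counting the edges across \<open>I\<close> from both sides turns the excess of
  \<open>card I\<close> over \<open>card (V - I)\<close> into k/2 spanned edges per vertex. As
  \<open>card V\<close> is even, the excess is at least 2.\<close>

lemma edges_in_large:
  assumes "I \<subseteq> V" "card I > n"
  shows "edges_in I \<ge> k" "edges_in (V - I) \<le> edges_in I"
proof -
  have "card (V - I) = 2 * n - card I" using assms cardV finV by (metis card_Diff_subset finite_subset)
  moreover have "card I \<le> 2 * n" using assms cardV finV by (metis card_mono)
  ultimately have "card (V - I) + 2 \<le> card I" using assms(2) by linarith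
  hence "k * (card (V - I) + 2) \<le> k * card I" by (rule mult_le_mono2)
  hence "k * card (V - I) + k * 2 \<le> k * card I" by (simp add: algebra_simps)
  thus "edges_in I \<ge> k" "edges_in (V - I) \<le> edges_in I"
    using edges_in_compl[OF assms(1)] by linarith+
qed

text \<open>\<open>H\<close> and \<open>H'\<close> bound the random graph at the hitting time from below and above.\<close>

definition obstruction :: "nat set set \<Rightarrow> nat set set \<Rightarrow> nat set \<Rightarrow> bool" where
  "obstruction H H' I \<longleftrightarrow> I \<subseteq> V \<and> card I > n \<and> (\<forall>e\<in>H. \<not> e \<subseteq> I) \<and>
     (\<forall>v\<in>I. \<exists>u\<in>V - I. {v, u} \<in> H') \<and>
     (\<forall>v\<in>V - I. (\<exists>u\<in>I. \<exists>u'\<in>I. u \<noteq> u' \<and> {v, u} \<in> H' \<and> {v, u'} \<in> H') \<or>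
                (\<exists>u\<in>I. {v, u} \<in> H' \<and> deg_in u I \<le> deg_in v I))"

lemma obstruction_mono: "obstruction H H' I \<Longrightarrow> G \<subseteq> H \<Longrightarrow> H' \<subseteq> G' \<Longrightarrow> obstruction G G' I"
  unfolding obstruction_def subset_iff by (elim conjE, intro conjI) metis+

text \<open>Take a maximum independent set of \<open>H\<close> which, among these, spans the fewest edges of the
  whole graph. If a vertex outside has only one neighbour in it, then swapping these two
  does not decrease the number of spanned edges.\<close>

lemma obstruction_exists:
  assumes H: "H \<subseteq> E" and iso: "no_isolated V H"
    and I0: "I0 \<subseteq> V" "card I0 > n" "\<forall>e\<in>H. \<not> e \<subseteq> I0"
  shows "\<exists>I. obstruction H H I"
proof -
  define ind where "ind I \<longleftrightarrow> I \<subseteq> V \<and> (\<forall>e\<in>H. \<not> e \<subseteq> I)" for I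
  have "\<exists>I. ind I \<and> (\<forall>J. ind J \<longrightarrow> card J \<le> card I)"
    using I0 finV card_mono[OF finV]
    by (intro ex_has_greatest_nat[of ind I0 card "Suc (card V)"]) (auto simp: ind_def less_Suc_eq_le)
  then obtain I1 where I1: "ind I1" "\<And>J. ind J \<Longrightarrow> card J \<le> card I1" by auto
  obtain I where I: "ind I \<and> card I = card I1"
    and best: "\<And>J. ind J \<Longrightarrow> card J = card I1 \<Longrightarrow> edges_in I \<le> edges_in J"
    using ex_has_least_nat[of "\<lambda>I. ind I \<and> card I = card I1" I1 edges_in] I1 by auto
  have IV: "I \<subseteq> V" and indep: "\<And>e. e \<in> H \<Longrightarrow> \<not> e \<subseteq> I" using I by (auto simp: ind_def)
  have fI: "finite I" using IV finV finite_subset by blast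
  have max: "\<And>J. ind J \<Longrightarrow> card J \<le> card I" using I1 I by simp
  have "card I > n" using max[of I0] I0 by (simp add: ind_def)
  moreover have "\<exists>u\<in>V - I. {v, u} \<in> H" if v: "v \<in> I" for v
  proof -
    obtain e where e: "e \<in> H" "v \<in> e" using iso v IV by (auto simp: no_isolated_def)
    then obtain u where "u \<in> V" "e = {v, u}" using H edge_at[of e v] by blast
    thus ?thesis using indep[OF e(1)] e v by auto
  qed
  moreover have "(\<exists>u\<in>I. \<exists>u'\<in>I. u \<noteq> u' \<and> {v, u} \<in> H \<and> {v, u'} \<in> H) \<or>
                (\<exists>u\<in>I. {v, u} \<in> H \<and> deg_in u I \<le> deg_in v I)" if v: "v \<in> V - I" for v
  proof (rule ccontr)
    assume no: "\<not> ?thesis"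
    have "\<not> ind (insert v I)" using max[of "insert v I"] v fI by auto
    then obtain e where e: "e \<in> H" "e \<subseteq> insert v I" using v IV by (auto simp: ind_def)
    hence "v \<in> e" using indep[OF e(1)] by auto
    then obtain u where u: "u \<noteq> v" "e = {v, u}" using H e edge_at[of e v] by blast
    have uI: "u \<in> I" "{v, u} \<in> H" using e u by auto
    let ?J = "insert v (I - {u})"
    have "ind ?J" unfolding ind_def
    proof (intro conjI ballI notI)
      fix f assume f: "f \<in> H" "f \<subseteq> ?J"
      hence "v \<in> f" using indep[OF f(1)] by auto
      then obtain w where w: "w \<noteq> v" "f = {v, w}" using H f edge_at[of f v] by blast
      thus False using no uI f by auto
    qed (use v IV in auto)
    moreover have "card ?J = card I" using v uI(1) fI card.remove[OF fI uI(1)] by simp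
    ultimately have "edges_in I \<le> edges_in ?J" using best I by simp
    moreover have "edges_in I = edges_in (I - {u}) + deg_in u (I - {u})"
      using edges_in_insert[of u "I - {u}"] uI by (simp add: insert_absorb)
    moreover have "edges_in ?J = edges_in (I - {u}) + deg_in v (I - {u})"
      using v by (intro edges_in_insert) auto
    moreover have "deg_in v (I - {u}) \<le> deg_in v I" by (intro deg_in_mono) auto
    moreover have "nb u \<inter> (I - {u}) = nb u \<inter> I" using nb_irrefl[of u] by auto
    hence "deg_in u (I - {u}) = deg_in u I" by (simp add: deg_in_def)
    ultimately show False using no uI by auto
  qed
  ultimately show ?thesis using IV indep unfolding obstruction_def by blast
qed

section \<open>Bipartite graphs without a perfect matching\<close>

lemma bipartite_sides:
  assumes A: "A \<subseteq> V" "\<forall>e\<in>E. card (e \<inter> A) = 1"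
  shows "card A = n" "card (V - A) = n"
proof -
  have cnt: "card E * c = k * card B" if "B \<subseteq> V" "\<And>e. e \<in> E \<Longrightarrow> card (e \<inter> B) = c" for B c
  proof -
    have fB: "finite B" using that finV finite_subset by blast
    have "card E * c = (\<Sum>e\<in>E. card (e \<inter> B))" using that by simp
    also have "\<dots> = (\<Sum>e\<in>E. \<Sum>v\<in>B. if v \<in> e then 1 else 0)"
      using fB by (simp add: sum.If_cases Int_commute)
    also have "\<dots> = (\<Sum>v\<in>B. \<Sum>e\<in>E. if v \<in> e then 1 else 0)" by (rule sum.swap)
    also have "\<dots> = (\<Sum>v\<in>B. degree E v)"
      using finE by (simp add: sum.If_cases degree_def Int_def)
    also have "\<dots> = k * card B" using reg that by (simp add: regular_def subset_iff)
    finally show ?thesis .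
  qed
  have "card (e \<inter> (V - A)) = 1" if "e \<in> E" for e
  proof -
    obtain u v where uv: "u \<noteq> v" "u \<in> V" "v \<in> V" "e = {u, v}" using edgeE[OF \<open>e \<in> E\<close>] .
    have "card ({u, v} \<inter> A) = 1" using A uv that by simp
    thus ?thesis using uv by (cases "u \<in> A"; cases "v \<in> A") (auto simp: Int_insert_left)
  qed
  hence "k * card A = k * card (V - A)" using cnt[of A 1] cnt[of "V - A" 1] A by auto
  hence "card A = card (V - A)" using k_pos by simp
  moreover have "card A + card (V - A) = 2 * n"
    using A cardV finV by (metis card_Diff_subset card_mono finite_subset le_add_diff_inverse)
  ultimately show "card A = n" "card (V - A) = n" by auto
qed

lemma bipartite_nb:
  assumes "\<forall>e\<in>E. card (e \<inter> A) = 1" "u \<in> nb v" shows "u \<in> A \<longleftrightarrow> v \<notin> A"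
proof -
  have "card ({v, u} \<inter> A) = 1" "v \<noteq> u" using assms edgeD[of v u] by (auto simp: nb_def)
  thus ?thesis by (cases "u \<in> A"; cases "v \<in> A") (auto simp: Int_insert_left)
qed

text \<open>If \<open>S\<close> on the side \<open>A\<close> violates Hall's condition, then
  \<open>S\<close> and the vertices of the other side without a neighbour in \<open>S\<close> form
  an independent set, of size more than n as both sides have n vertices.\<close>

lemma koenig:
  assumes A: "A \<subseteq> V" "\<forall>e\<in>E. card (e \<inter> A) = 1" and H: "H \<subseteq> E" and no: "\<not> has_perfect_matching V H"
  shows "\<exists>I\<subseteq>V. card I > n \<and> (\<forall>e\<in>H. \<not> e \<subseteq> I)"
proof -
  define N where "N a = {u. {a, u} \<in> H}" for a
  have N_nb: "N a \<subseteq> nb a" for a using H by (auto simp: N_def nb_def)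
  have NA: "N a \<subseteq> V - A" if "a \<in> A" for a
    using N_nb[of a] bipartite_nb[OF A(2)] that nb_subset by blast
  have fin: "finite A" "finite (V - A)" using A finV by (auto intro: finite_subset)
  have "\<not> (\<forall>S\<subseteq>A. card S \<le> card (\<Union>a\<in>S. N a))"
  proof
    assume "\<forall>S\<subseteq>A. card S \<le> card (\<Union>a\<in>S. N a)"
    then obtain f where f: "inj_on f A" "\<And>a. a \<in> A \<Longrightarrow> f a \<in> N a"
      using hall_marriage[of A N] fin NA by (metis finite_subset)
    have "f ` A \<subseteq> V - A" using f NA by blast
    moreover have "card (f ` A) = card (V - A)" using f bipartite_sides[OF A] by (simp add: card_image)
    ultimately have im: "f ` A = V - A" using fin by (simp add: card_subset_eq)
    let ?M = "(\<lambda>a. {a, f a}) ` A"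
    have "\<exists>!e. e \<in> ?M \<and> v \<in> e" if v: "v \<in> V" for v
    proof (cases "v \<in> A")
      case True
      show ?thesis
        by (rule ex1I[of _ "{v, f v}"]) (use True im in auto)
    next
      case False
      then obtain a where a: "a \<in> A" "v = f a" using v im by auto
      show ?thesis
        by (rule ex1I[of _ "{a, f a}"]) (use a False f(1) in \<open>auto simp: inj_on_def\<close>)
    qed
    moreover have "?M \<subseteq> H" using f by (auto simp: N_def)
    ultimately have "?M \<subseteq> H \<and> (\<forall>v\<in>V. \<exists>!e. e \<in> ?M \<and> v \<in> e)" by simp
    thus False using no unfolding has_perfect_matching_def by (simp only: not_ex not_False_eq_True)
  qed
  then obtain S where S: "S \<subseteq> A" "card (\<Union>a\<in>S. N a) < card S" by (auto simp: not_le)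
  let ?U = "\<Union>a\<in>S. N a"
  have U: "?U \<subseteq> V - A" using NA S by blast
  have fU: "finite ?U" "finite S" using U S fin by (auto intro: finite_subset)
  let ?I = "S \<union> (V - A - ?U)"
  have "card ?I = card S + card (V - A - ?U)" using S fU fin by (intro card_Un_disjoint) auto
  moreover have "card (V - A - ?U) = n - card ?U"
    using U fU bipartite_sides[OF A] by (simp add: card_Diff_subset)
  moreover have "card ?U \<le> n" using card_mono[OF fin(2) U] bipartite_sides[OF A] by simp
  ultimately have "card ?I > n" using S by linarith
  moreover have "\<not> e \<subseteq> ?I" if "e \<in> H" for e
  proof
    assume e: "e \<subseteq> ?I"
    have "e \<in> E" using that H by auto
    then obtain u v where uv: "u \<noteq> v" "e = {u, v}" "u \<in> V" "v \<in> V" by (rule edgeE)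
    have "u \<in> nb v" "v \<in> nb u" using uv that H by (auto simp: nb_def insert_commute)
    hence "u \<in> A \<longleftrightarrow> v \<notin> A" using bipartite_nb[OF A(2)] by blast
    moreover have "v \<in> ?U" if "u \<in> S" using that uv \<open>e \<in> H\<close> by (auto simp: N_def)
    moreover have "u \<in> ?U" if "v \<in> S" using that uv \<open>e \<in> H\<close> by (auto simp: N_def insert_commute)
    moreover have "u \<in> S \<or> u \<in> V - A - ?U" "v \<in> S \<or> v \<in> V - A - ?U" using e uv(2) by blast+
    ultimately show False using S(1) U by blast
  qed
  moreover have "?I \<subseteq> V" using S A by auto
  ultimately show ?thesis by (intro exI[of _ ?I]) simp
qed

section \<open>Containers for sparse sets\<close>

text \<open>Two random sets of k vertices among 2n share k^2 / (2n) elements on average; close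
  vertices share more than a quarter of this.\<close>

definition close :: "nat \<Rightarrow> nat \<Rightarrow> bool" where
  "close u v \<longleftrightarrow> 8 * n * card (nb u \<inter> nb v) > k\<^sup>2"

definition separated :: "nat set \<Rightarrow> bool" where
  "separated S \<longleftrightarrow> S \<subseteq> V \<and> (\<forall>u\<in>S. \<forall>v\<in>S. u \<noteq> v \<longrightarrow> \<not> close u v)"

lemma close_commute: "close u v \<longleftrightarrow> close v u"
  by (simp add: close_def Int_commute)

lemma n_pos: "k \<le> n \<Longrightarrow> 0 < n" using k_pos by simp

text \<open>Bonferroni's inequality: fewer than \<open>(card S)\<^sup>2 / 2\<close> pairs overlap,
  each in at most k^2 / (8n) vertices.\<close>

lemma card_UN_nb_separated:
  assumes n: "k \<le> n" and "finite S" "separated S"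
  shows "real (card S) * k - (real (card S))\<^sup>2 * (real k ^ 2 / (16 * n)) \<le> card (\<Union>v\<in>S. nb v)"
  using assms(2,3)
proof (induction S rule: finite_induct)
  case (insert a S)
  let ?U = "\<Union>v\<in>S. nb v"
  define c where "c = real k ^ 2 / (16 * n)"
  have IH: "real (card S) * k - (real (card S))\<^sup>2 * c \<le> card ?U"
    using insert by (auto simp: separated_def c_def)
  have fU: "finite ?U" using insert fin_nb by auto
  have cd: "real (card (nb a \<inter> nb v)) \<le> 2 * c" if "v \<in> S" for v
  proof -
    have "\<not> close a v" using insert that by (auto simp: separated_def)
    hence "8 * n * card (nb a \<inter> nb v) \<le> k\<^sup>2" by (simp add: close_def)
    hence "real (8 * n * card (nb a \<inter> nb v)) \<le> real (k\<^sup>2)" by (rule of_nat_mono)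
    thus ?thesis using n_pos[OF n] by (simp add: c_def field_simps)
  qed
  have "card (nb a \<inter> ?U) \<le> (\<Sum>v\<in>S. card (nb a \<inter> nb v))"
    unfolding Int_UN_distrib using insert by (intro card_UN_le) auto
  hence "real (card (nb a \<inter> ?U)) \<le> (\<Sum>v\<in>S. real (card (nb a \<inter> nb v)))"
    unfolding of_nat_sum[symmetric] by (rule of_nat_mono)
  also have "\<dots> \<le> card S * (2 * c)" using sum_mono[OF cd] by simp
  finally have 1: "real (card (nb a \<inter> ?U)) \<le> card S * (2 * c)" .
  have "card (nb a \<union> ?U) + card (nb a \<inter> ?U) = card (nb a) + card ?U"
    using card_Un_Int[OF fin_nb fU] by simp
  moreover have "card (nb a) = k" using insert card_nb by (auto simp: separated_def)
  ultimately have "real (card (nb a \<union> ?U)) + real (card (nb a \<inter> ?U)) = real k + real (card ?U)"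
    by (metis of_nat_add)
  hence "real (card (nb a \<union> ?U)) \<ge> k + (real (card S) * k - (real (card S))\<^sup>2 * c) - card S * (2 * c)"
    using 1 IH by linarith
  moreover have "c \<ge> 0" by (simp add: c_def)
  ultimately have "real (card S + 1) * k - (real (card S + 1))\<^sup>2 * c \<le> card (nb a \<union> ?U)"
    by (simp add: power2_eq_square algebra_simps)
  thus ?case using insert by (simp add: c_def add.commute)
qed simp

text \<open>With r = y n / k separated vertices, the preceding bound says that they have at least (y
  - y^2 / 16) n neighbours. Taking r as 4 n / k rounded up puts y between 4 and 5, where this
  exceeds the 2n vertices available.\<close>

lemma card_separated:
  assumes n: "k \<le> n" and S: "separated S"
  shows "card S \<le> 5 * real n / k"
proof (rule ccontr)
  assume no: "\<not> ?thesis"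
  define m where "m = real n / k"
  have m: "m \<ge> 1" using n k_pos by (simp add: m_def)
  define r where "r = nat \<lceil>4 * m\<rceil>"
  have r: "real r \<ge> 4 * m" "real r \<le> 4 * m + 1" using m unfolding r_def by linarith+
  have "real r < card S" using r no m by (simp add: not_le m_def)
  then obtain T where T: "T \<subseteq> S" "card T = r" by (meson less_imp_le_nat obtain_subset_with_card_n of_nat_less_iff)
  have sT: "separated T" "finite T" using T S finV by (auto simp: separated_def intro: finite_subset)
  have "(\<Union>v\<in>T. nb v) \<subseteq> V" using nb_subset by auto
  hence "card (\<Union>v\<in>T. nb v) \<le> 2 * n" using card_mono[OF finV] cardV by metis
  moreover have "real r * k - (real r)\<^sup>2 * (real k ^ 2 / (16 * n)) \<le> card (\<Union>v\<in>T. nb v)"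
    using card_UN_nb_separated[OF n sT(2,1)] T by simp
  ultimately have le: "real r * k - (real r)\<^sup>2 * (real k ^ 2 / (16 * n)) \<le> 2 * real n" by linarith
  define y where "y = real r / m"
  have y: "y \<ge> 4" "y \<le> 5" using r m unfolding y_def by (auto simp: field_simps)
  have ry: "real r * k = n * y" using n_pos[OF n] k_pos by (simp add: y_def m_def)
  have "(real r)\<^sup>2 * (real k ^ 2 / (16 * n)) = (real r * k)\<^sup>2 / (16 * n)" by (simp add: power_mult_distrib)
  also have "\<dots> = n * (y\<^sup>2 / 16)" unfolding ry using n_pos[OF n] by (simp add: field_simps power2_eq_square)
  finally have "n * (y - y\<^sup>2 / 16) \<le> n * 2" using le ry by (simp add: algebra_simps)
  hence "y - y\<^sup>2 / 16 \<le> 2" using n_pos[OF n] by simp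
  moreover have "y\<^sup>2 \<le> 5\<^sup>2" using y by (intro power_mono) auto
  ultimately show False using y by simp
qed

text \<open>Peel off maximum separated sets one after another. Each is maximal within what its
  predecessors leave, so a vertex that survives all rounds is close to some member of every
  family.\<close>

lemma separated_families:
  "\<exists>F. (\<forall>i<N::nat. separated (F i)) \<and> (\<forall>i<N. \<forall>l<N. i \<noteq> l \<longrightarrow> F i \<inter> F l = {}) \<and>
     (\<forall>i<N. \<forall>v\<in>V - (\<Union>l<N. F l). \<exists>u\<in>F i. close v u)"
proof (induction N)
  case (Suc N)
  then obtain F where F: "\<forall>i<N. separated (F i)" "\<forall>i<N. \<forall>l<N. i \<noteq> l \<longrightarrow> F i \<inter> F l = {}"
     "\<forall>i<N. \<forall>v\<in>V - (\<Union>l<N. F l). \<exists>u\<in>F i. close v u" by (elim exE conjE) (rule that; assumption)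
  let ?W = "V - (\<Union>l<N. F l)"
  have "\<exists>S. (separated S \<and> S \<subseteq> ?W) \<and> (\<forall>T. separated T \<and> T \<subseteq> ?W \<longrightarrow> card T \<le> card S)"
    using card_mono[OF finV]
    by (intro ex_has_greatest_nat[of _ "{}" card "Suc (card V)"]) (auto simp: separated_def less_Suc_eq_le)
  then obtain S where S: "separated S" "S \<subseteq> ?W" "\<And>T. separated T \<Longrightarrow> T \<subseteq> ?W \<Longrightarrow> card T \<le> card S"
    by (elim exE conjE) (rule that, assumption, assumption, metis)
  have fS: "finite S" using S(2) finV by (meson finite_Diff finite_subset)
  have cl: "\<exists>u\<in>S. close v u" if v: "v \<in> ?W" "v \<notin> S" for v
  proof (rule ccontr)
    assume "\<not> ?thesis"
    hence "separated (insert v S)" using S(1) v close_commute unfolding separated_def by blast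
    thus False using S(3)[of "insert v S"] v S(2) fS by simp
  qed
  let ?F = "F(N := S)"
  have U: "(\<Union>l<Suc N. ?F l) = (\<Union>l<N. F l) \<union> S" by (auto simp: less_Suc_eq)
  have "\<forall>i<Suc N. separated (?F i)" using F(1) S(1) by (auto simp: less_Suc_eq)
  moreover have "\<forall>i<Suc N. \<forall>l<Suc N. i \<noteq> l \<longrightarrow> ?F i \<inter> ?F l = {}"
    using F(2) S(2) by (auto simp: less_Suc_eq)
  moreover have "\<forall>i<Suc N. \<forall>v\<in>V - (\<Union>l<Suc N. ?F l). \<exists>u\<in>?F i. close v u"
    unfolding U using F(3) cl by (auto simp: less_Suc_eq)
  ultimately show ?case by blast
qed auto

text \<open>The threshold is half of that for \<open>close\<close>. A common neighbour of v in
  \<open>I\<close> and u outside \<open>I\<close> lies either on the side of v or on that of u, so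
  typical vertices on different sides are never close.\<close>

definition atypical :: "nat set \<Rightarrow> nat set" where
  "atypical I = {v \<in> I. 16 * n * deg_in v I > k\<^sup>2} \<union> {v \<in> V - I. 16 * n * deg_in v (V - I) > k\<^sup>2}"

lemma not_close_typical:
  assumes "v \<in> I - atypical I" "u \<in> V - I - atypical I"
  shows "\<not> close v u"
proof -
  have "nb v \<inter> nb u \<subseteq> (nb v \<inter> I) \<union> (nb u \<inter> (V - I))" using nb_subset by auto
  hence "card (nb v \<inter> nb u) \<le> card ((nb v \<inter> I) \<union> (nb u \<inter> (V - I)))"
    by (intro card_mono) (auto simp: fin_nb)
  also have "\<dots> \<le> deg_in v I + deg_in u (V - I)" unfolding deg_in_def by (rule card_Un_le)
  finally have "16 * n * card (nb v \<inter> nb u) \<le> 16 * n * (deg_in v I + deg_in u (V - I))"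
    by (rule mult_le_mono2)
  moreover have "16 * n * deg_in v I \<le> k\<^sup>2" "16 * n * deg_in u (V - I) \<le> k\<^sup>2"
    using assms by (auto simp: atypical_def)
  ultimately show ?thesis by (simp add: close_def algebra_simps)
qed

text \<open>Markov's inequality for the degree into the own part, on two disjoint parts at once; an
  empty \<open>T\<close> leaves a single part.\<close>

lemma card_le_deg_sum:
  assumes "finite S" and "\<And>v. v \<in> A \<inter> S \<Longrightarrow> a \<le> b * deg_in v S"
    and "finite T" and "\<And>v. v \<in> A \<inter> T \<Longrightarrow> a \<le> b * deg_in v T"
    and "S \<inter> T = {}" "A \<subseteq> S \<union> T"
  shows "a * card A \<le> b * (deg_sum S S + deg_sum T T)"
proof -
  have *: "a * card (A \<inter> S) \<le> b * deg_sum S S" if "finite S" "\<And>v. v \<in> A \<inter> S \<Longrightarrow> a \<le> b * deg_in v S" for S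
  proof -
    have "a * card (A \<inter> S) = (\<Sum>v\<in>A \<inter> S. a)" by simp
    also have "\<dots> \<le> (\<Sum>v\<in>A \<inter> S. b * deg_in v S)" by (intro sum_mono that)
    also have "\<dots> \<le> (\<Sum>v\<in>S. b * deg_in v S)" using that by (intro sum_mono2) auto
    finally show ?thesis by (simp add: deg_sum_def sum_distrib_left)
  qed
  have "card A = card (A \<inter> S) + card (A \<inter> T)"
    using assms by (subst card_Un_disjoint[symmetric]) (auto intro!: arg_cong[where f=card])
  thus ?thesis using *[OF assms(1,2)] *[OF assms(3,4)] by (simp add: add_mult_distrib2)
qed

text \<open>Here \<open>j\<close> stands for \<open>edges_in I div k\<close>, which is at least 1 by
  \<open>edges_in_large\<close>; the factor 2 absorbs the remainder of the division.\<close>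

definition sparse_set :: "nat \<Rightarrow> nat set \<Rightarrow> bool" where
  "sparse_set j I \<longleftrightarrow> I \<subseteq> V \<and> card I > n \<and> edges_in I < 2 * j * k"

lemma sparse_set_deg_sum:
  assumes "sparse_set j I"
  shows "deg_sum I I + deg_sum (V - I) (V - I) \<le> 8 * j * k" "finite I"
    "deg_sum I I \<le> 4 * j * k" "deg_sum (V - I) (V - I) \<le> 4 * j * k"
proof -
  show f: "finite I" using assms finV by (auto simp: sparse_set_def intro: finite_subset)
  have "edges_in (V - I) \<le> edges_in I" using assms by (intro edges_in_large) (auto simp: sparse_set_def)
  moreover have "edges_in I < 2 * j * k" using assms by (simp add: sparse_set_def)
  ultimately show "deg_sum I I \<le> 4 * j * k" "deg_sum (V - I) (V - I) \<le> 4 * j * k"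
    using f finV by (simp_all add: handshake)
  thus "deg_sum I I + deg_sum (V - I) (V - I) \<le> 8 * j * k" by linarith
qed

lemma card_atypical:
  assumes "sparse_set j I" shows "card (atypical I) \<le> 128 * real j * (real n / k)"
proof -
  note d = sparse_set_deg_sum[OF assms]
  have "k\<^sup>2 * card (atypical I) \<le> 16 * n * (deg_sum I I + deg_sum (V - I) (V - I))"
    using d(2) finV assms
    by (intro card_le_deg_sum) (auto simp: atypical_def sparse_set_def)
  also have "\<dots> \<le> 16 * n * (8 * j * k)" using d(1) by (rule mult_le_mono2)
  finally have "k * card (atypical I) \<le> 128 * j * n" using k_pos by (simp add: power2_eq_square mult_ac)
  hence "real (k * card (atypical I)) \<le> real (128 * j * n)" by (rule of_nat_mono)
  thus ?thesis using k_pos by (simp add: field_simps)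
qed

text \<open>One of many disjoint separated families consists of typical vertices only. Its trace on
  \<open>I\<close> determines \<open>I\<close> up to few errors, and two rounds of majority vote repair these except at
  the \<open>O(j)\<close> undecided vertices, on which \<open>I\<close> is guessed.\<close>

lemma containers:
  assumes n: "k \<le> n" and j: "1 \<le> j" and small: "773 * real j * (real n / k)\<^sup>2 \<le> k / 32"
  shows "\<exists>F. finite F \<and> real (card F) \<le> (128 * real j * (real n / k) + 1) * (2 powr (5 * real n / k) * 2 ^ (256 * j)) \<and>
     (\<forall>I. sparse_set j I \<longrightarrow> (\<exists>J\<in>F. J \<subseteq> V \<and>
        (\<forall>p\<in>I - J. 7 * k \<le> 8 * deg_in p I) \<and> (\<forall>q\<in>J - I. 8 * deg_in q I \<le> k)))"
proof -
  let ?m = "real n / k"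
  have m: "?m \<ge> 1" using n k_pos by simp
  \<comment> \<open>One more family than there can be atypical vertices: as the families are
    disjoint, one of them avoids all atypical vertices.\<close>
  define N where "N = nat \<lfloor>128 * real j * ?m\<rfloor> + 1"
  have N: "real N \<le> 128 * real j * ?m + 1" "real N > 128 * real j * ?m"
    using m j unfolding N_def by (simp_all, linarith+)
  obtain F where F_all: "\<forall>i<N. separated (F i)" "\<forall>i<N. \<forall>l<N. i \<noteq> l \<longrightarrow> F i \<inter> F l = {}"
     "\<forall>i<N. \<forall>v\<in>V - (\<Union>l<N. F l). \<exists>u\<in>F i. close v u"
    using separated_families[of N] by (elim exE conjE) (rule that; assumption)
  note F = F_all[rule_format]
  have finF: "finite (F i)" if "i < N" for i using F(1)[OF that] finV by (auto simp: separated_def intro: finite_subset)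
  define J0 where "J0 Y = {v \<in> V. \<exists>y\<in>Y. close v y}" for Y
  \<comment> \<open>\<open>J0\<close> will differ from \<open>I\<close> in at most k/32 vertices.
    Degree below k/16 into \<open>J0\<close> thus forces degree at most 3k/32, hence at most k/8,
    into \<open>I\<close>, and degree above 15k/16 forces at least 7k/8. Vertices in between are the
    undecided ones in \<open>U\<close>.\<close>
  define I0 where "I0 Y = {v \<in> V. 16 * deg_in v (J0 Y) < k}" for Y
  define U where "U Y = {v \<in> V. k \<le> 16 * deg_in v (J0 Y) \<and> 16 * deg_in v (J0 Y) \<le> 15 * k}" for Y
  \<comment> \<open>A trace with too many undecided vertices contributes nothing, which keeps the
    family small. The bound on \<open>card (U ?Y)\<close> below shows that the trace chosen for a
    sparse set is kept.\<close>
  define R where "R Y = (if card (U Y) \<le> 256 * j then (\<lambda>Z. I0 Y \<union> Z) ` Pow (U Y) else {})" for Y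
  define C where "C = (\<Union>i<N. \<Union>Y\<in>Pow (F i). R Y)"
  have finU: "finite (U Y)" for Y using finV by (simp add: U_def)
  have finR: "finite (R Y)" for Y using finU by (simp add: R_def)
  have cR: "real (card (R Y)) \<le> 2 ^ (256 * j)" for Y
  proof (cases "card (U Y) \<le> 256 * j")
    case True
    have "card (R Y) \<le> card (Pow (U Y))" using True finU by (auto simp: R_def intro!: card_image_le)
    also have "\<dots> = 2 ^ card (U Y)" using finU by (simp add: card_Pow)
    also have "\<dots> \<le> 2 ^ (256 * j)" using True by (intro power_increasing) auto
    finally have "real (card (R Y)) \<le> real (2 ^ (256 * j))" by (rule of_nat_mono)
    thus ?thesis by simp
  qed (simp add: R_def)
  have cF: "real (card (\<Union>Y\<in>Pow (F i). R Y)) \<le> 2 powr (5 * real n / k) * 2 ^ (256 * j)" if i: "i < N" for i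
  proof -
    have "card (\<Union>Y\<in>Pow (F i). R Y) \<le> (\<Sum>Y\<in>Pow (F i). card (R Y))"
      using finF[OF i] by (intro card_UN_le) auto
    hence "real (card (\<Union>Y\<in>Pow (F i). R Y)) \<le> (\<Sum>Y\<in>Pow (F i). real (card (R Y)))"
      unfolding of_nat_sum[symmetric] by (rule of_nat_mono)
    also have "\<dots> \<le> real (card (Pow (F i))) * 2 ^ (256 * j)"
      using sum_mono[of "Pow (F i)" "\<lambda>Y. real (card (R Y))" "\<lambda>_. 2 ^ (256 * j)"] cR by simp
    also have "real (card (Pow (F i))) = 2 powr card (F i)"
      using finF[OF i] by (simp add: card_Pow powr_realpow)
    also have "\<dots> \<le> 2 powr (5 * real n / k)" using card_separated[OF n F(1)[OF i]] by (intro powr_mono) auto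
    finally show ?thesis by simp
  qed
  have "real (card C) \<le> (128 * real j * ?m + 1) * (2 powr (5 * real n / k) * 2 ^ (256 * j))"
  proof -
    have "card C \<le> (\<Sum>i<N. card (\<Union>Y\<in>Pow (F i). R Y))" unfolding C_def by (intro card_UN_le) auto
    hence "real (card C) \<le> (\<Sum>i<N. real (card (\<Union>Y\<in>Pow (F i). R Y)))"
      unfolding of_nat_sum[symmetric] by (rule of_nat_mono)
    also have "\<dots> \<le> real N * (2 powr (5 * real n / k) * 2 ^ (256 * j))"
      using sum_mono[of "{..<N}" "\<lambda>i. real (card (\<Union>Y\<in>Pow (F i). R Y))" "\<lambda>_. 2 powr (5 * real n / k) * 2 ^ (256 * j)"] cF by simp
    also have "\<dots> \<le> (128 * real j * ?m + 1) * (2 powr (5 * real n / k) * 2 ^ (256 * j))"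
      using N by (intro mult_right_mono) auto
    finally show ?thesis .
  qed
  moreover have "finite C" unfolding C_def using finF finR by auto
  moreover have "\<exists>J\<in>C. J \<subseteq> V \<and> (\<forall>p\<in>I - J. 7 * k \<le> 8 * deg_in p I) \<and> (\<forall>q\<in>J - I. 8 * deg_in q I \<le> k)"
    if I: "sparse_set j I" for I
  proof -
    note d = sparse_set_deg_sum[OF I]
    have IV: "I \<subseteq> V" using I by (simp add: sparse_set_def)
    have fa: "finite (atypical I)" using IV finV by (auto simp: atypical_def intro: finite_subset)
    have "\<exists>i<N. F i \<inter> atypical I = {}"
    proof (rule ccontr)
      assume "\<not> ?thesis"
      hence "\<forall>i. \<exists>v. i < N \<longrightarrow> v \<in> F i \<inter> atypical I" by blast
      then obtain g where g: "\<And>i. i < N \<Longrightarrow> g i \<in> F i \<inter> atypical I" by metis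
      have "inj_on g {..<N}" using g F(2) unfolding inj_on_def by fastforce
      hence "card {..<N} \<le> card (atypical I)" using g fa by (intro card_inj_on_le) auto
      thus False using card_atypical[OF I] N by simp
    qed
    then obtain i where i: "i < N" "F i \<inter> atypical I = {}" by blast
    let ?Y = "F i \<inter> I"
    \<comment> \<open>Outside \<open>D\<close> the sets \<open>J0 ?Y\<close> and \<open>I\<close>
      agree: a vertex there is typical and close to a member of \<open>F i\<close>, and close
      typical vertices lie on the same side. The constant is 773 = 128 + 640 + 5, from the atypical
      vertices and from \<open>N\<close> families of at most 5 n / k vertices.\<close>
    define D where "D = atypical I \<union> (\<Union>l<N. F l)"
    have fD: "finite D" using fa finF by (auto simp: D_def)
    have "card D \<le> card (atypical I) + (\<Sum>l<N. card (F l))"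
      unfolding D_def using card_UN_le[of "{..<N}" F] card_Un_le[of "atypical I" "\<Union>l<N. F l"]
      by simp
    hence "real (card D) \<le> real (card (atypical I)) + (\<Sum>l<N. real (card (F l)))"
      unfolding of_nat_sum[symmetric] of_nat_add[symmetric] by (rule of_nat_mono)
    also have "(\<Sum>l<N. real (card (F l))) \<le> real N * (5 * ?m)"
      using sum_mono[of "{..<N}" "\<lambda>l. real (card (F l))" "\<lambda>_. 5 * ?m"] card_separated[OF n F(1)] by simp
    also have "real N * (5 * ?m) \<le> (128 * real j * ?m + 1) * (5 * ?m)" using N m by (intro mult_right_mono) auto
    also have "real (card (atypical I)) + (128 * real j * ?m + 1) * (5 * ?m)
       \<le> 128 * real j * ?m + (128 * real j * ?m + 1) * (5 * ?m)" using card_atypical[OF I] by simp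
    also have "\<dots> \<le> 773 * real j * ?m\<^sup>2"
    proof -
      have "?m * 1 \<le> ?m * ?m" using m by (intro mult_left_mono) auto
      hence "?m \<le> ?m\<^sup>2" by (simp add: power2_eq_square)
      moreover from this have "real j * ?m \<le> real j * ?m\<^sup>2" by (intro mult_left_mono) auto
      moreover have "1 * ?m\<^sup>2 \<le> real j * ?m\<^sup>2" using j by (intro mult_right_mono) auto
      moreover have "128 * real j * ?m + (128 * real j * ?m + 1) * (5 * ?m) = 128 * (real j * ?m) + 640 * (real j * ?m\<^sup>2) + 5 * ?m"
        by (simp add: power2_eq_square algebra_simps)
      ultimately show ?thesis by linarith
    qed
    also note small
    finally have D: "32 * card D \<le> k" by simp
    have sub: "J0 ?Y \<subseteq> I \<union> D" "I \<subseteq> J0 ?Y \<union> D"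
    proof -
      show "J0 ?Y \<subseteq> I \<union> D"
      proof
        fix v assume v: "v \<in> J0 ?Y"
        then obtain y where y: "v \<in> V" "y \<in> F i" "y \<in> I" "close v y" by (auto simp: J0_def)
        show "v \<in> I \<union> D" using not_close_typical[of y I v] y i close_commute by (auto simp: D_def)
      qed
      show "I \<subseteq> J0 ?Y \<union> D"
      proof
        fix v assume v: "v \<in> I"
        show "v \<in> J0 ?Y \<union> D"
        proof (cases "v \<in> D")
          case False
          then obtain u where u: "u \<in> F i" "close v u" using F(3)[OF i(1), of v] v IV by (auto simp: D_def)
          have "u \<in> V" using F(1)[OF i(1)] u by (auto simp: separated_def)
          hence "u \<in> I" using not_close_typical[of v I u] u v i False by (auto simp: D_def)
          thus ?thesis using u v IV by (auto simp: J0_def)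
        qed simp
      qed
    qed
    have d1: "deg_in v (J0 ?Y) \<le> deg_in v I + card D" and d2: "deg_in v I \<le> deg_in v (J0 ?Y) + card D" for v
      using deg_in_diff[OF fD] sub by blast+
    \<comment> \<open>An undecided vertex has at least k/16 - k/32 = k/32 neighbours on its own side
      of \<open>I\<close>.\<close>
    have "k * card (U ?Y) \<le> 32 * (deg_sum I I + deg_sum (V - I) (V - I))"
    proof (rule card_le_deg_sum)
      fix v assume "v \<in> U ?Y \<inter> I"
      thus "k \<le> 32 * deg_in v I" using d1[of v] D by (auto simp: U_def)
    next
      fix v assume v: "v \<in> U ?Y \<inter> (V - I)"
      hence "deg_in v I + deg_in v (V - I) = k" by (intro deg_in_compl) auto
      thus "k \<le> 32 * deg_in v (V - I)" using d2[of v] D v by (auto simp: U_def)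
    qed (use d(2) finV in \<open>auto simp: U_def\<close>)
    also have "\<dots> \<le> 32 * (8 * j * k)" using d(1) by (rule mult_le_mono2)
    finally have U: "card (U ?Y) \<le> 256 * j" using k_pos by simp
    let ?J = "I0 ?Y \<union> (I \<inter> U ?Y)"
    have "?J \<in> R ?Y" using U by (auto simp: R_def)
    hence "?J \<in> C" using i(1) by (auto simp: C_def)
    moreover have "?J \<subseteq> V" by (auto simp: I0_def U_def)
    moreover have "7 * k \<le> 8 * deg_in p I" if p: "p \<in> I - ?J" for p
    proof -
      have "16 * deg_in p (J0 ?Y) > 15 * k" using p IV by (auto simp: I0_def U_def)
      thus ?thesis using d1[of p] D by linarith
    qed
    moreover have "8 * deg_in q I \<le> k" if q: "q \<in> ?J - I" for q
    proof -
      have "16 * deg_in q (J0 ?Y) < k" using q by (auto simp: I0_def)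
      thus ?thesis using d2[of q] D by linarith
    qed
    ultimately show ?thesis by blast
  qed
  ultimately show ?thesis by blast
qed

text \<open>A vertex of \<open>I - J\<close> or \<open>J - I\<close> has at least 7k/8 neighbours on
  its own side of \<open>I\<close>, while the degrees there sum to at most 4 j k; and 32/7 < 5.
  Moving these vertices adds at most 20 j k to the 8 j k for \<open>I\<close>. The last bound no
  longer mentions \<open>I\<close>, so weights in the union bound can depend on \<open>J\<close>
  alone.\<close>

lemma container_card:
  assumes I: "sparse_set j I" and J: "J \<subseteq> V"
    and p: "\<And>p. p \<in> I - J \<Longrightarrow> 7 * k \<le> 8 * deg_in p I"
    and q: "\<And>q. q \<in> J - I \<Longrightarrow> 8 * deg_in q I \<le> k"
  shows "card (I - J) \<le> 5 * j" "card (J - I) \<le> 5 * j"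
    and "deg_sum J J + deg_sum (V - J) (V - J) \<le> 28 * j * k"
proof -
  note d = sparse_set_deg_sum[OF I]
  have IV: "I \<subseteq> V" using I by (simp add: sparse_set_def)
  have "7 * k * card (I - J) \<le> 8 * (deg_sum I I + deg_sum {} {})"
    by (rule card_le_deg_sum) (use d(2) p in auto)
  also have "\<dots> \<le> 8 * (4 * j * k)" using d(3) by (simp add: deg_sum_def)
  finally have "k * (7 * card (I - J)) \<le> k * (32 * j)" by (simp add: mult_ac)
  thus 1: "card (I - J) \<le> 5 * j" using k_pos by simp
  have "7 * k * card (J - I) \<le> 8 * (deg_sum (V - I) (V - I) + deg_sum {} {})"
  proof (rule card_le_deg_sum)
    fix v assume v: "v \<in> (J - I) \<inter> (V - I)"
    hence "deg_in v I + deg_in v (V - I) = k" by (intro deg_in_compl) auto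
    thus "7 * k \<le> 8 * deg_in v (V - I)" using q[of v] v by auto
  qed (use finV J in auto)
  also have "\<dots> \<le> 8 * (4 * j * k)" using d(4) by (simp add: deg_sum_def)
  finally have "k * (7 * card (J - I)) \<le> k * (32 * j)" by (simp add: mult_ac)
  thus 2: "card (J - I) \<le> 5 * j" using k_pos by simp
  have "deg_sum J J \<le> deg_sum (I \<union> (J - I)) (I \<union> (J - I))"
    using d(2) J finV by (intro deg_sum_mono) (auto intro: finite_subset)
  also have "\<dots> \<le> deg_sum I I + 2 * (k * card (J - I))" using IV J by (intro deg_sum_Un_le) auto
  finally have 3: "deg_sum J J \<le> deg_sum I I + 2 * (k * card (J - I))" .
  have "deg_sum (V - J) (V - J) \<le> deg_sum ((V - I) \<union> (I - J)) ((V - I) \<union> (I - J))"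
    using d(2) finV by (intro deg_sum_mono) auto
  also have "\<dots> \<le> deg_sum (V - I) (V - I) + 2 * (k * card (I - J))" using IV by (intro deg_sum_Un_le) auto
  finally have 4: "deg_sum (V - J) (V - J) \<le> deg_sum (V - I) (V - I) + 2 * (k * card (I - J))" .
  have "k * card (J - I) \<le> k * (5 * j)" "k * card (I - J) \<le> k * (5 * j)"
    using 1 2 by (intro mult_le_mono2; simp)+
  hence "k * card (J - I) \<le> 5 * j * k" "k * card (I - J) \<le> 5 * j * k" by (simp_all add: mult_ac)
  thus "deg_sum J J + deg_sum (V - J) (V - J) \<le> 28 * j * k" using 3 4 d(1) by linarith
qed

end

section \<open>The union bound\<close>

text \<open>The numbers \<open>p\<close> and \<open>q\<close> are prices of single edges,
  \<open>p\<close> for being among the first \<open>t\<close> and \<open>q\<close> for missing the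
  first \<open>s\<close>. They multiply as for independent edges while at most \<open>y0\<close>
  edges are prescribed. Note that q^k is n to the power -7/8.\<close>

locale regular_graph_process = regular_graph +
  fixes p q :: real and s t y0 :: nat
  assumes p_nonneg: "0 \<le> p" and p_le: "p * k \<le> 2 * ln n" and q_eq: "q = exp (- (7/8) * ln n / k)"
    and ln_ge: "1 \<le> ln n"
    and prob_le: "\<And>X Y. X \<subseteq> E \<Longrightarrow> Y \<subseteq> E \<Longrightarrow> X \<inter> Y = {} \<Longrightarrow> card Y \<le> y0 \<Longrightarrow>
      process_prob E (\<lambda>xs. X \<inter> set (take s xs) = {} \<and> Y \<subseteq> set (take t xs)) \<le> p ^ card Y * q ^ card X"
begin

text \<open>Counts the candidates for the edge that pays for a vertex v placed differently by
  \<open>I\<close> and \<open>J\<close>. This edge crosses \<open>I\<close>, so if its other end is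
  placed alike by both, it runs inside the side of \<open>J\<close> that contains v.\<close>

definition own_deg :: "nat set \<Rightarrow> nat \<Rightarrow> nat" where
  "own_deg J v = (if v \<in> J then deg_in v J else deg_in v (V - J))"

lemma sum_own_deg:
  assumes "J \<subseteq> V" shows "(\<Sum>v\<in>V. own_deg J v) = deg_sum J J + deg_sum (V - J) (V - J)"
proof -
  have "V = J \<union> (V - J)" using assms by auto
  hence "(\<Sum>v\<in>V. own_deg J v) = (\<Sum>v\<in>J. own_deg J v) + (\<Sum>v\<in>V - J. own_deg J v)"
    using finV by (metis Diff_disjoint finite_Un sum.union_disjoint)
  thus ?thesis by (simp add: deg_sum_def own_deg_def)
qed

lemma real_n: "real n \<ge> 1" "exp (ln (real n)) = n"
  using ln_ge by (cases "n = 0"; simp)+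

lemma q_pos: "0 < q" by (simp add: q_eq)

lemma process_subset_E: "xs \<in> permutations_of_set E \<Longrightarrow> set (take i xs) \<subseteq> E"
  using set_take_subset[of i xs] by (auto simp: permutations_of_set_def)

text \<open>\<open>Qu\<close> is named outright, while each vertex of \<open>Qa\<close> and
  \<open>P\<close> is paid for by one edge across \<open>I\<close>. Neighbours of \<open>Qa\<close>
  are taken in \<open>I \<inter> J\<close> to keep these edges distinct: an edge between
  \<open>Qa\<close> and \<open>P\<close> could otherwise be chosen by both ends. A vertex of
  \<open>P\<close> may use an edge to a removed vertex, hence the extra degree into
  \<open>Qa \<union> Qu\<close>.\<close>

lemma prob_few_unattached:
  assumes J: "J \<subseteq> V" "Qa \<subseteq> J" "Qu \<subseteq> J" "P \<subseteq> V - J" and I: "I = (J - (Qa \<union> Qu)) \<union> P"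
    and y0: "card Qa + card P \<le> y0"
  shows "process_prob E (\<lambda>xs. {e \<in> E. e \<subseteq> I} \<inter> set (take s xs) = {} \<and>
      (\<forall>v\<in>Qa. \<exists>u\<in>I \<inter> J. {v, u} \<in> set (take t xs)) \<and> (\<forall>v\<in>P. \<exists>u\<in>V - I. {v, u} \<in> set (take t xs)))
    \<le> (\<Prod>v\<in>Qa. p * own_deg J v) * (\<Prod>v\<in>P. p * (real (own_deg J v) + real (deg_in v (Qa \<union> Qu)))) * q ^ edges_in I"
    (is "?lhs \<le> ?rhs")
proof -
  define Opt where "Opt v = (\<lambda>u. {{v, u}}) ` (if v \<in> J then nb v \<inter> (I \<inter> J) else nb v \<inter> (V - I))" for v
  define b where "b v = (if v \<in> J then p * own_deg J v else p * (real (own_deg J v) + real (deg_in v (Qa \<union> Qu))))" for v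
  let ?X = "{e \<in> E. e \<subseteq> I}"
  have fin: "finite Qa" "finite P" "finite J" using J finV by (auto intro: finite_subset)
  have dj: "Qa \<inter> P = {}" using J by auto
  have mem: "\<exists>u. Y = {{v, u}} \<and> {v, u} \<in> E \<and> (if v \<in> Qa then v \<notin> I \<and> u \<in> I \<inter> J else v \<in> I - J \<and> u \<notin> I)"
    if "v \<in> Qa \<union> P" "Y \<in> Opt v" for v Y
    using that J I by (auto simp: Opt_def nb_def split: if_splits)
  have "?lhs \<le> process_prob E (\<lambda>xs. ?X \<inter> set (take s xs) = {} \<and> (\<forall>v\<in>Qa \<union> P. \<exists>Y\<in>Opt v. Y \<subseteq> set (take t xs)))"
  proof (rule process_prob_mono[OF finE], elim conjE, intro conjI ballI)
    fix xs v
    assume xs: "xs \<in> permutations_of_set E" and v: "v \<in> Qa \<union> P"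
      and a: "\<forall>v\<in>Qa. \<exists>u\<in>I \<inter> J. {v, u} \<in> set (take t xs)" "\<forall>v\<in>P. \<exists>u\<in>V - I. {v, u} \<in> set (take t xs)"
    obtain u where u: "u \<in> (if v \<in> J then I \<inter> J else V - I)" "{v, u} \<in> set (take t xs)"
      using a v J by (cases "v \<in> J") (fastforce)+
    have "{v, u} \<in> E" using u(2) process_subset_E[OF xs] by auto
    thus "\<exists>Y\<in>Opt v. Y \<subseteq> set (take t xs)"
      using u by (intro bexI[of _ "{{v, u}}"]) (auto simp: Opt_def nb_def)
  qed
  also have "\<dots> \<le> (\<Prod>v\<in>Qa \<union> P. b v) * q ^ edges_in I"
  proof (rule process_prob_choices[where c = "\<lambda>_. 1" and p = p])
    fix v Y assume "v \<in> Qa \<union> P" "Y \<in> Opt v"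
    then obtain u where "Y = {{v, u}}" "{v, u} \<in> E" "if v \<in> Qa then v \<notin> I \<and> u \<in> I \<inter> J else v \<in> I - J \<and> u \<notin> I"
      using mem by blast
    thus "Y \<subseteq> E \<and> ?X \<inter> Y = {} \<and> card Y = 1" by (auto split: if_splits)
  next
    fix v v' Y Y' assume v: "v \<in> Qa \<union> P" "v' \<in> Qa \<union> P" "v \<noteq> v'" and Y: "Y \<in> Opt v" "Y' \<in> Opt v'"
    obtain u where u: "Y = {{v, u}}" "if v \<in> Qa then v \<notin> I \<and> u \<in> I \<inter> J else v \<in> I - J \<and> u \<notin> I"
      using mem[OF v(1) Y(1)] by blast
    obtain u' where u': "Y' = {{v', u'}}" "if v' \<in> Qa then v' \<notin> I \<and> u' \<in> I \<inter> J else v' \<in> I - J \<and> u' \<notin> I"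
      using mem[OF v(2) Y(2)] by blast
    have "{v, u} \<noteq> {v', u'}" using u(2) u'(2) v(3) by (auto simp: doubleton_eq_iff split: if_splits)
    thus "Y \<inter> Y' = {}" using u u' by simp
  next
    fix v assume v: "v \<in> Qa \<union> P"
    have "card (Opt v) \<le> card (if v \<in> J then nb v \<inter> (I \<inter> J) else nb v \<inter> (V - I))"
      unfolding Opt_def by (intro card_image_le) (auto simp: fin_nb)
    also have "\<dots> \<le> (if v \<in> J then own_deg J v else own_deg J v + deg_in v (Qa \<union> Qu))"
    proof (cases "v \<in> J")
      case True
      have "card (nb v \<inter> (I \<inter> J)) \<le> card (nb v \<inter> J)" by (intro card_mono) (auto simp: fin_nb)
      thus ?thesis using True by (simp add: own_deg_def deg_in_def)
    next
      case False
      have "deg_in v (V - I) \<le> deg_in v ((V - J) \<union> (Qa \<union> Qu))" using I by (intro deg_in_mono) auto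
      also have "\<dots> \<le> deg_in v (V - J) + deg_in v (Qa \<union> Qu)" by (rule deg_in_Un)
      finally show ?thesis using False by (simp add: own_deg_def deg_in_def)
    qed
    finally have "real (card (Opt v)) * p \<le> real (if v \<in> J then own_deg J v else own_deg J v + deg_in v (Qa \<union> Qu)) * p"
      using p_nonneg by (intro mult_right_mono) auto
    thus "real (card (Opt v)) * p ^ 1 \<le> b v" by (simp add: b_def mult.commute split: if_splits)
  next
    fix Y assume Y: "Y \<subseteq> E" "?X \<inter> Y = {}" "card Y = (\<Sum>v\<in>Qa \<union> P. 1)"
    hence "card Y \<le> y0" using y0 fin dj by (simp add: card_Un_disjoint)
    thus "process_prob E (\<lambda>xs. ?X \<inter> set (take s xs) = {} \<and> Y \<subseteq> set (take t xs)) \<le> p ^ card Y * q ^ edges_in I"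
      unfolding edges_in_def using Y by (intro prob_le) auto
  qed (use finE fin p_nonneg q_pos in \<open>auto simp: Opt_def fin_nb\<close>)
  also have "(\<Prod>v\<in>Qa \<union> P. b v) = (\<Prod>v\<in>Qa. b v) * (\<Prod>v\<in>P. b v)"
    using fin dj by (intro prod.union_disjoint)
  also have "(\<Prod>v\<in>Qa. b v) = (\<Prod>v\<in>Qa. p * own_deg J v)" using J by (intro prod.cong) (auto simp: b_def)
  also have "(\<Prod>v\<in>P. b v) = (\<Prod>v\<in>P. p * (real (own_deg J v) + real (deg_in v (Qa \<union> Qu))))"
    using J by (intro prod.cong) (auto simp: b_def)
  finally show ?thesis .
qed

text \<open>Now \<open>P\<close> is named outright and a vertex of \<open>Qu\<close> is paid for by
  its two edges into \<open>P\<close>. All charged edges lead from \<open>Qa \<union> Qu\<close>,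
  outside \<open>I\<close>, into \<open>I\<close>, so different vertices use different
  edges.\<close>

lemma prob_many_unattached:
  assumes J: "J \<subseteq> V" "Qa \<subseteq> J" "Qu \<subseteq> J" "Qa \<inter> Qu = {}" "P \<subseteq> V - J" and I: "I = (J - (Qa \<union> Qu)) \<union> P"
    and y0: "card Qa + 2 * card Qu \<le> y0"
  shows "process_prob E (\<lambda>xs. {e \<in> E. e \<subseteq> I} \<inter> set (take s xs) = {} \<and>
      (\<forall>v\<in>Qa. \<exists>u\<in>I \<inter> J. {v, u} \<in> set (take t xs)) \<and>
      (\<forall>v\<in>Qu. \<exists>u\<in>P. \<exists>u'\<in>P. u \<noteq> u' \<and> {v, u} \<in> set (take t xs) \<and> {v, u'} \<in> set (take t xs)))
    \<le> (\<Prod>v\<in>Qa. p * own_deg J v) * (\<Prod>v\<in>Qu. p\<^sup>2 * (real (deg_in v P))\<^sup>2) * q ^ edges_in I"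
    (is "?lhs \<le> ?rhs")
proof -
  define Opt where "Opt v = (if v \<in> Qa then (\<lambda>u. {{v, u}}) ` (nb v \<inter> (I \<inter> J))
     else (\<lambda>(u, u'). {{v, u}, {v, u'}}) ` {(u, u') \<in> (nb v \<inter> P) \<times> (nb v \<inter> P). u \<noteq> u'})" for v
  define b where "b v = (if v \<in> Qa then p * own_deg J v else p\<^sup>2 * (real (deg_in v P))\<^sup>2)" for v
  define c where "c v = (if v \<in> Qa then 1 else 2 :: nat)" for v
  let ?X = "{e \<in> E. e \<subseteq> I}"
  have fin: "finite Qa" "finite P" "finite J" "finite Qu" using J finV by (auto intro: finite_subset)
  have fO: "finite (Opt v)" for v
  proof -
    have "finite {(u, u') \<in> (nb v \<inter> P) \<times> (nb v \<inter> P). u \<noteq> u'}"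
      by (rule finite_subset[of _ "nb v \<times> nb v"]) (auto simp: fin_nb)
    thus ?thesis by (auto simp: Opt_def fin_nb)
  qed
  have vI: "v \<notin> I" if "v \<in> Qa \<union> Qu" for v using that J I by auto
  have mem: "\<exists>U\<subseteq>I. Y = (\<lambda>u. {v, u}) ` U \<and> Y \<subseteq> E \<and> card Y = c v" if v: "v \<in> Qa \<union> Qu" "Y \<in> Opt v" for v Y
  proof (cases "v \<in> Qa")
    case True
    then obtain u where "u \<in> nb v \<inter> (I \<inter> J)" "Y = {{v, u}}" using v by (auto simp: Opt_def)
    hence "{u} \<subseteq> I \<and> Y = (\<lambda>u. {v, u}) ` {u} \<and> Y \<subseteq> E \<and> card Y = c v"
      using True by (simp add: c_def nb_def)
    thus ?thesis by (rule exI)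
  next
    case False
    hence "Y \<in> (\<lambda>(u, u'). {{v, u}, {v, u'}}) ` {(u, u') \<in> (nb v \<inter> P) \<times> (nb v \<inter> P). u \<noteq> u'}"
      using v(2) by (simp add: Opt_def)
    then obtain z where "Y = {{v, fst z}, {v, snd z}}" "z \<in> (nb v \<inter> P) \<times> (nb v \<inter> P)" "fst z \<noteq> snd z"
      by (rule imageE) (rule that; auto simp: case_prod_beta)
    then obtain u u' where "u \<in> nb v \<inter> P" "u' \<in> nb v \<inter> P" "u \<noteq> u'" "Y = {{v, u}, {v, u'}}"
      by (metis mem_Times_iff)
    hence "{u, u'} \<subseteq> I \<and> Y = (\<lambda>u. {v, u}) ` {u, u'} \<and> Y \<subseteq> E \<and> card Y = c v"
      using False I by (simp add: c_def nb_def doubleton_eq_iff)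
    thus ?thesis by (rule exI)
  qed
  have "?lhs \<le> process_prob E (\<lambda>xs. ?X \<inter> set (take s xs) = {} \<and> (\<forall>v\<in>Qa \<union> Qu. \<exists>Y\<in>Opt v. Y \<subseteq> set (take t xs)))"
  proof (rule process_prob_mono[OF finE], elim conjE, intro conjI ballI)
    fix xs v
    assume xs: "xs \<in> permutations_of_set E" and v: "v \<in> Qa \<union> Qu"
      and a: "\<forall>v\<in>Qa. \<exists>u\<in>I \<inter> J. {v, u} \<in> set (take t xs)"
        "\<forall>v\<in>Qu. \<exists>u\<in>P. \<exists>u'\<in>P. u \<noteq> u' \<and> {v, u} \<in> set (take t xs) \<and> {v, u'} \<in> set (take t xs)"
    have nb: "u \<in> nb v" if "{v, u} \<in> set (take t xs)" for u
      using that process_subset_E[OF xs] by (auto simp: nb_def)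
    show "\<exists>Y\<in>Opt v. Y \<subseteq> set (take t xs)"
    proof (cases "v \<in> Qa")
      case True
      then obtain u where "u \<in> I \<inter> J" "{v, u} \<in> set (take t xs)" using a by blast
      thus ?thesis using nb True by (intro bexI[of _ "{{v, u}}"]) (auto simp: Opt_def)
    next
      case False
      hence "v \<in> Qu" using v by simp
      then obtain u u' where u: "u \<in> P" "u' \<in> P" "u \<noteq> u'" "{v, u} \<in> set (take t xs)" "{v, u'} \<in> set (take t xs)"
        using a(2) by blast
      have "(u, u') \<in> {(u, u') \<in> (nb v \<inter> P) \<times> (nb v \<inter> P). u \<noteq> u'}" using u nb by simp
      hence "{{v, u}, {v, u'}} \<in> Opt v" unfolding Opt_def if_not_P[OF False] by (rule rev_image_eqI) simp
      thus ?thesis using u by (intro bexI[of _ "{{v, u}, {v, u'}}"]) auto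
    qed
  qed
  also have "\<dots> \<le> (\<Prod>v\<in>Qa \<union> Qu. b v) * q ^ edges_in I"
  proof (rule process_prob_choices[where c = c and p = p])
    fix v Y assume v: "v \<in> Qa \<union> Qu" "Y \<in> Opt v"
    obtain U where U: "U \<subseteq> I" "Y = (\<lambda>u. {v, u}) ` U" "Y \<subseteq> E" "card Y = c v"
      using mem[OF v] by (elim exE conjE) (rule that)
    have "?X \<inter> Y = {}" using vI[OF v(1)] unfolding U(2) by auto
    thus "Y \<subseteq> E \<and> ?X \<inter> Y = {} \<and> card Y = c v" using U by simp
  next
    fix v v' Y Y' assume v: "v \<in> Qa \<union> Qu" "v' \<in> Qa \<union> Qu" "v \<noteq> v'" and Y: "Y \<in> Opt v" "Y' \<in> Opt v'"
    obtain U where U: "U \<subseteq> I" "Y = (\<lambda>u. {v, u}) ` U"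
      using mem[OF v(1) Y(1)] by (elim exE conjE) (rule that)
    obtain U' where U': "U' \<subseteq> I" "Y' = (\<lambda>u. {v', u}) ` U'"
      using mem[OF v(2) Y(2)] by (elim exE conjE) (rule that)
    show "Y \<inter> Y' = {}" using U U' v(3) vI[OF v(1)] vI[OF v(2)] by (auto simp: doubleton_eq_iff)
  next
    fix v assume v: "v \<in> Qa \<union> Qu"
    show "real (card (Opt v)) * p ^ c v \<le> b v"
    proof (cases "v \<in> Qa")
      case True
      have "card (Opt v) \<le> card (nb v \<inter> (I \<inter> J))"
        using True by (auto simp: Opt_def fin_nb intro!: card_image_le)
      also have "\<dots> \<le> own_deg J v"
        using True J by (auto simp: own_deg_def deg_in_def fin_nb intro!: card_mono)
      finally show ?thesis using True p_nonneg by (simp add: b_def c_def mult_left_mono mult.commute)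
    next
      case False
      have "card (Opt v) \<le> card {(u, u') \<in> (nb v \<inter> P) \<times> (nb v \<inter> P). u \<noteq> u'}"
        using False by (auto simp: Opt_def fin_nb intro!: card_image_le intro: finite_subset[of _ "nb v \<times> nb v"])
      also have "\<dots> \<le> card ((nb v \<inter> P) \<times> (nb v \<inter> P))" by (intro card_mono) (auto simp: fin_nb)
      also have "\<dots> = (deg_in v P)\<^sup>2" by (simp add: deg_in_def card_cartesian_product power2_eq_square)
      finally have "real (card (Opt v)) \<le> (real (deg_in v P))\<^sup>2" by (metis of_nat_mono of_nat_power)
      hence "real (card (Opt v)) * p\<^sup>2 \<le> (real (deg_in v P))\<^sup>2 * p\<^sup>2" by (rule mult_right_mono) simp
      thus ?thesis using False by (simp add: b_def c_def mult.commute)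
    qed
  next
    fix Y assume Y: "Y \<subseteq> E" "?X \<inter> Y = {}" "card Y = (\<Sum>v\<in>Qa \<union> Qu. c v)"
    have "(\<Sum>v\<in>Qa \<union> Qu. c v) = (\<Sum>v\<in>Qa. c v) + (\<Sum>v\<in>Qu. c v)" using fin J by (intro sum.union_disjoint) auto
    also have "(\<Sum>v\<in>Qa. c v) = card Qa" by (simp add: c_def)
    also have "(\<Sum>v\<in>Qu. c v) = (\<Sum>v\<in>Qu. 2)" using J by (intro sum.cong) (auto simp: c_def)
    finally have "card Y \<le> y0" using y0 Y by simp
    thus "process_prob E (\<lambda>xs. ?X \<inter> set (take s xs) = {} \<and> Y \<subseteq> set (take t xs)) \<le> p ^ card Y * q ^ edges_in I"
      unfolding edges_in_def using Y by (intro prob_le) auto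
  qed (use finE fin p_nonneg q_pos fO in auto)
  also have "(\<Prod>v\<in>Qa \<union> Qu. b v) = (\<Prod>v\<in>Qa. b v) * (\<Prod>v\<in>Qu. b v)"
    using fin J by (intro prod.union_disjoint) auto
  also have "(\<Prod>v\<in>Qa. b v) = (\<Prod>v\<in>Qa. p * own_deg J v)" by (intro prod.cong) (auto simp: b_def)
  also have "(\<Prod>v\<in>Qu. b v) = (\<Prod>v\<in>Qu. p\<^sup>2 * (real (deg_in v P))\<^sup>2)"
    using J by (intro prod.cong) (auto simp: b_def)
  finally show ?thesis .
qed

end

section \<open>How an obstruction differs from its container\<close>

context regular_graph
begin

text \<open>The degrees of \<open>P\<close> into \<open>I\<close> count twice only the edges inside
  \<open>P\<close>, at most \<open>(card P)\<^sup>2 / 2\<close> of them.\<close>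

lemma edges_in_ge:
  assumes "finite I" "P \<subseteq> I"
  shows "2 * (\<Sum>p\<in>P. deg_in p I) \<le> 2 * edges_in I + card P * card P"
proof -
  have f: "finite P" using assms finite_subset by blast
  have "deg_in p I \<le> deg_in p (I - P) + card P" for p using f by (intro deg_in_diff) auto
  hence "(\<Sum>p\<in>P. deg_in p I) \<le> (\<Sum>p\<in>P. deg_in p (I - P) + card P)" by (rule sum_mono)
  also have "\<dots> = deg_sum P (I - P) + card P * card P" by (simp add: deg_sum_def sum.distrib)
  also have "deg_sum P (I - P) = deg_sum (I - P) P" using assms f by (intro deg_sum_commute) auto
  also have "\<dots> \<le> deg_sum (I - P) I" using assms by (intro deg_sum_mono) auto
  finally have 1: "(\<Sum>p\<in>P. deg_in p I) \<le> deg_sum (I - P) I + card P * card P" by simp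
  have "deg_sum (I - P) I + (\<Sum>p\<in>P. deg_in p I) = deg_sum I I"
    unfolding deg_sum_def using assms by (metis sum.subset_diff)
  thus ?thesis using 1 handshake[OF assms(1)] by linarith
qed

text \<open>\<open>Qu\<close> collects the vertices removed from the container all of whose relevant neighbours were
  added to it; by the swapping property each of them has two such neighbours.\<close>

lemma obstruction_cases:
  assumes J: "J \<subseteq> V" and I: "sparse_set j I" and j: "40 * j \<le> k"
    and p: "\<forall>p\<in>I - J. 7 * k \<le> 8 * deg_in p I"
    and q: "\<forall>q\<in>J - I. 8 * deg_in q I \<le> k"
    and obs: "obstruction H T I"
  obtains Qa Qu P where "Qa \<subseteq> J" "Qu \<subseteq> J" "Qa \<inter> Qu = {}" "P \<subseteq> V - J" "I = (J - (Qa \<union> Qu)) \<union> P"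
    "card Qa \<le> 5 * j" "card Qu \<le> 5 * j" "card P \<le> 5 * j" "4 * k * card P \<le> 5 * edges_in I"
    "\<forall>v\<in>Qa. \<exists>u\<in>I \<inter> J. {v, u} \<in> T" "\<forall>v\<in>P. \<exists>u\<in>V - I. {v, u} \<in> T"
    "\<forall>v\<in>Qu. \<exists>u\<in>P. \<exists>u'\<in>P. u \<noteq> u' \<and> {v, u} \<in> T \<and> {v, u'} \<in> T"
proof -
  define P where "P = I - J"
  define Qa where "Qa = {v \<in> J - I. \<exists>u\<in>I \<inter> J. {v, u} \<in> T}"
  define Qu where "Qu = (J - I) - Qa"
  have IV: "I \<subseteq> V" using I by (simp add: sparse_set_def)
  have fin: "finite I" "finite (J - I)" "finite J" using IV J finV by (auto intro: finite_subset)
  have c: "card (I - J) \<le> 5 * j" "card (J - I) \<le> 5 * j"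
    using container_card[OF I J] p q by auto
  have "(\<Sum>p\<in>P. 7 * k) \<le> (\<Sum>p\<in>P. 8 * deg_in p I)" using p by (intro sum_mono) (auto simp: P_def)
  hence "7 * k * card P \<le> 8 * (\<Sum>p\<in>P. deg_in p I)" by (simp add: sum_distrib_left mult_ac)
  moreover have "2 * (\<Sum>p\<in>P. deg_in p I) \<le> 2 * edges_in I + card P * card P"
    using fin by (intro edges_in_ge) (auto simp: P_def)
  moreover have "8 * card P \<le> k" using c j by (simp add: P_def)
  hence "8 * card P * card P \<le> k * card P" by (intro mult_le_mono1)
  \<comment> \<open>The quadratic term is at most half of \<open>k * card P\<close>, which leaves
    (13/2) k |P| \<le> 8 x for the number x of edges in \<open>I\<close>; and 16/13 < 5/4.\<close>
  ultimately have 4: "4 * k * card P \<le> 5 * edges_in I" by (simp only: mult.assoc)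
  have "\<exists>u\<in>P. \<exists>u'\<in>P. u \<noteq> u' \<and> {v, u} \<in> T \<and> {v, u'} \<in> T" if v: "v \<in> Qu" for v
  proof -
    have notJ: "u \<in> P" if "u \<in> I" "{v, u} \<in> T" for u
      using v that by (auto simp: Qu_def Qa_def P_def)
    have "v \<in> V - I" using v J by (auto simp: Qu_def)
    hence "(\<exists>u\<in>I. \<exists>u'\<in>I. u \<noteq> u' \<and> {v, u} \<in> T \<and> {v, u'} \<in> T) \<or>
                (\<exists>u\<in>I. {v, u} \<in> T \<and> deg_in u I \<le> deg_in v I)"
      using obs by (simp add: obstruction_def)
    thus ?thesis
    proof
      \<comment> \<open>This alternative cannot occur: such a u lies in \<open>P\<close> and has at
        least 7k/8 neighbours in \<open>I\<close>, whereas v has at most k/8.\<close>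
      assume "\<exists>u\<in>I. {v, u} \<in> T \<and> deg_in u I \<le> deg_in v I"
      then obtain u where u: "u \<in> I" "{v, u} \<in> T" "deg_in u I \<le> deg_in v I" by blast
      have "7 * k \<le> 8 * deg_in u I" using p notJ[OF u(1,2)] by (auto simp: P_def)
      moreover have "8 * deg_in v I \<le> k" using q v by (auto simp: Qu_def)
      ultimately show ?thesis using u(3) k_pos by linarith
    qed (use notJ in meson)
  qed
  moreover have "\<forall>v\<in>P. \<exists>u\<in>V - I. {v, u} \<in> T" using obs by (simp add: obstruction_def P_def)
  moreover have "card Qa \<le> 5 * j" "card Qu \<le> 5 * j"
    using c(2) fin by (auto simp: Qa_def Qu_def intro: order_trans[OF card_mono[OF fin(2)]])
  moreover have "Qa \<subseteq> J" "Qu \<subseteq> J" "Qa \<inter> Qu = {}" "P \<subseteq> V - J" "I = (J - (Qa \<union> Qu)) \<union> P"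
    using IV by (auto simp: Qa_def Qu_def P_def)
  moreover have "\<forall>v\<in>Qa. \<exists>u\<in>I \<inter> J. {v, u} \<in> T" "card P \<le> 5 * j" using c(1) by (auto simp: Qa_def P_def)
  ultimately show ?thesis using 4 by (intro that[of Qa Qu P]) (simp_all only:, blast)
qed

end

section \<open>The union bound for a single container\<close>

context regular_graph_process
begin

text \<open>The budget: of the exponent (7/8) x / k, the part (5/8) x / k pays n^(-1/2) for each of
  the \<open>a\<close> vertices, as \<open>a\<close> is at most (5/4) x / k. The remaining quarter
  is at least j / 4.\<close>

lemma q_power_le:
  assumes "j * k \<le> x" "4 * k * a \<le> 5 * x"
  shows "q ^ x \<le> exp (- ln n * j / 4) * exp (- ln n / 2) ^ a"
proof -
  have k: "real k > 0" using k_pos by simp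
  have "real (j * k) \<le> real x" "real (4 * k * a) \<le> real (5 * x)" using assms by (auto intro: of_nat_mono simp del: of_nat_mult)
  hence "real j \<le> x / k" "(4/5) * real a \<le> x / k" using k by (auto simp: field_simps)
  hence "j / 4 + a / 2 \<le> (7/8) * (x / k)" by linarith
  hence "ln n * (j / 4 + a / 2) \<le> ln n * ((7/8) * (x / k))" using ln_ge by (intro mult_left_mono) auto
  hence "exp (- (ln n * ((7/8) * (x / k)))) \<le> exp (- (ln n * (j / 4 + a / 2)))" by simp
  moreover have "q ^ x = exp (- (ln n * ((7/8) * (x / k))))"
    by (simp add: q_eq exp_of_nat_mult[symmetric] field_simps)
  moreover have "exp (- ln n * j / 4) * exp (- ln n / 2) ^ a = exp (- (ln n * (j / 4 + a / 2)))"
    by (simp add: exp_of_nat_mult[symmetric] exp_add[symmetric] field_simps)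
  ultimately show ?thesis by simp
qed

lemma sum_deg_in_V: "finite S \<Longrightarrow> S \<subseteq> V \<Longrightarrow> (\<Sum>v\<in>V. deg_in v S) = k * card S"
  using deg_sum_commute[OF finV, of S] deg_sum_V[of S] by (simp add: deg_sum_def)

lemma p_ratio: "p / ln n \<le> 2 / k" "p / ln n \<ge> 0"
  using p_le ln_ge p_nonneg k_pos by (auto simp: field_simps)

lemma exp_half_square: "(exp (- ln (real n) / 2))\<^sup>2 = 1 / real n"
proof -
  have "(exp (- ln (real n) / 2))\<^sup>2 = exp (- ln (real n))" by (simp flip: exp_double)
  thus ?thesis using real_n by (simp add: exp_minus field_simps)
qed

definition small :: "nat \<Rightarrow> nat set set" where
  "small r = {S. S \<subseteq> V \<and> card S \<le> r}"

lemma finite_small: "finite (small r)"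
  by (rule finite_subset[of _ "Pow V"]) (auto simp: small_def finV)

lemma smallD: "S \<in> small r \<Longrightarrow> S \<subseteq> V \<and> card S \<le> r \<and> finite S"
  using finV by (auto simp: small_def intro: finite_subset)

text \<open>The weights sum to at most 28 j k p, hence to at most 56 j ln n. Rankin's trick with c =
  ln n then leaves a polylogarithmic factor per vertex, where blind choices would cost n.\<close>

lemma sum_attached_le:
  assumes J: "J \<subseteq> V" and W: "deg_sum J J + deg_sum (V - J) (V - J) \<le> 28 * j * k"
  shows "(\<Sum>S\<in>small r. \<Prod>v\<in>S. p * real (own_deg J v)) \<le> ln n ^ r * exp (56 * real j)"
proof -
  have "(\<Sum>S\<in>small r. \<Prod>v\<in>S. p * real (own_deg J v)) \<le> ln n ^ r * exp ((\<Sum>v\<in>V. p * real (own_deg J v)) / ln n)"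
    unfolding small_def using finV p_nonneg ln_ge by (intro sum_subsets_prod_le) auto
  also have "(\<Sum>v\<in>V. p * real (own_deg J v)) / ln n = (p / ln n) * real (\<Sum>v\<in>V. own_deg J v)"
    by (simp add: sum_distrib_left[symmetric])
  also have "\<dots> \<le> (2 / k) * real (28 * j * k)"
    using p_ratio W sum_own_deg[OF J] by (intro mult_mono) (auto simp del: of_nat_mult)
  also have "\<dots> = 56 * real j" using k_pos by simp
  finally show ?thesis using ln_ge by simp
qed

text \<open>As before; a set of at most 10 j removed vertices adds 10 j k to the degrees, and 76 = 2
  (28 + 10).\<close>

lemma sum_added_le:
  assumes J: "J \<subseteq> V" and W: "deg_sum J J + deg_sum (V - J) (V - J) \<le> 28 * j * k"
    and Q: "Q \<subseteq> V" "card Q \<le> 10 * j"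
  shows "(\<Sum>S\<in>small r. \<Prod>v\<in>S. p * (real (own_deg J v) + real (deg_in v Q))) \<le> ln n ^ r * exp (76 * real j)"
proof -
  have fQ: "finite Q" using Q finV finite_subset by blast
  have "(\<Sum>S\<in>small r. \<Prod>v\<in>S. p * (real (own_deg J v) + real (deg_in v Q)))
      \<le> ln n ^ r * exp ((\<Sum>v\<in>V. p * (real (own_deg J v) + real (deg_in v Q))) / ln n)"
    unfolding small_def using finV p_nonneg ln_ge by (intro sum_subsets_prod_le) auto
  also have "(\<Sum>v\<in>V. p * (real (own_deg J v) + real (deg_in v Q))) / ln n
      = (p / ln n) * real ((\<Sum>v\<in>V. own_deg J v) + (\<Sum>v\<in>V. deg_in v Q))"
    by (simp add: sum_distrib_left[symmetric] sum.distrib)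
  also have "\<dots> \<le> (2 / k) * real (28 * j * k + 10 * j * k)"
  proof -
    have "card Q * k \<le> 10 * j * k" using Q(2) by (rule mult_le_mono1)
    hence "(\<Sum>v\<in>V. own_deg J v) + (\<Sum>v\<in>V. deg_in v Q) \<le> 28 * j * k + 10 * j * k"
      unfolding sum_own_deg[OF J] sum_deg_in_V[OF fQ Q(1)] mult.commute[of k "card Q"] using W by (rule add_mono[rotated])
    thus ?thesis using p_ratio by (intro mult_mono of_nat_mono of_nat_0_le_iff) auto
  qed
  also have "\<dots> = 76 * real j" using k_pos by (simp add: field_simps)
  finally show ?thesis using ln_ge by simp
qed

text \<open>The squares of the degrees into \<open>P\<close> sum to at most k |P|^2 \<le> 25 j^2 k,
  so with p \<le> 2 (ln n) / k the weights without the prefactor sum to 100 j^2 (ln n)^2 / k. This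
  is so small that a gain of k / (5 j) can be extracted for every vertex of
  \<open>S\<close>.\<close>

lemma sum_unattached_le:
  assumes j: "1 \<le> j" and P: "P \<in> small (5 * j)"
  shows "(\<Sum>S\<in>small (5 * j). \<Prod>v\<in>S. (k / (5 * j)) * (p\<^sup>2 * (real (deg_in v P))\<^sup>2)) \<le> ln n ^ (10 * j) * exp (20 * real j)"
proof -
  note P' = smallD[OF P]
  let ?f = "\<lambda>v. (k / (5 * j)) * (p\<^sup>2 * (real (deg_in v P))\<^sup>2)"
  have "(\<Sum>S\<in>small (5 * j). prod ?f S) \<le> ((ln n)\<^sup>2) ^ (5 * j) * exp ((\<Sum>v\<in>V. ?f v) / (ln n)\<^sup>2)"
    unfolding small_def using finV ln_ge by (intro sum_subsets_prod_le) auto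
  also have "(\<Sum>v\<in>V. ?f v) / (ln n)\<^sup>2 = (k / (5 * j)) * ((p / ln n)\<^sup>2 * (\<Sum>v\<in>V. (real (deg_in v P))\<^sup>2))"
    unfolding sum_distrib_left[symmetric] by (simp add: power_divide)
  also have "\<dots> \<le> (k / (5 * j)) * ((2 / k)\<^sup>2 * (25 * j\<^sup>2 * k))"
  proof -
    have "(\<Sum>v\<in>V. (real (deg_in v P))\<^sup>2) \<le> (\<Sum>v\<in>V. real (card P) * real (deg_in v P))"
    proof (rule sum_mono)
      fix v
      have "deg_in v P \<le> card P" unfolding deg_in_def using P' by (intro card_mono) auto
      thus "(real (deg_in v P))\<^sup>2 \<le> real (card P) * real (deg_in v P)"
        by (simp add: power2_eq_square mult_right_mono)
    qed
    also have "\<dots> = real (card P) * real (\<Sum>v\<in>V. deg_in v P)" by (simp add: sum_distrib_left[symmetric])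
    also have "\<dots> = real (card P) * real (card P) * k" using sum_deg_in_V[of P] P' by simp
    also have "\<dots> \<le> (5 * real j) * (5 * real j) * k"
      using P' by (intro mult_mono) auto
    also have "\<dots> = 25 * j\<^sup>2 * k" by (simp add: power2_eq_square)
    finally show ?thesis using p_ratio
      by (intro mult_left_mono mult_mono power_mono) (auto intro: sum_nonneg)
  qed
  also have "\<dots> = 20 * real j" using k_pos j by (simp add: field_simps power2_eq_square)
  finally show ?thesis using ln_ge by (simp add: power_mult[symmetric])
qed

text \<open>The factor 2 stands for the two ways \<open>ZA\<close> and \<open>ZB\<close> of naming
  the errors. \<open>ZA\<close> gives the exponent 2 + (56 + 76) j, bounded by 134 j, and
  \<open>ZB\<close> the power 5 + 5 + 10 of ln n for each unit of j; both are rounded up to the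
  common bound.\<close>

lemma process_prob_container:
  assumes J: "J \<subseteq> V" and j: "1 \<le> j" "15 * j \<le> y0" "40 * j \<le> k" and m: "real n / k \<le> (ln n)\<^sup>2"
  shows "process_prob E (\<lambda>xs. \<exists>I. sparse_set j I \<and> j * k \<le> edges_in I \<and>
      (\<forall>p\<in>I - J. 7 * k \<le> 8 * deg_in p I) \<and> (\<forall>q\<in>J - I. 8 * deg_in q I \<le> k) \<and>
      obstruction (set (take s xs)) (set (take t xs)) I)
    \<le> 2 * exp (- ln n * j / 4) * (ln n ^ (20 * j) * exp (134 * real j))" (is "process_prob E ?bad \<le> ?rhs")
proof (cases "\<exists>xs. ?bad xs")
  \<comment> \<open>The degree bound \<open>W\<close> for \<open>J\<close> is inherited from a
    witness \<open>I\<close>, so it is available only if the bad event can occur at all.\<close>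
  case False
  hence "process_prob E ?bad = 0" by (simp add: process_prob_def)
  thus ?thesis using ln_ge by simp
next
  case True
  hence W: "deg_sum J J + deg_sum (V - J) (V - J) \<le> 28 * j * k"
    using container_card(3)[OF _ J] by blast
  define g where "g = exp (- ln n * j / 4)"
  \<comment> \<open>In \<open>ZB\<close> each vertex of \<open>Qu\<close> has the gain \<beta> of
    \<open>sum_unattached_le\<close> to give away. As \<open>card P \<le> 2 * card Qu\<close>, every
    vertex of \<open>P\<close> can receive a factor 1 / sqrt \<beta>; with the n^(-1/2) of
    \<open>q_power_le\<close> this makes the weight \<open>f\<close>.\<close>
  define \<beta> where "\<beta> = real k / (5 * j)"
  define f where "f = exp (- ln n / 2) / sqrt \<beta>"
  have \<beta>: "\<beta> \<ge> 1" using j by (simp add: \<beta>_def field_simps)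
  have f: "f \<ge> 0" using \<beta> by (simp add: f_def)
  let ?S = "small (5 * j)"
  let ?I = "\<lambda>Qa Qu P. (J - (Qa \<union> Qu)) \<union> P"
  define valid where "valid Qa Qu P \<longleftrightarrow> Qa \<subseteq> J \<and> Qu \<subseteq> J \<and> Qa \<inter> Qu = {} \<and> P \<subseteq> V - J \<and>
     j * k \<le> edges_in (?I Qa Qu P) \<and> 4 * k * card P \<le> 5 * edges_in (?I Qa Qu P)" for Qa Qu P
  define evA where "evA = (\<lambda>(Qu, Qa, P) xs. {e \<in> E. e \<subseteq> ?I Qa Qu P} \<inter> set (take s xs) = {} \<and>
      (\<forall>v\<in>Qa. \<exists>u\<in>?I Qa Qu P \<inter> J. {v, u} \<in> set (take t xs)) \<and> (\<forall>v\<in>P. \<exists>u\<in>V - ?I Qa Qu P. {v, u} \<in> set (take t xs)))"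
  define evB where "evB = (\<lambda>(P, Qa, Qu) xs. {e \<in> E. e \<subseteq> ?I Qa Qu P} \<inter> set (take s xs) = {} \<and>
      (\<forall>v\<in>Qa. \<exists>u\<in>?I Qa Qu P \<inter> J. {v, u} \<in> set (take t xs)) \<and>
      (\<forall>v\<in>Qu. \<exists>u\<in>P. \<exists>u'\<in>P. u \<noteq> u' \<and> {v, u} \<in> set (take t xs) \<and> {v, u'} \<in> set (take t xs)))"
  \<comment> \<open>The components are listed in the order of summation, outermost first, since the
    weight of the last one depends on sets before it.\<close>
  define ZA where "ZA = {(Qu, Qa, P). (Qu, Qa, P) \<in> ?S \<times> ?S \<times> ?S \<and> valid Qa Qu P \<and> 2 * card Qu \<le> card P}"
  define ZB where "ZB = {(P, Qa, Qu). (P, Qa, Qu) \<in> ?S \<times> ?S \<times> ?S \<and> valid Qa Qu P \<and> card P \<le> 2 * card Qu}"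
  let ?wa = "\<lambda>Qa. \<Prod>v\<in>Qa. p * real (own_deg J v)"
  let ?wp = "\<lambda>Q P. \<Prod>v\<in>P. p * (real (own_deg J v) + real (deg_in v Q))"
  let ?wu = "\<lambda>P Qu. \<Prod>v\<in>Qu. \<beta> * (p\<^sup>2 * (real (deg_in v P))\<^sup>2)"
  define tA where "tA = (\<lambda>(Qu, Qa, P). (\<Prod>v\<in>Qu. 1 / real n) * (?wa Qa * ?wp (Qa \<union> Qu) P))"
  define tB where "tB = (\<lambda>(P, Qa, Qu). (\<Prod>v\<in>P. f) * (?wa Qa * ?wu P Qu))"
  have fS3: "finite (?S \<times> ?S \<times> ?S)" using finite_small by simp
  have subAB: "ZA \<subseteq> ?S \<times> ?S \<times> ?S" "ZB \<subseteq> ?S \<times> ?S \<times> ?S" by (auto simp: ZA_def ZB_def)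
  have finAB: "finite ZA" "finite ZB" using subAB fS3 finite_subset by blast+
  have nonneg: "?wa Qa \<ge> 0" "?wp Q P \<ge> 0" "?wu P Qu \<ge> 0" for Qa Q P Qu
    using p_nonneg \<beta> by (auto intro!: prod_nonneg)
  have "process_prob E ?bad \<le> process_prob E (\<lambda>xs. (\<exists>z\<in>ZA. evA z xs) \<or> (\<exists>z\<in>ZB. evB z xs))"
  proof (rule process_prob_mono[OF finE])
    fix xs assume "?bad xs"
    then obtain I where I: "sparse_set j I" "j * k \<le> edges_in I"
      "\<forall>p\<in>I - J. 7 * k \<le> 8 * deg_in p I" "\<forall>q\<in>J - I. 8 * deg_in q I \<le> k"
      "obstruction (set (take s xs)) (set (take t xs)) I" by (elim exE conjE) (rule that; assumption)
    obtain Qa Qu P where z: "Qa \<subseteq> J" "Qu \<subseteq> J" "Qa \<inter> Qu = {}" "P \<subseteq> V - J" "I = ?I Qa Qu P"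
      "card Qa \<le> 5 * j" "card Qu \<le> 5 * j" "card P \<le> 5 * j" "4 * k * card P \<le> 5 * edges_in I"
      "\<forall>v\<in>Qa. \<exists>u\<in>I \<inter> J. {v, u} \<in> set (take t xs)" "\<forall>v\<in>P. \<exists>u\<in>V - I. {v, u} \<in> set (take t xs)"
      "\<forall>v\<in>Qu. \<exists>u\<in>P. \<exists>u'\<in>P. u \<noteq> u' \<and> {v, u} \<in> set (take t xs) \<and> {v, u'} \<in> set (take t xs)"
      by (rule obstruction_cases[OF J I(1) j(3) I(3,4,5)])
    have v: "valid Qa Qu P" using z(1-4,9) I(2) unfolding valid_def z(5)[symmetric] by simp
    have s: "Qa \<in> ?S" "Qu \<in> ?S" "P \<in> ?S" using z J by (auto simp: small_def)
    have ind: "{e \<in> E. e \<subseteq> I} \<inter> set (take s xs) = {}" using I(5) by (auto simp: obstruction_def)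
    show "(\<exists>z\<in>ZA. evA z xs) \<or> (\<exists>z\<in>ZB. evB z xs)"
    proof (cases "2 * card Qu \<le> card P")
      case True
      hence "(Qu, Qa, P) \<in> ZA" using v s by (simp add: ZA_def)
      moreover have "evA (Qu, Qa, P) xs" using ind z(10,11) unfolding evA_def prod.case z(5)[symmetric] by simp
      ultimately show ?thesis by blast
    next
      case False
      hence "(P, Qa, Qu) \<in> ZB" using v s by (simp add: ZB_def)
      moreover have "evB (P, Qa, Qu) xs" using ind z(10,12) unfolding evB_def prod.case z(5)[symmetric] by blast
      ultimately show ?thesis by blast
    qed
  qed
  also have "\<dots> \<le> process_prob E (\<lambda>xs. \<exists>z\<in>ZA. evA z xs) + process_prob E (\<lambda>xs. \<exists>z\<in>ZB. evB z xs)"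
    by (rule process_prob_disj)
  also have "\<dots> \<le> (\<Sum>z\<in>ZA. process_prob E (evA z)) + (\<Sum>z\<in>ZB. process_prob E (evB z))"
    using finAB by (intro add_mono process_prob_UN)
  also have "\<dots> \<le> (\<Sum>z\<in>ZA. g * tA z) + (\<Sum>z\<in>ZB. g * tB z)"
  proof (intro add_mono sum_mono)
    fix z assume "z \<in> ZA"
    then obtain Qu Qa P where z: "z = (Qu, Qa, P)" "Qu \<in> ?S" "Qa \<in> ?S" "P \<in> ?S" "valid Qa Qu P" "2 * card Qu \<le> card P"
      by (auto simp: ZA_def)
    have "process_prob E (evA z) \<le> ?wa Qa * ?wp (Qa \<union> Qu) P * q ^ edges_in (?I Qa Qu P)"
      unfolding z(1) evA_def prod.case
      using z smallD[OF z(3)] smallD[OF z(4)] J j by (intro prob_few_unattached) (auto simp: valid_def)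
    also have "\<dots> \<le> ?wa Qa * ?wp (Qa \<union> Qu) P * (g * exp (- ln n / 2) ^ card P)"
      unfolding g_def using z(5) nonneg
      by (intro mult_left_mono q_power_le mult_nonneg_nonneg) (auto simp: valid_def)
    \<comment> \<open>Two vertices of \<open>P\<close> pay 1/n for one vertex of \<open>Qu\<close>.
      With 2n vertices in all, summing over \<open>Qu\<close> then costs at most exp 2.\<close>
    also have "\<dots> \<le> ?wa Qa * ?wp (Qa \<union> Qu) P * (g * exp (- ln n / 2) ^ (2 * card Qu))"
      using z(6) ln_ge nonneg by (intro mult_left_mono mult_nonneg_nonneg power_decreasing) (auto simp: g_def)
    also have "exp (- ln n / 2) ^ (2 * card Qu) = (\<Prod>v\<in>Qu. 1 / real n)"
      unfolding power_mult exp_half_square by simp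
    finally show "process_prob E (evA z) \<le> g * tA z"
      by (simp only: z(1) tA_def prod.case mult_ac)
  next
    fix z assume "z \<in> ZB"
    then obtain Qu Qa P where z: "z = (P, Qa, Qu)" "Qu \<in> ?S" "Qa \<in> ?S" "P \<in> ?S" "valid Qa Qu P" "card P \<le> 2 * card Qu"
      by (auto simp: ZB_def)
    let ?u = "\<Prod>v\<in>Qu. p\<^sup>2 * (real (deg_in v P))\<^sup>2"
    have "process_prob E (evB z) \<le> ?wa Qa * ?u * q ^ edges_in (?I Qa Qu P)"
      unfolding z(1) evB_def prod.case
      using z smallD[OF z(2)] smallD[OF z(3)] J j by (intro prob_many_unattached) (auto simp: valid_def)
    also have "\<dots> \<le> ?wa Qa * ?u * (g * exp (- ln n / 2) ^ card P)"
      unfolding g_def using z(5) p_nonneg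
      by (intro mult_left_mono q_power_le mult_nonneg_nonneg prod_nonneg) (auto simp: valid_def)
    also have "?u = (1 / sqrt \<beta>) ^ (2 * card Qu) * ?wu P Qu"
    proof -
      have "(1 / sqrt \<beta>) ^ (2 * card Qu) = (1 / \<beta>) ^ card Qu"
        unfolding power_mult using \<beta> by (simp add: power_divide)
      thus ?thesis using \<beta> by (simp add: prod.distrib power_divide)
    qed
    also have "?wa Qa * ((1 / sqrt \<beta>) ^ (2 * card Qu) * ?wu P Qu) * (g * exp (- ln n / 2) ^ card P)
       \<le> ?wa Qa * ((1 / sqrt \<beta>) ^ card P * ?wu P Qu) * (g * exp (- ln n / 2) ^ card P)"
      using nonneg z(6) \<beta> by (intro mult_left_mono mult_right_mono power_decreasing) (auto simp: g_def)
    also have "\<dots> = g * tB z" by (simp add: z(1) tB_def f_def power_divide mult_ac)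
    finally show "process_prob E (evB z) \<le> g * tB z" .
  qed
  also have "\<dots> = g * (\<Sum>z\<in>ZA. tA z) + g * (\<Sum>z\<in>ZB. tB z)" by (simp add: sum_distrib_left)
  also have "(\<Sum>z\<in>ZA. tA z) \<le> ln n ^ (20 * j) * exp (134 * real j)"
  proof -
    have "(\<Sum>z\<in>ZA. tA z) \<le> (\<Sum>z\<in>?S \<times> ?S \<times> ?S. tA z)"
      using fS3 subAB p_nonneg by (intro sum_mono2) (auto simp: tA_def intro!: mult_nonneg_nonneg prod_nonneg)
    also have "\<dots> = (\<Sum>Qu\<in>?S. (\<Prod>v\<in>Qu. 1 / real n) * (\<Sum>Qa\<in>?S. ?wa Qa * (\<Sum>P\<in>?S. ?wp (Qa \<union> Qu) P)))"
      by (simp add: sum.cartesian_product[symmetric] tA_def sum_distrib_left mult_ac)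
    also have "\<dots> \<le> (\<Sum>Qu\<in>?S. (\<Prod>v\<in>Qu. 1 / real n) * (\<Sum>Qa\<in>?S. ?wa Qa * (ln n ^ (5 * j) * exp (76 * real j))))"
    proof (intro sum_mono mult_left_mono)
      fix Qu Qa assume Q: "Qu \<in> ?S" "Qa \<in> ?S"
      have "card (Qa \<union> Qu) \<le> 10 * j"
        using card_Un_le[of Qa Qu] smallD[OF Q(1)] smallD[OF Q(2)] by linarith
      thus "(\<Sum>P\<in>?S. ?wp (Qa \<union> Qu) P) \<le> ln n ^ (5 * j) * exp (76 * real j)"
        using smallD[OF Q(1)] smallD[OF Q(2)] by (intro sum_added_le[OF J W]) auto
    qed (use p_nonneg in \<open>auto intro!: prod_nonneg\<close>)
    also have "\<dots> = (\<Sum>Qu\<in>?S. \<Prod>v\<in>Qu. 1 / real n) * ((\<Sum>Qa\<in>?S. ?wa Qa) * (ln n ^ (5 * j) * exp (76 * real j)))"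
      by (simp only: sum_distrib_right)
    also have "\<dots> \<le> (1 ^ (5 * j) * exp ((\<Sum>v\<in>V. 1 / real n) / 1)) * ((ln n ^ (5 * j) * exp (56 * real j)) * (ln n ^ (5 * j) * exp (76 * real j)))"
    proof (intro mult_mono mult_nonneg_nonneg mult_right_mono)
      show "(\<Sum>Qu\<in>?S. \<Prod>v\<in>Qu. 1 / real n) \<le> 1 ^ (5 * j) * exp ((\<Sum>v\<in>V. 1 / real n) / 1)"
        unfolding small_def using finV by (intro sum_subsets_prod_le) auto
      show "(\<Sum>Qa\<in>?S. ?wa Qa) \<le> ln n ^ (5 * j) * exp (56 * real j)" by (rule sum_attached_le[OF J W])
    qed (use p_nonneg f ln_ge in \<open>auto intro!: sum_nonneg prod_nonneg\<close>)
    also have "(\<Sum>v\<in>V. 1 / real n) / 1 = 2" using cardV real_n by simp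
    also have "(1 ^ (5 * j) * exp 2) * ((ln n ^ (5 * j) * exp (56 * real j)) * (ln n ^ (5 * j) * exp (76 * real j)))
       = ln n ^ (10 * j) * exp (2 + 132 * real j)"
    proof -
      have "exp (2 + 132 * real j) = exp 2 * (exp (56 * real j) * exp (76 * real j))"
        by (simp add: mult_exp_exp)
      moreover have "ln n ^ (10 * j) = ln n ^ (5 * j) * ln n ^ (5 * j)" by (simp flip: power_add)
      ultimately show ?thesis by (simp only: mult_ac power_one mult_1)
    qed
    also have "\<dots> \<le> ln n ^ (20 * j) * exp (134 * real j)"
      using ln_ge j by (intro mult_mono power_increasing) auto
    finally show ?thesis .
  qed
  also have "(\<Sum>z\<in>ZB. tB z) \<le> ln n ^ (20 * j) * exp (134 * real j)"
  proof -
    have "(\<Sum>z\<in>ZB. tB z) \<le> (\<Sum>z\<in>?S \<times> ?S \<times> ?S. tB z)"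
      using fS3 subAB p_nonneg \<beta> f by (intro sum_mono2) (auto simp: tB_def intro!: mult_nonneg_nonneg prod_nonneg)
    also have "\<dots> = (\<Sum>P\<in>?S. (\<Prod>v\<in>P. f) * (\<Sum>Qa\<in>?S. ?wa Qa * (\<Sum>Qu\<in>?S. ?wu P Qu)))"
      by (simp add: sum.cartesian_product[symmetric] tB_def sum_distrib_left mult_ac)
    also have "\<dots> \<le> (\<Sum>P\<in>?S. (\<Prod>v\<in>P. f) * (\<Sum>Qa\<in>?S. ?wa Qa * (ln n ^ (10 * j) * exp (20 * real j))))"
    proof (intro sum_mono mult_left_mono)
      fix P assume "P \<in> ?S"
      thus "(\<Sum>Qu\<in>?S. ?wu P Qu) \<le> ln n ^ (10 * j) * exp (20 * real j)"
        using sum_unattached_le[OF j(1)] by (simp add: \<beta>_def)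
    qed (use p_nonneg f in \<open>auto intro!: prod_nonneg\<close>)
    also have "\<dots> = (\<Sum>P\<in>?S. \<Prod>v\<in>P. f) * ((\<Sum>Qa\<in>?S. ?wa Qa) * (ln n ^ (10 * j) * exp (20 * real j)))"
      by (simp only: sum_distrib_right)
    also have "\<dots> \<le> (ln n ^ (5 * j) * exp (10 * real j)) * ((ln n ^ (5 * j) * exp (56 * real j)) * (ln n ^ (10 * j) * exp (20 * real j)))"
    proof (intro mult_mono mult_nonneg_nonneg mult_right_mono)
      have "(\<Sum>P\<in>?S. \<Prod>v\<in>P. f) \<le> ln n ^ (5 * j) * exp ((\<Sum>v\<in>V. f) / ln n)"
        unfolding small_def using finV f ln_ge by (intro sum_subsets_prod_le) auto
      also have "(\<Sum>v\<in>V. f) / ln n = 2 * n * f / ln n" using cardV by simp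
      also have "\<dots> \<le> 10 * real j"
      proof -
        \<comment> \<open>By the choice of \<beta>, the square of n f is n / \<beta> = 5 j n / k, so
          even blind choices of \<open>P\<close> have total weight O(j ln n).\<close>
        have "(n * f)\<^sup>2 = n\<^sup>2 * ((exp (- ln n / 2))\<^sup>2 / \<beta>)"
          using \<beta> by (simp add: f_def power_mult_distrib power_divide)
        also note exp_half_square
        also have "n\<^sup>2 * (1 / n / \<beta>) = real n / k * (5 * j)"
          using real_n k_pos j by (simp add: \<beta>_def power2_eq_square field_simps)
        also have "\<dots> \<le> (ln n)\<^sup>2 * (5 * j)\<^sup>2"
        proof -
          have "real (5 * j) * 1 \<le> real (5 * j) * real (5 * j)" using j by (intro mult_left_mono) auto
          hence "real (5 * j) \<le> (5 * real j)\<^sup>2" by (simp add: power2_eq_square)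
          thus ?thesis using m by (intro mult_mono) auto
        qed
        finally have "(n * f)\<^sup>2 \<le> (ln n * (5 * j))\<^sup>2" by (simp add: power_mult_distrib)
        hence "n * f \<le> ln n * (5 * j)" by (rule power2_le_imp_le) (use ln_ge in simp)
        hence "2 * n * f \<le> (10 * real j) * ln n" by (simp add: mult_ac)
        thus ?thesis using ln_ge by (simp only: pos_divide_le_eq)
      qed
      finally show "(\<Sum>P\<in>?S. \<Prod>v\<in>P. f) \<le> ln n ^ (5 * j) * exp (10 * real j)" using ln_ge by simp
      show "(\<Sum>Qa\<in>?S. ?wa Qa) \<le> ln n ^ (5 * j) * exp (56 * real j)" by (rule sum_attached_le[OF J W])
    qed (use p_nonneg f ln_ge in \<open>auto intro!: sum_nonneg prod_nonneg\<close>)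
    also have "\<dots> = ln n ^ (20 * j) * exp (86 * real j)"
    proof -
      have "exp (86 * real j) = exp (10 * real j) * (exp (56 * real j) * exp (20 * real j))"
        by (simp add: mult_exp_exp)
      moreover have "ln n ^ (20 * j) = ln n ^ (5 * j) * (ln n ^ (5 * j) * ln n ^ (10 * j))" by (simp flip: power_add)
      ultimately show ?thesis by (simp only: mult_ac)
    qed
    also have "\<dots> \<le> ln n ^ (20 * j) * exp (134 * real j)"
      using ln_ge by (intro mult_mono) auto
    finally show ?thesis .
  qed
  finally show ?thesis by (simp add: g_def mult_ac)
qed

end

text \<open>The base of a geometric series in \<open>j\<close>. The decisive factor is
  \<open>exp (- ln n / 4)\<close>, that is n^(-1/4); the others are n^o(1) and come from the number
  of containers and from \<open>process_prob_container\<close>.\<close>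

definition rate :: "nat \<Rightarrow> real" where
  "rate n = 516 * ln n * 2 powr (5 * ln n powr (1/3)) * 2 ^ 256 * exp (- ln n / 4) * ln n ^ 20 * exp 134"

section \<open>Summation over containers and over \<open>j\<close>\<close>

context regular_graph_process
begin

context
  assumes k_le: "k \<le> n" and k_large: "50 * (real n / k) \<le> ln n powr (1/3)"
    and y0_large: "60 * (n / ln n) \<le> y0"
begin

lemma ratio_ge_1: "real n / k \<ge> 1"
  using k_le k_pos by simp

lemma ratio_cubed: "125000 * (real n / k) ^ 3 \<le> ln n"
proof -
  have "125000 * (real n / k) ^ 3 = (50 * (real n / k)) ^ 3" by (subst power_mult_distrib) simp
  also have "\<dots> \<le> (ln n powr (1/3)) ^ 3"
    using k_large by (intro power_mono) auto
  also have "\<dots> = ln n" using ln_ge by (simp add: powr_power)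
  finally show ?thesis .
qed

lemma ratio_powers: "real n / k \<le> (real n / k) ^ 3" "(real n / k)\<^sup>2 \<le> (real n / k) ^ 3"
  using ratio_ge_1 power_increasing[of 1 3 "real n / k"] power_increasing[of 2 3 "real n / k"] by simp_all

lemma ratio_le: "real n / k \<le> ln n powr (1/3)" "real n / k \<le> ln n" "real n / k \<le> (ln n)\<^sup>2"
proof -
  show "real n / k \<le> ln n powr (1/3)" using k_large ratio_ge_1 by linarith
  show le: "real n / k \<le> ln n" using ratio_cubed ratio_powers ratio_ge_1 by linarith
  have "ln n * 1 \<le> ln n * ln n" using ln_ge by (intro mult_left_mono) auto
  thus "real n / k \<le> (ln n)\<^sup>2" using le by (simp add: power2_eq_square)
qed

text \<open>Here the cube of n / k is needed: as j is at most 4 n / ln n, the errors in the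
  container construction stay within k/32 because 773 * 4 * 32 = 98944 is below 125000 = 50^3.
  Likewise 60 = 15 * 4 in \<open>y0_large\<close>.\<close>

lemma index_bounds:
  assumes "real j * ln n \<le> 4 * n"
  shows "15 * j \<le> y0" "40 * j \<le> k" "773 * real j * (real n / k)\<^sup>2 \<le> k / 32"
proof -
  have j: "real j \<le> 4 * (n / ln n)" using assms ln_ge by (simp add: field_simps)
  have "real (15 * j) \<le> real y0" using j y0_large by simp
  thus "15 * j \<le> y0" by (simp only: of_nat_le_iff)
  let ?m = "real n / k"
  have nk: "real n = ?m * k" using k_pos by simp
  have m3: "n / ln n * ?m\<^sup>2 * 125000 \<le> k"
  proof -
    have "n * ?m\<^sup>2 = k * ?m ^ 3" using nk by (simp add: power2_eq_square power3_eq_cube)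
    hence "n * ?m\<^sup>2 * 125000 \<le> k * ln n"
      using mult_left_mono[OF ratio_cubed, of "real k"] by (simp add: mult_ac)
    hence "n * ?m\<^sup>2 * 125000 / ln n \<le> k" using ln_ge by (subst pos_divide_le_eq) auto
    thus ?thesis by (simp add: mult_ac)
  qed
  have "773 * real j * ?m\<^sup>2 \<le> 773 * (4 * (n / ln n)) * ?m\<^sup>2"
    using j by (intro mult_right_mono mult_left_mono) auto
  also have "\<dots> \<le> k / 32" using m3 k_pos by simp
  finally show "773 * real j * ?m\<^sup>2 \<le> k / 32" .
  have "n / ln n * 1 \<le> n / ln n * ?m\<^sup>2" using ratio_ge_1 ln_ge by (intro mult_left_mono) auto
  hence "40 * real j \<le> real k" using j m3 by linarith
  hence "real (40 * j) \<le> real k" by simp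
  thus "40 * j \<le> k" by (simp only: of_nat_le_iff)
qed

text \<open>As j is at least 1, each factor that is at least 1 may be raised to the power j. The
  constant is 516 = 2 * 129 * 2, whose last 2 absorbs j \<le> 2^j.\<close>

lemma containers_total_le:
  assumes j: "1 \<le> j"
    and c: "c \<le> (128 * real j * (real n / k) + 1) * (2 powr (5 * real n / k) * 2 ^ (256 * j))"
  shows "c * (2 * exp (- ln n * j / 4) * (ln n ^ (20 * j) * exp (134 * real j))) \<le> rate n ^ j"
proof -
  let ?m = "real n / k" let ?T = "2 powr (5 * ln n powr (1/3))"
  have "128 * real j * ?m + 1 \<le> 129 * real j * ?m"
    using mult_mono[of 1 "real j" 1 ?m] j ratio_ge_1 by simp
  also have "\<dots> \<le> 129 * 2 ^ j * ln n"
    using ratio_le(2) ln_ge by (intro mult_mono) (auto intro: less_imp_le of_nat_less_two_power)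
  also have "2 * (129 * 2 ^ j * ln n) \<le> 258 ^ j * 2 ^ j * ln n ^ j"
  proof -
    have "(258::real) ^ 1 \<le> 258 ^ j" "ln n ^ 1 \<le> ln n ^ j" using j ln_ge by (intro power_increasing; simp)+
    hence "258 * ln n \<le> 258 ^ j * ln n ^ j" using ln_ge by (intro mult_mono) auto
    hence "2 ^ j * (258 * ln n) \<le> 2 ^ j * (258 ^ j * ln n ^ j)" by (intro mult_left_mono) auto
    thus ?thesis by (simp only: mult_ac)
  qed
  also have "(258::real) ^ j * 2 ^ j = 516 ^ j" by (simp flip: power_mult_distrib)
  finally have 1: "2 * (128 * real j * ?m + 1) \<le> 516 ^ j * ln n ^ j" by simp
  have "2 powr (5 * real n / k) \<le> ?T" using ratio_le(1) by (intro powr_mono) auto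
  also have "?T \<le> ?T ^ j" using power_increasing[of 1 j ?T] j ge_one_powr_ge_zero[of 2] by simp
  finally have 2: "2 powr (5 * real n / k) \<le> ?T ^ j" .
  have "c * (2 * exp (- ln n * j / 4) * (ln n ^ (20 * j) * exp (134 * real j)))
    \<le> (128 * real j * ?m + 1) * (2 powr (5 * real n / k) * 2 ^ (256 * j)) * (2 * exp (- ln n * j / 4) * (ln n ^ (20 * j) * exp (134 * real j)))"
    using c ln_ge by (intro mult_right_mono) auto
  also have "\<dots> = (2 * (128 * real j * ?m + 1)) * (2 powr (5 * real n / k) * (2 ^ (256 * j) * (exp (- ln n * j / 4) * (ln n ^ (20 * j) * exp (134 * real j)))))"
    by (simp only: mult_ac)
  also have "\<dots> \<le> (516 ^ j * ln n ^ j) * (?T ^ j * (2 ^ (256 * j) * (exp (- ln n * j / 4) * (ln n ^ (20 * j) * exp (134 * real j)))))"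
    by (rule mult_mono[OF 1 mult_right_mono[OF 2]]) (use ln_ge in auto)
  also have "\<dots> = rate n ^ j"
  proof -
    have "exp (- ln n * j / 4) = exp (- ln n / 4) ^ j" "exp (134 * real j) = exp 134 ^ j"
      by (simp_all add: exp_of_nat_mult[symmetric] mult_ac)
    thus ?thesis unfolding rate_def power_mult_distrib power_mult by (simp only: mult_ac)
  qed
  finally show ?thesis .
qed

text \<open>With 4 n k / ln n spanned edges the power of \<open>q\<close> is at most exp (-7n/2),
  which beats the 4^n subsets of \<open>V\<close>.\<close>

lemma process_prob_dense_obstruction:
  "process_prob E (\<lambda>xs. \<exists>I. I \<subseteq> V \<and> real (edges_in I) * ln n \<ge> 4 * n * k \<and> {e \<in> E. e \<subseteq> I} \<inter> set (take s xs) = {})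
    \<le> (4 * exp (- 7/2)) ^ n"
proof -
  let ?D = "{I. I \<subseteq> V \<and> real (edges_in I) * ln n \<ge> 4 * n * k}"
  have fD: "finite ?D" by (rule finite_subset[of _ "Pow V"]) (auto simp: finV)
  have "process_prob E (\<lambda>xs. \<exists>I. I \<subseteq> V \<and> real (edges_in I) * ln n \<ge> 4 * n * k \<and> {e \<in> E. e \<subseteq> I} \<inter> set (take s xs) = {})
     = process_prob E (\<lambda>xs. \<exists>I\<in>?D. {e \<in> E. e \<subseteq> I} \<inter> set (take s xs) = {} \<and> {} \<subseteq> set (take t xs))"
    by (simp add: conj_assoc)
  also have "\<dots> \<le> (\<Sum>I\<in>?D. process_prob E (\<lambda>xs. {e \<in> E. e \<subseteq> I} \<inter> set (take s xs) = {} \<and> {} \<subseteq> set (take t xs)))"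
    by (rule process_prob_UN[OF fD])
  also have "\<dots> \<le> (\<Sum>I\<in>?D. exp (- 7/2) ^ n)"
  proof (rule sum_mono)
    fix I assume I: "I \<in> ?D"
    have "process_prob E (\<lambda>xs. {e \<in> E. e \<subseteq> I} \<inter> set (take s xs) = {} \<and> {} \<subseteq> set (take t xs))
       \<le> p ^ card ({} :: nat set set) * q ^ card {e \<in> E. e \<subseteq> I}" by (intro prob_le) auto
    also have "\<dots> = exp (- ((7/8) * (real (edges_in I) * ln n) / k))"
      by (simp add: edges_in_def q_eq exp_of_nat_mult[symmetric] field_simps)
    also have "\<dots> \<le> exp (- (7/2 * n))"
      using I k_pos by (simp add: field_simps)
    also have "\<dots> = exp (- 7/2) ^ n" by (simp add: exp_of_nat_mult[symmetric] mult_ac)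
    finally show "process_prob E (\<lambda>xs. {e \<in> E. e \<subseteq> I} \<inter> set (take s xs) = {} \<and> {} \<subseteq> set (take t xs)) \<le> exp (- 7/2) ^ n" .
  qed
  also have "\<dots> = real (card ?D) * exp (- 7/2) ^ n" by simp
  also have "\<dots> \<le> 4 ^ n * exp (- 7/2) ^ n"
  proof -
    have "card ?D \<le> card (Pow V)" by (intro card_mono) (auto simp: finV)
    also have "\<dots> = 4 ^ n" by (simp add: card_Pow finV cardV power_mult)
    finally have "real (card ?D) \<le> real (4 ^ n)" by (rule of_nat_mono)
    thus ?thesis by (intro mult_right_mono) auto
  qed
  finally show ?thesis by (simp add: power_mult_distrib)
qed

text \<open>Dense sets are treated without containers. For the others j is at most 4 n / ln n, the
  range in which \<open>index_bounds\<close> makes containers available.\<close>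

lemma process_prob_obstruction:
  "process_prob E (\<lambda>xs. \<exists>I. obstruction (set (take s xs)) (set (take t xs)) I)
    \<le> (4 * exp (- 7/2)) ^ n + (\<Sum>j=1..n. rate n ^ j)"
proof -
  define js where "js = {j \<in> {1..n}. real j * ln n \<le> 4 * n}"
  define ev where "ev j J xs \<longleftrightarrow> (\<exists>I. sparse_set j I \<and> j * k \<le> edges_in I \<and>
      (\<forall>p\<in>I - J. 7 * k \<le> 8 * deg_in p I) \<and> (\<forall>q\<in>J - I. 8 * deg_in q I \<le> k) \<and>
      obstruction (set (take s xs)) (set (take t xs)) I)" for j J xs
  let ?b = "\<lambda>j. (128 * real j * (real n / k) + 1) * (2 powr (5 * real n / k) * 2 ^ (256 * j))"
  have "\<forall>j\<in>js. \<exists>F. finite F \<and> real (card F) \<le> ?b j \<and>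
     (\<forall>I. sparse_set j I \<longrightarrow> (\<exists>J\<in>F. J \<subseteq> V \<and>
        (\<forall>p\<in>I - J. 7 * k \<le> 8 * deg_in p I) \<and> (\<forall>q\<in>J - I. 8 * deg_in q I \<le> k)))"
    using containers[OF k_le _ index_bounds(3)] by (auto simp: js_def)
  then obtain F where "\<forall>j\<in>js. finite (F j) \<and> real (card (F j)) \<le> ?b j \<and>
     (\<forall>I. sparse_set j I \<longrightarrow> (\<exists>J\<in>F j. J \<subseteq> V \<and>
        (\<forall>p\<in>I - J. 7 * k \<le> 8 * deg_in p I) \<and> (\<forall>q\<in>J - I. 8 * deg_in q I \<le> k)))"
    by (rule bchoice[THEN exE])
  hence F: "\<And>j. j \<in> js \<Longrightarrow> finite (F j)" "\<And>j. j \<in> js \<Longrightarrow> real (card (F j)) \<le> ?b j"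
    "\<And>j I. j \<in> js \<Longrightarrow> sparse_set j I \<Longrightarrow> \<exists>J\<in>F j. J \<subseteq> V \<and>
        (\<forall>p\<in>I - J. 7 * k \<le> 8 * deg_in p I) \<and> (\<forall>q\<in>J - I. 8 * deg_in q I \<le> k)"
    by simp_all
  define F' where "F' j = {J \<in> F j. J \<subseteq> V}" for j
  have F': "finite (F' j)" "card (F' j) \<le> card (F j)" if "j \<in> js" for j
    using F(1)[OF that] by (auto simp: F'_def intro: card_mono)
  let ?dense = "\<lambda>xs. \<exists>I. I \<subseteq> V \<and> real (edges_in I) * ln n \<ge> 4 * n * k \<and> {e \<in> E. e \<subseteq> I} \<inter> set (take s xs) = {}"
  have "process_prob E (\<lambda>xs. \<exists>I. obstruction (set (take s xs)) (set (take t xs)) I)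
     \<le> process_prob E (\<lambda>xs. ?dense xs \<or> (\<exists>j\<in>js. \<exists>J\<in>F' j. ev j J xs))"
  proof (rule process_prob_mono[OF finE])
    fix xs assume "\<exists>I. obstruction (set (take s xs)) (set (take t xs)) I"
    then obtain I where I: "obstruction (set (take s xs)) (set (take t xs)) I" by blast
    have I': "I \<subseteq> V" "card I > n" "{e \<in> E. e \<subseteq> I} \<inter> set (take s xs) = {}"
      using I by (auto simp: obstruction_def)
    show "?dense xs \<or> (\<exists>j\<in>js. \<exists>J\<in>F' j. ev j J xs)"
    proof (cases "real (edges_in I) * ln n \<ge> 4 * n * k")
      case True
      thus ?thesis using I' by blast
    next
      case False
      define j where "j = edges_in I div k"
      have ge: "edges_in I \<ge> k" using edges_in_large(1) I' by blast
      have j: "1 \<le> j" "j * k \<le> edges_in I"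
        using ge k_pos by (simp_all add: j_def div_greater_zero_iff Suc_le_eq)
      have "edges_in I < (j + 1) * k" using k_pos by (simp add: j_def dividend_less_times_div mult.commute)
      also have "\<dots> \<le> 2 * j * k" using j(1) by (intro mult_right_mono) auto
      finally have sp: "sparse_set j I" using I' by (simp add: sparse_set_def)
      have "real (j * k) * ln n \<le> real (edges_in I) * ln n" using j(2) ln_ge by (intro mult_right_mono of_nat_mono) auto
      hence "real k * (real j * ln n) \<le> real k * (4 * n)" using False by (simp add: mult_ac)
      hence jL: "real j * ln n \<le> 4 * n" using k_pos by simp
      \<comment> \<open>Together with \<open>jL\<close> this places j in the index range of the
        final sum.\<close>
      have "4 \<le> ln n" using ratio_cubed ratio_powers ratio_ge_1 by linarith
      hence "real j * 4 \<le> real j * ln n" by (intro mult_left_mono) auto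
      hence "j \<le> n" using jL by linarith
      hence js: "j \<in> js" using j jL by (simp add: js_def)
      obtain J where J: "J \<in> F j" "J \<subseteq> V" "\<forall>p\<in>I - J. 7 * k \<le> 8 * deg_in p I" "\<forall>q\<in>J - I. 8 * deg_in q I \<le> k"
        using F(3)[OF js sp] by (elim bexE conjE) (rule that)
      have "ev j J xs" unfolding ev_def by (rule exI[of _ I]) (intro conjI sp j(2) J(3,4) I)
      moreover have "J \<in> F' j" using J by (simp add: F'_def)
      ultimately show ?thesis using js by blast
    qed
  qed
  also have "\<dots> \<le> process_prob E ?dense + process_prob E (\<lambda>xs. \<exists>j\<in>js. \<exists>J\<in>F' j. ev j J xs)"
    by (rule process_prob_disj)
  also have "process_prob E ?dense \<le> (4 * exp (- 7/2)) ^ n" by (rule process_prob_dense_obstruction)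
  also have "process_prob E (\<lambda>xs. \<exists>j\<in>js. \<exists>J\<in>F' j. ev j J xs) \<le> (\<Sum>j\<in>js. process_prob E (\<lambda>xs. \<exists>J\<in>F' j. ev j J xs))"
    by (rule process_prob_UN) (simp add: js_def)
  also have "\<dots> \<le> (\<Sum>j\<in>js. rate n ^ j)"
  proof (rule sum_mono)
    fix j assume j: "j \<in> js"
    hence j': "1 \<le> j" "real j * ln n \<le> 4 * n" by (auto simp: js_def)
    let ?r = "2 * exp (- ln n * j / 4) * (ln n ^ (20 * j) * exp (134 * real j))"
    have "process_prob E (\<lambda>xs. \<exists>J\<in>F' j. ev j J xs) \<le> (\<Sum>J\<in>F' j. process_prob E (ev j J))"
      by (rule process_prob_UN[OF F'(1)[OF j]])
    also have "\<dots> \<le> (\<Sum>J\<in>F' j. ?r)"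
    proof (rule sum_mono)
      fix J assume "J \<in> F' j"
      hence "J \<subseteq> V" by (simp add: F'_def)
      thus "process_prob E (ev j J) \<le> ?r"
        unfolding ev_def using j' index_bounds[OF j'(2)] ratio_le(3) by (intro process_prob_container) auto
    qed
    also have "\<dots> = real (card (F' j)) * ?r" by simp
    also have "\<dots> \<le> rate n ^ j"
      using F'(2)[OF j] F(2)[OF j] by (intro containers_total_le j') linarith
    finally show "process_prob E (\<lambda>xs. \<exists>J\<in>F' j. ev j J xs) \<le> rate n ^ j" .
  qed
  also have "\<dots> \<le> (\<Sum>j=1..n. rate n ^ j)"
    using ln_ge by (intro sum_mono2) (auto simp: js_def rate_def)
  finally show ?thesis by simp
qed

end

end

section \<open>Hitting times\<close>

lemma perfect_matching_no_isolated: "has_perfect_matching V F \<Longrightarrow> no_isolated V F"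
  unfolding has_perfect_matching_def no_isolated_def by (meson subsetD)

lemma no_isolated_mono: "no_isolated V F \<Longrightarrow> F \<subseteq> F' \<Longrightarrow> no_isolated V F'"
  unfolding no_isolated_def by (meson subsetD)

context regular_graph
begin

lemma card_E: "card E = n * k"
proof -
  have "e \<subseteq> V" if "e \<in> E" for e using edgeE[OF that] by blast
  hence "{e \<in> E. e \<subseteq> V} = E" by blast
  hence "2 * card E = 2 * (n * k)"
    using handshake[OF finV] deg_sum_V[of V] cardV by (simp add: edges_in_def mult_ac)
  thus ?thesis by simp
qed

lemma card_incident: "v \<in> V \<Longrightarrow> card {e \<in> E. v \<in> e} = k"
  using reg by (simp add: regular_def degree_def)

text \<open>The graph at time \<open>tau_I\<close> has no isolated vertex and no perfect matching,
  and \<open>tau_I\<close> lies between \<open>s\<close> and \<open>t\<close>. Passing to these two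
  fixed times removes the random time from the event, so that the union bound applies.\<close>

lemma not_hitting_simultaneously:
  assumes A: "A \<subseteq> V" "\<forall>e\<in>E. card (e \<inter> A) = 1"
    and xs: "xs \<in> permutations_of_set E" and ne: "tau_M V xs \<noteq> tau_I V xs"
    and s: "\<not> no_isolated V (set (take s xs))" and t: "no_isolated V (set (take t xs))"
  shows "\<exists>I. obstruction (set (take s xs)) (set (take t xs)) I"
proof -
  let ?G = "\<lambda>i. set (take i xs)" let ?i = "tau_I V xs"
  have GE: "?G i \<subseteq> E" for i using xs set_take_subset[of i xs] by (auto simp: permutations_of_set_def)
  have iso: "no_isolated V (?G ?i)"
    using t unfolding tau_I_def hitting_time_def by (rule LeastI)
  have "?i \<le> t" using t unfolding tau_I_def hitting_time_def by (rule Least_le)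
  hence it: "?G ?i \<subseteq> ?G t" by (rule set_take_subset_set_take)
  have "s \<le> ?i"
  proof (rule ccontr)
    assume "\<not> s \<le> ?i"
    hence "?G ?i \<subseteq> ?G s" by (intro set_take_subset_set_take) auto
    thus False using s no_isolated_mono[OF iso] by blast
  qed
  hence si: "?G s \<subseteq> ?G ?i" by (rule set_take_subset_set_take)
  \<comment> \<open>A \<open>LEAST\<close> carries information only once a witness is known, so
    \<open>tau_M\<close> is compared with \<open>tau_I\<close> after assuming a perfect matching at
    time \<open>tau_I\<close>.\<close>
  have no_pm: "\<not> has_perfect_matching V (?G ?i)"
  proof
    assume pm: "has_perfect_matching V (?G ?i)"
    hence "tau_M V xs \<le> ?i" unfolding tau_M_def hitting_time_def by (rule Least_le)
    moreover have "has_perfect_matching V (?G (tau_M V xs))"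
      using pm unfolding tau_M_def hitting_time_def by (rule LeastI)
    hence "no_isolated V (?G (tau_M V xs))" by (rule perfect_matching_no_isolated)
    hence "?i \<le> tau_M V xs" unfolding tau_I_def hitting_time_def by (rule Least_le)
    ultimately show False using ne by simp
  qed
  obtain I0 where "I0 \<subseteq> V" "card I0 > n" "\<forall>e\<in>?G ?i. \<not> e \<subseteq> I0"
    using koenig[OF A GE no_pm] by (elim exE conjE) (rule that)
  then obtain I where "obstruction (?G ?i) (?G ?i) I" using obstruction_exists[OF GE iso] by blast
  thus ?thesis using obstruction_mono si it by blast
qed

text \<open>Second moment on one side \<open>A\<close>, where the stars of different vertices are
  disjoint. A star is avoided with probability at least n^(-123/128), so on average at least
  n^(5/128) vertices of \<open>A\<close> are isolated. Here 61/64 is 15/16 plus 1/64 for rounding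
  and for n - 1 in place of n; the quadratic term of ln (1 - z), with z \<le> 1/256, adds
  1/128.\<close>

lemma process_prob_no_isolated_le:
  assumes A: "A \<subseteq> V" "\<forall>e\<in>E. card (e \<inter> A) = 1"
    and n: "128 \<le> n" and L: "1 \<le> ln n" and k: "256 * ln n \<le> k" and s: "real s \<le> 15/16 * n * ln n + 1"
  shows "process_prob E (\<lambda>xs. no_isolated V (set (take s xs))) \<le> exp (- 5/128 * ln n)"
proof -
  define L where "L = ln (real n)"
  have Lk: "1 \<le> L" "256 * L \<le> k" using L k by (auto simp: L_def)
  let ?N = "real (card E)"
  define \<pi> where "\<pi> = (\<Prod>i<k. (?N - real s - real i) / (?N - real i))"
  define z where "z = real s / (?N - k)"
  have N: "?N - k = k * (real n - 1)" by (simp add: card_E algebra_simps)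
  have Nk: "?N - k > 0" unfolding N using k_pos n by simp
  have s2: "real s \<le> 61/64 * L * (real n - 1)"
  proof -
    have "128 * L \<le> n * L" using n Lk by (intro mult_right_mono) auto
    moreover have "61/64 * L * (real n - 1) = 61/64 * (n * L) - 61/64 * L" by (simp add: field_simps)
    moreover have "15/16 * n * ln n = 15/16 * (n * L)" by (simp add: L_def)
    ultimately show ?thesis using s Lk by linarith
  qed
  have kz: "k * z \<le> 61/64 * L"
  proof -
    have "k * z = real s / (real n - 1)" unfolding z_def N using k_pos by simp
    thus ?thesis using s2 n by (simp add: pos_divide_le_eq)
  qed
  have z: "0 \<le> z" "z \<le> 1/256"
  proof -
    show "0 \<le> z" using Nk by (simp add: z_def)
    have "k * z \<le> k * (1/256)" using kz Lk by linarith
    thus "z \<le> 1/256" using k_pos by simp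
  qed
  have "(1 - z) ^ k \<le> \<pi>"
  proof -
    have "(\<Prod>i<k. 1 - z) \<le> \<pi>" unfolding \<pi>_def
    proof (intro prod_mono conjI)
      fix i assume i: "i \<in> {..<k}"
      have "s / (?N - i) \<le> z" unfolding z_def using i Nk by (intro divide_left_mono) auto
      moreover have "(?N - real s - real i) / (?N - real i) = 1 - s / (?N - i)"
        using i Nk by (simp add: field_simps)
      ultimately show "1 - z \<le> (?N - real s - real i) / (?N - real i)" by simp
    qed (use z in auto)
    thus ?thesis by simp
  qed
  moreover have "exp (- (123/128 * L)) \<le> (1 - z) ^ k"
  proof -
    have "- z - 2 * z\<^sup>2 \<le> ln (1 - z)" using z by (intro ln_one_minus_pos_lower_bound) auto
    hence "exp (- z - 2 * z\<^sup>2) \<le> exp (ln (1 - z))" by (simp only: exp_le_cancel_iff)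
    also have "\<dots> = 1 - z" using z by simp
    finally have "exp (- z - 2 * z\<^sup>2) \<le> 1 - z" .
    hence "exp (- z - 2 * z\<^sup>2) ^ k \<le> (1 - z) ^ k" by (intro power_mono) auto
    moreover have "exp (- z - 2 * z\<^sup>2) ^ k = exp (- (k * z + 2 * (k * z) * z))"
      by (simp add: exp_of_nat_mult[symmetric] power2_eq_square algebra_simps)
    moreover have "exp (- (123/128 * L)) \<le> exp (- (k * z + 2 * (k * z) * z))"
    proof -
      have "(k * z) * z \<le> L * (1/256)" using kz z Lk by (intro mult_mono) auto
      hence "k * z + 2 * (k * z) * z \<le> 123/128 * L" using kz by linarith
      thus ?thesis by simp
    qed
    ultimately show ?thesis by linarith
  qed
  ultimately have \<pi>: "exp (- (123/128 * L)) \<le> \<pi>" by linarith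
  have \<pi>_pos: "\<pi> > 0" using \<pi> by (rule less_le_trans[OF exp_gt_zero])
  have cA: "card A = n" using bipartite_sides[OF A] by simp
  have sN: "s + 2 * k \<le> card E"
  proof -
    have "L * (real n - 1) \<le> k / 256 * n" using Lk n by (intro mult_mono) auto
    moreover have "real k * 128 \<le> real k * n" using n by (intro mult_left_mono) auto
    moreover have "0 \<le> L * (real n - 1)" using Lk n by simp
    ultimately have "real s + 2 * real k \<le> real n * real k" using s2 by (simp only: mult.assoc mult.commute[of "real n" "real k"])
    hence "real (s + 2 * k) \<le> real (n * k)" by simp
    thus ?thesis unfolding card_E by (simp only: of_nat_le_iff)
  qed
  have "process_prob E (\<lambda>xs. no_isolated V (set (take s xs)))
     \<le> process_prob E (\<lambda>xs. \<forall>v\<in>A. {e \<in> E. v \<in> e} \<inter> set (take s xs) \<noteq> {})"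
  proof (rule process_prob_mono[OF finE])
    fix xs assume xs: "xs \<in> permutations_of_set E" and iso: "no_isolated V (set (take s xs))"
    have "set (take s xs) \<subseteq> E" using xs set_take_subset[of s xs] by (auto simp: permutations_of_set_def)
    thus "\<forall>v\<in>A. {e \<in> E. v \<in> e} \<inter> set (take s xs) \<noteq> {}"
      using iso A(1) unfolding no_isolated_def by blast
  qed
  also have "\<dots> \<le> 1 / (real (card A) * \<pi>)"
  proof (rule process_prob_all_hit_le[OF finE _ _ _ sN \<pi>_def \<pi>_pos])
    fix v w assume vw: "v \<in> A" "w \<in> A" "v \<noteq> w"
    show "{e \<in> E. v \<in> e} \<inter> {e \<in> E. w \<in> e} = {}"
    proof (rule ccontr)
      assume "\<not> ?thesis"
      then obtain e where e: "e \<in> E" "v \<in> e" "w \<in> e" by blast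
      have "finite (e \<inter> A)" using A(1) finV by (meson finite_Int finite_subset)
      hence "card {v, w} \<le> card (e \<inter> A)" using vw e by (intro card_mono) auto
      thus False using A(2) e vw by simp
    qed
  qed (use A finV card_incident cA n in \<open>auto intro: finite_subset\<close>)
  also have "\<dots> \<le> 1 / (n * exp (- (123/128 * L)))"
    unfolding cA using \<pi> \<pi>_pos n by (intro divide_left_mono mult_left_mono) auto
  also have "\<dots> = exp (- 5/128 * L)"
  proof -
    have "real n = exp L" using n by (simp add: L_def)
    hence eq: "n * exp (- (123/128 * L)) = exp (5/128 * L)" by (simp only: mult_exp_exp) (simp add: field_simps)
    have "exp (- 5/128 * L) = exp (- (5/128 * L))" by (rule arg_cong) simp
    thus ?thesis unfolding eq by (simp only: exp_minus inverse_eq_divide)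
  qed
  finally show ?thesis by (simp add: L_def)
qed

text \<open>First moment: a star of k edges is avoided with probability at most exp (-t / n). The -1
  makes room for rounding \<open>t\<close> down.\<close>

lemma process_prob_isolated_le:
  assumes t: "t \<le> card E" "2 * ln n - 1 \<le> t / n"
  shows "process_prob E (\<lambda>xs. \<not> no_isolated V (set (take t xs))) \<le> 2 * n * exp (1 - 2 * ln n)"
proof (cases "n = 0")
  case True
  hence "V = {}" using finV cardV by simp
  thus ?thesis by (simp add: process_prob_def no_isolated_def)
next
  case False
  let ?X = "\<lambda>v. {e \<in> E. v \<in> e}"
  have "process_prob E (\<lambda>xs. \<not> no_isolated V (set (take t xs)))
     \<le> process_prob E (\<lambda>xs. \<exists>v\<in>V. ?X v \<inter> set (take t xs) = {} \<and> {} \<subseteq> set (take t xs))"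
    by (rule process_prob_mono[OF finE]) (auto simp: no_isolated_def)
  also have "\<dots> \<le> (\<Sum>v\<in>V. process_prob E (\<lambda>xs. ?X v \<inter> set (take t xs) = {} \<and> {} \<subseteq> set (take t xs)))"
    by (rule process_prob_UN[OF finV])
  also have "\<dots> \<le> (\<Sum>v\<in>V. exp (1 - 2 * ln n))"
  proof (rule sum_mono)
    fix v assume v: "v \<in> V"
    have "process_prob E (\<lambda>xs. ?X v \<inter> set (take t xs) = {} \<and> {} \<subseteq> set (take t xs))
       \<le> (real t / real (card E)) ^ card ({} :: nat set set) * exp (- (t / card E)) ^ card (?X v)"
    proof (rule process_prob_avoid_hit_le[OF finE])
      have "(real (card E) - real t) / (real (card E) - real (card ({} :: nat set set))) = 1 + - (t / card E)"
        using False k_pos by (simp add: card_E field_simps)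
      also have "\<dots> \<le> exp (- (t / card E))" by (rule exp_ge_add_one_self)
      finally show "(real (card E) - real t) / (real (card E) - real (card ({} :: nat set set))) \<le> exp (- (t / card E))" .
    qed (use t in auto)
    also have "\<dots> = exp (- (t / n))"
      using card_incident[OF v] k_pos by (simp add: card_E exp_of_nat_mult[symmetric])
    also have "\<dots> \<le> exp (1 - 2 * ln n)" using t(2) by simp
    finally show "process_prob E (\<lambda>xs. ?X v \<inter> set (take t xs) = {} \<and> {} \<subseteq> set (take t xs)) \<le> exp (1 - 2 * ln n)" .
  qed
  finally show ?thesis using cardV by simp
qed

lemma process_prob_hitting_times:
  assumes A: "A \<subseteq> V" "\<forall>e\<in>E. card (e \<inter> A) = 1"
    and n: "128 \<le> n" and L: "100 \<le> ln n" and k: "256 * ln n \<le> k" "50 * (real n / k) \<le> ln n powr (1/3)"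
  shows "process_prob E (\<lambda>xs. tau_M V xs = tau_I V xs) \<ge> 1 -
    (exp (- 5/128 * ln n) + 2 * n * exp (1 - 2 * ln n) + (4 * exp (- 7/2)) ^ n + (\<Sum>j=1..n. rate n ^ j))"
proof -
  define nL where "nL = n * ln n"
  \<comment> \<open>About n^(1 - c) vertices of each side are expected to be isolated after c n ln n
    edges, so c = 15/16 and c = 2 enclose the hitting time.\<close>
  define s where "s = nat \<lceil>15/16 * nL\<rceil>"
  define t where "t = nat \<lfloor>2 * nL\<rfloor>"
  \<comment> \<open>Prescribing up to n ln n / 16 edges lowers the exponent of \<open>q\<close> from
    15/16 to 7/8.\<close>
  define y0 where "y0 = nat \<lfloor>nL / 16\<rfloor>"
  define p where "p = real t / card E"
  define q where "q = exp (- (7/8) * ln n / k)"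
  have nL: "nL \<ge> 128 * 100" unfolding nL_def using n L by (intro mult_mono) auto
  have s: "15/16 * nL \<le> s" "s \<le> 15/16 * nL + 1" and t: "t \<le> 2 * nL" "2 * nL - 1 \<le> t"
    and y0: "y0 \<le> nL / 16" "nL / 16 - 1 \<le> y0"
    using nL unfolding s_def t_def y0_def by linarith+
  have N: "256 * nL \<le> card E"
  proof -
    have "n * (256 * ln n) \<le> n * real k" using k(1) by (intro mult_left_mono) auto
    thus ?thesis by (simp add: card_E nL_def)
  qed
  have "real t \<le> real (card E)" using t nL N by linarith
  hence tN: "t \<le> card E" by simp
  have "real s \<le> real (card E)" using s nL N by linarith
  hence sN: "s \<le> card E" by simp
  have "real y0 \<le> real s" using y0 s nL by linarith
  hence ys: "y0 \<le> s" by simp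
  have k_le: "k \<le> n"
  proof -
    have cA: "card A = n" "card (V - A) = n" using bipartite_sides[OF A] by auto
    then obtain v where v: "v \<in> A" using n by fastforce
    have "nb v \<subseteq> V - A" using bipartite_nb[OF A(2)] v nb_subset by blast
    hence "card (nb v) \<le> card (V - A)" using finV by (intro card_mono) auto
    thus ?thesis using card_nb[of v] v A(1) cA by auto
  qed
  interpret regular_graph_process V E n k p q s t y0
  proof unfold_locales
    show "0 \<le> p" by (simp add: p_def)
    show "p * k \<le> 2 * ln n"
      using t(1) n k_pos by (simp add: p_def card_E nL_def field_simps)
    fix X Y assume XY: "X \<subseteq> E" "Y \<subseteq> E" "X \<inter> Y = {}" "card Y \<le> y0"
    show "process_prob E (\<lambda>xs. X \<inter> set (take s xs) = {} \<and> Y \<subseteq> set (take t xs)) \<le> p ^ card Y * q ^ card X"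
    proof (rule process_prob_avoid_hit_le[OF finE XY(1-3) tN _ sN])
      let ?y = "real (card Y)" let ?N = "real (card E)"
      have y: "?y \<le> y0" using XY(4) by simp
      have yN: "?N - ?y > 0" using y y0 N nL by linarith
      have "(?N - s) / (?N - ?y) = 1 - (s - ?y) / (?N - ?y)" using yN by (simp add: field_simps)
      also have "\<dots> \<le> 1 - (7/8 * nL) / ?N"
      proof -
        have "(7/8 * nL) / ?N \<le> (s - ?y) / (?N - ?y)"
          using y y0 s yN nL by (intro frac_le) auto
        thus ?thesis by simp
      qed
      also have "(7/8 * nL) / ?N = 7/8 * ln n / k" using n by (simp add: nL_def card_E)
      also have "1 - 7/8 * ln n / k \<le> q"
        unfolding q_def using exp_ge_add_one_self[of "- (7/8) * ln n / k"] by simp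
      finally show "(?N - s) / (?N - ?y) \<le> q" .
    qed (use XY(4) ys in \<open>auto simp: p_def\<close>)
  qed (use L in \<open>auto simp: q_def\<close>)
  have y0_large: "60 * (n / ln n) \<le> y0"
  proof -
    have "60 * n \<le> n * ln n" using mult_right_mono[of 60 "ln n" "real n"] L by (simp add: mult.commute)
    hence "60 * (n / ln n) \<le> n" using L by (simp add: pos_divide_le_eq)
    moreover have "real n * 100 \<le> nL" unfolding nL_def using L by (intro mult_left_mono) auto
    ultimately show ?thesis using y0 n by linarith
  qed
  have "process_prob E (\<lambda>xs. tau_M V xs \<noteq> tau_I V xs)
     \<le> process_prob E (\<lambda>xs. (no_isolated V (set (take s xs)) \<or> \<not> no_isolated V (set (take t xs))) \<or>
         (\<exists>I. obstruction (set (take s xs)) (set (take t xs)) I))"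
    using not_hitting_simultaneously[OF A] by (intro process_prob_mono[OF finE]) metis
  also have "\<dots> \<le> process_prob E (\<lambda>xs. no_isolated V (set (take s xs)) \<or> \<not> no_isolated V (set (take t xs)))
     + process_prob E (\<lambda>xs. \<exists>I. obstruction (set (take s xs)) (set (take t xs)) I)"
    by (rule process_prob_disj)
  also have "process_prob E (\<lambda>xs. no_isolated V (set (take s xs)) \<or> \<not> no_isolated V (set (take t xs)))
     \<le> process_prob E (\<lambda>xs. no_isolated V (set (take s xs))) + process_prob E (\<lambda>xs. \<not> no_isolated V (set (take t xs)))"
    by (rule process_prob_disj)
  also have "process_prob E (\<lambda>xs. no_isolated V (set (take s xs))) \<le> exp (- 5/128 * ln n)"
    using s(2) L k n by (intro process_prob_no_isolated_le[OF A]) (auto simp: nL_def)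
  also have "process_prob E (\<lambda>xs. \<not> no_isolated V (set (take t xs))) \<le> 2 * n * exp (1 - 2 * ln n)"
  proof (rule process_prob_isolated_le[OF tN])
    have "n * (2 * ln n - 1) \<le> t" using t(2) n by (simp add: nL_def algebra_simps)
    thus "2 * ln n - 1 \<le> t / n" using n by (simp add: pos_le_divide_eq mult.commute)
  qed
  also have "process_prob E (\<lambda>xs. \<exists>I. obstruction (set (take s xs)) (set (take t xs)) I)
     \<le> (4 * exp (- 7/2)) ^ n + (\<Sum>j=1..n. rate n ^ j)"
    by (rule process_prob_obstruction[OF k_le k(2) y0_large])
  finally show ?thesis
    using process_prob_not[OF finE, of "\<lambda>xs. tau_M V xs = tau_I V xs"] by simp
qed

end

section \<open>Limits of the error terms\<close>

lemma sum_powers_tendsto_0: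
  fixes r :: "nat \<Rightarrow> real"
  assumes r: "r \<longlonglongrightarrow> 0" "eventually (\<lambda>n. r n \<ge> 0) sequentially"
  shows "(\<lambda>n. \<Sum>j=1..n. r n ^ j) \<longlonglongrightarrow> 0"
proof (rule tendsto_sandwich[where f = "\<lambda>_. 0" and h = "\<lambda>n. 2 * r n"])
  have "eventually (\<lambda>n. r n < 1/2) sequentially" using order_tendstoD(2)[OF r(1), of "1/2"] by simp
  thus "\<forall>\<^sub>F n in sequentially. (\<Sum>j=1..n. r n ^ j) \<le> 2 * r n"
    using r(2)
  proof eventually_elim
    case (elim n)
    \<comment> \<open>The subtracted term makes the induction go through, by r \<le> 1/2.\<close>
    have "(\<Sum>j=1..m. r n ^ j) \<le> 2 * r n - 2 * r n ^ Suc m" for m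
    proof (induction m)
      case (Suc m)
      have "2 * r n * r n ^ Suc m \<le> 1 * r n ^ Suc m" using elim by (intro mult_right_mono) auto
      thus ?case using Suc by (simp add: mult_ac)
    qed simp
    moreover have "r n ^ Suc n \<ge> 0" using elim(2) by (rule zero_le_power)
    ultimately show ?case by (smt (verit))
  qed
  show "(\<lambda>n. 2 * r n) \<longlonglongrightarrow> 0" using tendsto_mult_right_zero[OF r(1)] .
  show "eventually (\<lambda>n. 0 \<le> (\<Sum>j=1..n. r n ^ j)) sequentially"
    using r(2) by eventually_elim (auto intro: sum_nonneg)
qed auto

lemma rate_tendsto_0: "rate \<longlonglongrightarrow> 0"
proof -
  \<comment> \<open>The constant factors of \<open>rate\<close> are split off, so that the
    asymptotic part is free of huge numerals.\<close>
  have "(\<lambda>n. ln (real n) * 2 powr (5 * ln (real n) powr (1/3)) * exp (- ln (real n) / 4) * ln (real n) ^ 20) \<longlonglongrightarrow> 0"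
    by real_asymp
  hence "(\<lambda>n. (516 * 2 ^ 256 * exp 134) * (ln (real n) * 2 powr (5 * ln (real n) powr (1/3)) * exp (- ln (real n) / 4) * ln (real n) ^ 20)) \<longlonglongrightarrow> 0"
    by (rule tendsto_mult_right_zero)
  moreover have "rate = (\<lambda>n. (516 * 2 ^ 256 * exp 134) * (ln (real n) * 2 powr (5 * ln (real n) powr (1/3)) * exp (- ln (real n) / 4) * ln (real n) ^ 20))"
    unfolding rate_def by (simp only: mult_ac)
  ultimately show ?thesis by (simp only:)
qed

theorem theorem1p1:
  fixes k :: "nat \<Rightarrow> nat" and G :: "nat \<Rightarrow> nat set set"
  assumes "filterlim (\<lambda>n. real (k n) * ln (real n) powr (1/3) / real n) at_top sequentially"
    and "eventually (\<lambda>n. simple_graph {..<2*n} (G n) \<and> bipartite {..<2*n} (G n)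
                         \<and> regular {..<2*n} (G n) (k n)) sequentially"
  shows "(\<lambda>n. process_prob (G n) (\<lambda>xs. tau_M {..<2*n} xs = tau_I {..<2*n} xs))
           \<longlonglongrightarrow> 1"
proof (rule tendsto_sandwich)
  let ?err = "\<lambda>n. exp (- 5/128 * ln n) + 2 * n * exp (1 - 2 * ln n) + (4 * exp (- 7/2)) ^ n + (\<Sum>j=1..n. rate n ^ j)"
  \<comment> \<open>The constant 50 is that of \<open>k_large\<close>. It gives k at least 50 n /
    (ln n)^(1/3), which eventually exceeds 256 ln n.\<close>
  have large: "eventually (\<lambda>n. real (k n) * ln (real n) powr (1/3) / real n \<ge> 50) sequentially"
    using assms(1) by (simp add: filterlim_at_top)
  have "eventually (\<lambda>n::nat. 50 * n / ln n powr (1/3) \<ge> 256 * ln n) sequentially"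
    "eventually (\<lambda>n::nat. ln n \<ge> 100) sequentially" by real_asymp+
  thus "eventually (\<lambda>n. 1 - ?err n \<le> process_prob (G n) (\<lambda>xs. tau_M {..<2*n} xs = tau_I {..<2*n} xs)) sequentially"
    using large assms(2) eventually_ge_at_top[of 128]
  proof eventually_elim
    case (elim n)
    define c where "c = ln (real n) powr (1/3)"
    have c: "c > 0" using elim(2) by (simp add: c_def)
    have kc: "50 * real n \<le> k n * c" using elim(3,5) by (simp add: c_def field_simps)
    have "50 * n / c \<le> k n" using kc c by (simp add: field_simps)
    hence k1: "256 * ln n \<le> k n" using elim(1) unfolding c_def by linarith
    hence "real (k n) > 0" using elim(2) by linarith
    hence kpos: "k n > 0" and k2: "50 * (real n / k n) \<le> ln n powr (1/3)"
      using kc unfolding c_def by (auto simp: field_simps)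
    interpret regular_graph "{..<2*n}" "G n" n "k n"
      by unfold_locales (use elim(4) kpos in auto)
    obtain A where A: "A \<subseteq> {..<2*n}" "\<forall>e\<in>G n. card (e \<inter> A) = 1"
      using elim(4) by (auto simp: bipartite_def)
    show ?case using process_prob_hitting_times[OF A elim(5,2) k1 k2] by simp
  qed
  have "\<forall>\<^sub>F n in sequentially. rate n \<ge> 0"
    using eventually_ge_at_top[of 1] by eventually_elim (simp add: rate_def)
  hence "(\<lambda>n. \<Sum>j=1..n. rate n ^ j) \<longlonglongrightarrow> 0" by (intro sum_powers_tendsto_0 rate_tendsto_0)
  moreover have "(\<lambda>n. (4 * exp (- 7/2)) ^ n :: real) \<longlonglongrightarrow> 0"
  proof (rule LIMSEQ_power_zero)
    have "(1 + 7/2 :: real) \<le> exp (7/2)" by (rule exp_ge_add_one_self)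
    hence "4 < exp (7/2 :: real)" by linarith
    thus "norm (4 * exp (- 7/2) :: real) < 1" by (simp add: exp_minus field_simps)
  qed
  moreover have "(\<lambda>n::nat. exp (- 5/128 * ln n) + 2 * n * exp (1 - 2 * ln n) :: real) \<longlonglongrightarrow> 0" by real_asymp
  ultimately have "?err \<longlonglongrightarrow> 0 + 0 + 0" by (intro tendsto_add)
  thus "(\<lambda>n. 1 - ?err n) \<longlonglongrightarrow> 1" using tendsto_diff[OF tendsto_const, of ?err 0 sequentially 1] by simp
  have "process_prob E Q \<le> 1" for E Q
  proof -
    have "card {xs \<in> permutations_of_set E. Q xs} \<le> card (permutations_of_set E)" by (intro card_mono) auto
    thus ?thesis unfolding process_prob_def
      by (cases "card (permutations_of_set E)") (simp_all add: divide_le_eq_1 del: card_permutations_of_set)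
  qed
  thus "eventually (\<lambda>n. process_prob (G n) (\<lambda>xs. tau_M {..<2*n} xs = tau_I {..<2*n} xs) \<le> 1) sequentially"
    by simp
qed auto

end
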